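(* Let $f$ be either $\gamma$ or $i$. Suppose $\mathcal{G}$ is a hereditary class of graphs such that whenever $G\in\mathcal{G}$ has at least one edge, there is a vertex $v$ of $G$ with $f(G)\le f(G-v)$. Then for every $G\in\mathcal{G}$ with $n$ vertices, $\operatorname{pd}(G)\le n-f(G)$. If $f=i$, then for every $G\in\mathcal{G}$ with $n$ vertices, \[\operatorname{pd}(G)=n-i(G)=\operatorname{bight}(I(G)),\] and $S/I(G)$ is Cohen–Macaulay if and only if it is unmixed.
   Context: All graphs are finite and simple. A class of graphs is hereditary if it is closed under deleting a vertex (passing to the induced subgraph on the remaining vertices). A set $A\subseteq V(G)$ is dominating if every vertex not in $A$ has a neighbor in $A$; $\gamma(G)$ is the minimum size of a dominating set and $i(G)$ the minimum size of an independent dominating set ($\gamma=i=0$ for the empty graph). For $G$ with vertex set $\{x_1,\dots,x_n\}$ and a fixed field $\mathbf{k}$, $S=\mathbf{k}[x_1,\dots,x_n]$, $I(G)$ is the edge ideal generated by $x_ix_j$ over edges $(x_i,x_j)$, $\operatorname{pd}(G)$ is the projective dimension of $S/I(G)$, and $\operatorname{bight}(I(G))$ (big height) is the maximum height of a minimal prime of $I(G)$, equivalently the maximum size of a minimal vertex cover of $G$. $S/I(G)$ is unmixed if all minimal primes (equivalently, all associated primes) of $I(G)$ have the same height. *)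

theory Defs
  imports "HOL-Library.Poly_Mapping"
begin

type_synonym 'v graph = "'v set \<times> 'v set set"

definition is_graph :: "'v graph \<Rightarrow> bool" where
  "is_graph G \<longleftrightarrow> finite (fst G) \<and> (\<forall>e\<in>snd G. e \<subseteq> fst G \<and> card e = 2)"

definition del_vertex :: "'v graph \<Rightarrow> 'v \<Rightarrow> 'v graph" where
  "del_vertex G v = (fst G - {v}, {e\<in>snd G. v \<notin> e})"

definition hereditary :: "'v graph set \<Rightarrow> bool" where
  "hereditary \<G> \<longleftrightarrow> (\<forall>G\<in>\<G>. \<forall>v\<in>fst G. del_vertex G v \<in> \<G>)"

definition adj :: "'v graph \<Rightarrow> 'v \<Rightarrow> 'v \<Rightarrow> bool" where
  "adj G u w \<longleftrightarrow> {u, w} \<in> snd G \<and> u \<noteq> w"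

definition dominating :: "'v graph \<Rightarrow> 'v set \<Rightarrow> bool" where
  "dominating G A \<longleftrightarrow> A \<subseteq> fst G \<and> (\<forall>x\<in>fst G - A. \<exists>a\<in>A. adj G x a)"

definition independent :: "'v graph \<Rightarrow> 'v set \<Rightarrow> bool" where
  "independent G A \<longleftrightarrow> A \<subseteq> fst G \<and> (\<forall>a\<in>A. \<forall>b\<in>A. \<not> adj G a b)"

definition dom_num :: "'v graph \<Rightarrow> nat" where
  "dom_num G = (LEAST k. \<exists>A. dominating G A \<and> card A = k)"

definition indep_dom_num :: "'v graph \<Rightarrow> nat" where
  "indep_dom_num G = (LEAST k. \<exists>A. dominating G A \<and> independent G A \<and> card A = k)"

type_synonym ('v, 'k) mpoly = "('v \<Rightarrow>\<^sub>0 nat) \<Rightarrow>\<^sub>0 'k"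

definition polyring :: "'v set \<Rightarrow> ('v, 'k::field) mpoly set" where
  "polyring V = {p :: ('v, 'k) mpoly. \<forall>m\<in>Poly_Mapping.keys p. Poly_Mapping.keys m \<subseteq> V}"

definition Var :: "'v \<Rightarrow> ('v, 'k::field) mpoly" where
  "Var v = Poly_Mapping.single (Poly_Mapping.single v 1) 1"

definition is_ideal :: "'v set \<Rightarrow> ('v, 'k::field) mpoly set \<Rightarrow> bool" where
  "is_ideal V J \<longleftrightarrow> J \<subseteq> polyring V \<and> 0 \<in> J \<and> (\<forall>a\<in>J. \<forall>b\<in>J. a + b \<in> J)
     \<and> (\<forall>r\<in>polyring V. \<forall>a\<in>J. r * a \<in> J)"

definition is_prime :: "'v set \<Rightarrow> ('v, 'k::field) mpoly set \<Rightarrow> bool" where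
  "is_prime V P \<longleftrightarrow> is_ideal V P \<and> P \<noteq> polyring V
     \<and> (\<forall>a\<in>polyring V. \<forall>b\<in>polyring V. a * b \<in> P \<longrightarrow> a \<in> P \<or> b \<in> P)"

definition ideal_plus :: "'v set \<Rightarrow> ('v, 'k::field) mpoly set \<Rightarrow> (nat \<Rightarrow> ('v, 'k) mpoly) \<Rightarrow> nat
    \<Rightarrow> ('v, 'k) mpoly set" where
  "ideal_plus V J a t = {q + (\<Sum>j<t. c j * a j) | q c. q \<in> J \<and> (\<forall>j<t. c j \<in> polyring V)}"

definition edge_ideal :: "'v graph \<Rightarrow> ('v, 'k::field) mpoly set" where
  "edge_ideal G = {\<Sum>e\<in>snd G. c e * (\<Prod>v\<in>e. Var v) | c. \<forall>e\<in>snd G. c e \<in> polyring (fst G)}"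

definition freemod :: "'v set \<Rightarrow> nat \<Rightarrow> (nat \<Rightarrow> ('v, 'k::field) mpoly) set" where
  "freemod V r = {x. (\<forall>j<r. x j \<in> polyring V) \<and> (\<forall>j\<ge>r. x j = 0)}"

definition matapp :: "nat \<Rightarrow> nat \<Rightarrow> (nat \<Rightarrow> nat \<Rightarrow> ('v, 'k::field) mpoly)
    \<Rightarrow> (nat \<Rightarrow> ('v, 'k) mpoly) \<Rightarrow> nat \<Rightarrow> ('v, 'k) mpoly" where
  "matapp rows cols A x = (\<lambda>i. if i < rows then (\<Sum>j<cols. A i j * x j) else 0)"

text \<open>A free resolution of length m of S_V/J:
   0 \<rightarrow> S^{r m} \<rightarrow> ... \<rightarrow> S^{r 1} \<rightarrow> S^{r 0} \<rightarrow> S/J \<rightarrow> 0,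
  where d k : S^{r k} \<rightarrow> S^{r (k-1)} (1 \<le> k \<le> m) is given by a matrix and the
  augmentation S^{r 0} \<rightarrow> S/J sends the j-th basis vector to g j + J.\<close>
definition free_resolution :: "'v set \<Rightarrow> ('v, 'k::field) mpoly set \<Rightarrow> nat \<Rightarrow> (nat \<Rightarrow> nat)
    \<Rightarrow> (nat \<Rightarrow> nat \<Rightarrow> nat \<Rightarrow> ('v, 'k) mpoly) \<Rightarrow> (nat \<Rightarrow> ('v, 'k) mpoly) \<Rightarrow> bool" where
  "free_resolution V J m r d g \<longleftrightarrow>
     (\<forall>j<r 0. g j \<in> polyring V)
   \<and> (\<forall>k\<in>{1..m}. \<forall>i<r (k - 1). \<forall>j<r k. d k i j \<in> polyring V)
   \<comment> \<open>augmentation surjective\<close>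
   \<and> (\<forall>p\<in>polyring V. \<exists>x\<in>freemod V (r 0). (\<Sum>j<r 0. x j * g j) - p \<in> J)
   \<comment> \<open>exactness at S^{r 0}\<close>
   \<and> (\<forall>x\<in>freemod V (r 0). ((\<Sum>j<r 0. x j * g j) \<in> J) \<longleftrightarrow>
         (if m = 0 then x = (\<lambda>_. 0) else (\<exists>y\<in>freemod V (r 1). x = matapp (r 0) (r 1) (d 1) y)))
   \<comment> \<open>exactness at S^{r k}, 0 < k < m\<close>
   \<and> (\<forall>k. 0 < k \<and> k < m \<longrightarrow> (\<forall>x\<in>freemod V (r k).
         matapp (r (k - 1)) (r k) (d k) x = (\<lambda>_. 0) \<longleftrightarrow>
         (\<exists>y\<in>freemod V (r (k + 1)). x = matapp (r k) (r (k + 1)) (d (k + 1)) y)))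
   \<comment> \<open>injectivity of the last map\<close>
   \<and> (0 < m \<longrightarrow> (\<forall>x\<in>freemod V (r m).
         matapp (r (m - 1)) (r m) (d m) x = (\<lambda>_. 0) \<longrightarrow> x = (\<lambda>_. 0)))"

definition proj_dim :: "'v set \<Rightarrow> ('v, 'k::field) mpoly set \<Rightarrow> nat" where
  "proj_dim V J = (LEAST m. \<exists>r d g. free_resolution V J m r d g)"

definition pd :: "'k::field itself \<Rightarrow> 'v graph \<Rightarrow> nat" where
  "pd TYPE('k) G = proj_dim (fst G) (edge_ideal G :: ('v, 'k) mpoly set)"

definition prime_chain :: "'v set \<Rightarrow> nat \<Rightarrow> (nat \<Rightarrow> ('v, 'k::field) mpoly set) \<Rightarrow> bool" where
  "prime_chain V t P \<longleftrightarrow> (\<forall>i\<le>t. is_prime V (P i)) \<and> (\<forall>i<t. P i \<subset> P (i + 1))"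

definition height :: "'v set \<Rightarrow> ('v, 'k::field) mpoly set \<Rightarrow> nat" where
  "height V Q = Sup {t. \<exists>P. prime_chain V t P \<and> P t = Q}"

definition minimal_primes :: "'v set \<Rightarrow> ('v, 'k::field) mpoly set \<Rightarrow> ('v, 'k) mpoly set set" where
  "minimal_primes V J = {P. is_prime V P \<and> J \<subseteq> P \<and> (\<forall>Q. is_prime V Q \<and> J \<subseteq> Q \<and> Q \<subseteq> P \<longrightarrow> Q = P)}"

definition bight :: "'v set \<Rightarrow> ('v, 'k::field) mpoly set \<Rightarrow> nat" where
  "bight V J = Sup (height V ` minimal_primes V J)"

definition unmixed :: "'v set \<Rightarrow> ('v, 'k::field) mpoly set \<Rightarrow> bool" where
  "unmixed V J \<longleftrightarrow> (\<forall>P\<in>minimal_primes V J. \<forall>Q\<in>minimal_primes V J. height V P = height V Q)"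

definition krull_dim :: "'v set \<Rightarrow> ('v, 'k::field) mpoly set \<Rightarrow> nat" where
  "krull_dim V J = Sup {t. \<exists>P. prime_chain V t P \<and> J \<subseteq> P 0}"

text \<open>The homogeneous maximal ideal m = (x_v : v \<in> V).\<close>
definition max_ideal :: "'v set \<Rightarrow> ('v, 'k::field) mpoly set" where
  "max_ideal V = {p \<in> polyring V. Poly_Mapping.lookup p 0 = 0}"

definition regular_seq :: "'v set \<Rightarrow> ('v, 'k::field) mpoly set \<Rightarrow> (nat \<Rightarrow> ('v, 'k) mpoly) \<Rightarrow> nat \<Rightarrow> bool" where
  "regular_seq V J a t \<longleftrightarrow> (\<forall>i<t. a i \<in> max_ideal V)
     \<and> (\<forall>i<t. \<forall>b\<in>polyring V. a i * b \<in> ideal_plus V J a i \<longrightarrow> b \<in> ideal_plus V J a i)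
     \<and> ideal_plus V J a t \<noteq> polyring V"

definition depth :: "'v set \<Rightarrow> ('v, 'k::field) mpoly set \<Rightarrow> nat" where
  "depth V J = Sup {t. \<exists>a. regular_seq V J a t}"

text \<open>S/J (J homogeneous) is Cohen--Macaulay iff depth_m(S/J) = dim(S/J).\<close>
definition cohen_macaulay :: "'v set \<Rightarrow> ('v, 'k::field) mpoly set \<Rightarrow> bool" where
  "cohen_macaulay V J \<longleftrightarrow> depth V J = krull_dim V J"

end

theory Submission
  imports Defs "HOL-Library.FuncSet"
begin

text \<open>
  Fix a finite vertex set \<open>V\<close> and consider, for a graph \<open>H\<close> and a set \<open>W\<close> of further variables in \<open>V\<close>,
  the ideal \<open>J = I(H) + (W)\<close>. For a vertex \<open>v\<close> of \<open>H\<close> the ideals \<open>(J : v)\<close> and \<open>(J, v)\<close> are again of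
  this kind, for the graphs \<open>H - N[v]\<close> and \<open>H - v\<close>. In the exact sequence
  \<open>0 \<rightarrow> S/(J : v) \<rightarrow> S/J \<rightarrow> S/(J, v) \<rightarrow> 0\<close> both an upper bound for the length of a free resolution and
  the regularity of a fixed sequence pass from the outer terms to the middle one. Since
  \<open>f(H) \<le> f(H - N[v]) + 1\<close> always holds and \<open>f(H) \<le> f(H - v)\<close> for a suitable \<open>v\<close>, induction gives
  \<open>pd \<le> n - f\<close>, and shows that the elementary symmetric polynomials \<open>e\<^sub>1, \<dots>, e\<^sub>f\<close> in all variables
  form a regular sequence on \<open>S/I(G)\<close>.

  For \<open>f = i\<close>, let \<open>A\<close> be an independent dominating set of size \<open>i\<close>. The monomial \<open>x\<^sub>A\<close> is nonzero in
  \<open>S/I(G)\<close> and is killed by the \<open>n - i\<close> variables outside \<open>A\<close>, so \<open>Tor\<close> against these variables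
  does not vanish in degree \<open>n - i\<close>; hence \<open>pd \<ge> n - i\<close>, and depth sensitivity of Koszul homology
  gives \<open>depth \<le> i\<close>. Heights and dimension are read off from the minimal vertex covers, once chains
  of primes in \<open>S\<close> are known to have length at most \<open>n\<close>.
\<close>

text \<open>A sequence passes from the outer terms to the middle one only if the same sequence is
  regular on both, so one sequence has to serve all the quotients by variables that remain once the
  edges are gone. General linear forms would do over an infinite field, but a finite field may have
  too few coefficients. The elementary symmetric polynomials exist over every field, and modulo the
  variables in \<open>W\<close> the one of degree |V - W| is the product of all remaining variables;
  this makes them regular on every such quotient at once. The set \<open>W\<close> keeps all ideals
  of the induction in one polynomial ring.

  Projective dimension and depth are each bounded from both sides directly, without a formula that
  connects them. For the last claim, complements of minimal vertex covers are exactly the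
  independent dominating sets. Hence n - i is the size of a largest minimal cover, while the
  dimension is governed by a smallest cover, and depth equals dimension precisely when all minimal
  covers have the same size.\<close>

abbreviation keys :: "('a \<Rightarrow>\<^sub>0 'b::zero) \<Rightarrow> 'a set" where
  "keys \<equiv> Poly_Mapping.keys"

abbreviation lookup :: "('a \<Rightarrow>\<^sub>0 'b::zero) \<Rightarrow> 'a \<Rightarrow> 'b" where
  "lookup \<equiv> Poly_Mapping.lookup"

abbreviation single :: "'a \<Rightarrow> 'b::zero \<Rightarrow> 'a \<Rightarrow>\<^sub>0 'b" where
  "single \<equiv> Poly_Mapping.single"

section \<open>Polynomials\<close>

lemma keys_plus_nat: "keys (m + n :: 'a \<Rightarrow>\<^sub>0 nat) = keys m \<union> keys n"
  by (auto simp: in_keys_iff lookup_add)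

lemma monomial_split:
  fixes m :: "'a \<Rightarrow>\<^sub>0 nat"
  assumes "v \<in> keys m"
  shows "single v 1 + (m - single v 1) = m"
  using assms
  by (intro poly_mapping_eqI) (auto simp: lookup_add lookup_minus lookup_single when_def in_keys_iff)

definition mdeg :: "('a \<Rightarrow>\<^sub>0 nat) \<Rightarrow> nat" where
  "mdeg m = (\<Sum>v\<in>keys m. lookup m v)"

lemma mdeg_superset:
  assumes "finite A" "keys m \<subseteq> A"
  shows "mdeg m = (\<Sum>v\<in>A. lookup m v)"
  unfolding mdeg_def using assms
  by (intro sum.mono_neutral_left) (auto simp: in_keys_iff)

lemma mdeg_add: "mdeg (m + n) = mdeg m + mdeg n"
proof -
  let ?A = "keys m \<union> keys n"
  have "mdeg (m + n) = (\<Sum>v\<in>?A. lookup (m + n) v)"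
    by (rule mdeg_superset) (auto simp: keys_plus_nat)
  also have "\<dots> = mdeg m + mdeg n"
    by (simp add: lookup_add sum.distrib mdeg_superset[of ?A])
  finally show ?thesis .
qed

lemma mdeg_single [simp]: "mdeg (single v k) = k"
  by (cases "k = 0") (auto simp: mdeg_def)

lemma poly_eq_sum_singles: "p = (\<Sum>m\<in>keys p. single m (lookup p m))"
  by (intro poly_mapping_eqI) (auto simp: lookup_sum lookup_single when_def in_keys_iff)

lemma lookup_times:
  fixes p q :: "('a::comm_monoid_add) \<Rightarrow>\<^sub>0 ('k::comm_semiring_1)"
  shows "lookup (p * q) k =
    (\<Sum>m\<in>keys p. \<Sum>n\<in>keys q. if m + n = k then lookup p m * lookup q n else 0)"
proof -
  have "p * q = (\<Sum>m\<in>keys p. \<Sum>n\<in>keys q. single (m + n) (lookup p m * lookup q n))"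
    by (subst poly_eq_sum_singles[of p], subst poly_eq_sum_singles[of q])
      (simp add: sum_product mult_single)
  then show ?thesis
    by (simp add: lookup_sum lookup_single when_def)
qed

lemma polyringD: "p \<in> polyring V \<Longrightarrow> m \<in> keys p \<Longrightarrow> keys m \<subseteq> V"
  by (auto simp: polyring_def)

lemma polyring_zero [simp]: "0 \<in> polyring V"
  by (simp add: polyring_def)

lemma polyring_one [simp]: "1 \<in> polyring V"
  by (simp add: polyring_def)

lemma polyring_add [intro]: "p \<in> polyring V \<Longrightarrow> q \<in> polyring V \<Longrightarrow> p + q \<in> polyring V"
  using keys_add[of p q] by (fastforce simp: polyring_def)

lemma keys_uminus_eq: "keys (- p) = keys (p :: 'a \<Rightarrow>\<^sub>0 'b::ab_group_add)"
  by (auto simp: in_keys_iff)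

lemma polyring_uminus [intro]: "p \<in> polyring V \<Longrightarrow> - p \<in> polyring V"
  by (auto simp: polyring_def keys_uminus_eq)

lemma polyring_diff [intro]: "p \<in> polyring V \<Longrightarrow> q \<in> polyring V \<Longrightarrow> p - q \<in> polyring V"
  using polyring_add[of p V "- q"] by auto

lemma polyring_mult [intro]: "p \<in> polyring V \<Longrightarrow> q \<in> polyring V \<Longrightarrow> p * q \<in> polyring V"
  using keys_mult[of p q] by (fastforce simp: polyring_def keys_plus_nat)

lemma polyring_sum [intro]: "(\<And>i. i \<in> A \<Longrightarrow> f i \<in> polyring V) \<Longrightarrow> sum f A \<in> polyring V"
  by (induction A rule: infinite_finite_induct) auto

lemma polyring_prod [intro]: "(\<And>i. i \<in> A \<Longrightarrow> f i \<in> polyring V) \<Longrightarrow> prod f A \<in> polyring V"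
  by (induction A rule: infinite_finite_induct) auto

lemma polyring_power [intro]: "p \<in> polyring V \<Longrightarrow> p ^ n \<in> polyring V"
  by (induction n) auto

lemma polyring_single: "keys m \<subseteq> V \<Longrightarrow> single m c \<in> polyring V"
  by (auto simp: polyring_def)

lemma polyring_Var [intro]: "v \<in> V \<Longrightarrow> Var v \<in> polyring V"
  unfolding Var_def by (rule polyring_single) auto

lemma polyring_mono: "U \<subseteq> V \<Longrightarrow> p \<in> polyring U \<Longrightarrow> p \<in> polyring V"
  by (auto simp: polyring_def)

lemma keys_Var: "keys (Var v :: ('v, 'k::field) mpoly) = {single v 1}"
  by (simp add: Var_def)

lemma lookup_Var [simp]: "lookup (Var v :: ('v, 'k::field) mpoly) (single v (Suc 0)) = 1"
  by (simp add: Var_def)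

text \<open>Multiplication by a variable shifts coefficients. The case distinction guards against
  truncated subtraction, which would fix every monomial that does not involve
  \<open>v\<close>.\<close>

lemma lookup_Var_mult:
  "lookup (Var v * p) m = (if v \<in> keys m then lookup p (m - single v 1) else 0)"
proof -
  have inj: "single v (Suc 0) + n = m \<longleftrightarrow> v \<in> keys m \<and> n = m - single v (Suc 0)" for n
    using monomial_split[of v m] by (auto simp: keys_plus_nat)
  have "lookup (Var v * p) m =
      (\<Sum>n\<in>keys p. if single v 1 + n = m then lookup p n else 0)"
    unfolding lookup_times keys_Var by (simp cong: if_cong)
  also have "\<dots> = (\<Sum>n\<in>keys p. if n = m - single v 1 then (if v \<in> keys m then lookup p n else 0) else 0)"
    by (intro sum.cong) (auto simp: inj)
  also have "\<dots> = (if v \<in> keys m then lookup p (m - single v 1) else 0)"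
    by (auto simp: in_keys_iff)
  finally show ?thesis .
qed

lemma Var_mult_cancel: "Var v * p = Var v * q \<Longrightarrow> p = q"
proof (rule poly_mapping_eqI)
  fix m assume "Var v * p = Var v * q"
  then have "lookup (Var v * p) (single v 1 + m) = lookup (Var v * q) (single v 1 + m)"
    by simp
  then show "lookup p m = lookup q m"
    by (simp add: lookup_Var_mult keys_plus_nat)
qed

text \<open>The linear projection onto the span of the monomials satisfying \<open>A\<close>. Three
  choices of \<open>A\<close> matter: small degree (truncation), absence of one variable (setting it
  to zero), and absence of all variables of a set (reduction modulo the prime they
  generate).\<close>

definition filt :: "('a \<Rightarrow> bool) \<Rightarrow> ('a \<Rightarrow>\<^sub>0 'b::comm_monoid_add) \<Rightarrow> 'a \<Rightarrow>\<^sub>0 'b" where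
  "filt A p = (\<Sum>m\<in>{m\<in>keys p. A m}. single m (lookup p m))"

lemma lookup_filt: "lookup (filt A p) m = (if A m then lookup p m else 0)"
  by (auto simp: filt_def lookup_sum lookup_single when_def in_keys_iff)

lemma keys_filt: "keys (filt A p) = {m\<in>keys p. A m}"
  by (auto simp: in_keys_iff lookup_filt split: if_splits)

lemma filt_add: "filt A (p + q) = filt A p + filt A q"
  by (rule poly_mapping_eqI) (simp add: lookup_filt lookup_add)

lemma filt_zero [simp]: "filt A 0 = 0"
  by (rule poly_mapping_eqI) (simp add: lookup_filt)

lemma filt_diff: "filt A (p - q) = filt A p - filt A (q :: _ \<Rightarrow>\<^sub>0 _::ab_group_add)"
  by (rule poly_mapping_eqI) (simp add: lookup_filt lookup_minus)

lemma filt_sum: "filt A (sum f I) = (\<Sum>i\<in>I. filt A (f i))"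
  by (induction I rule: infinite_finite_induct) (simp_all add: filt_add)

lemma filt_eq: "(\<And>m. m \<in> keys p \<Longrightarrow> A m) \<Longrightarrow> filt A p = p"
  by (rule poly_mapping_eqI) (auto simp: lookup_filt in_keys_iff)

lemma filt_polyring: "p \<in> polyring V \<Longrightarrow> filt A p \<in> polyring V"
  by (auto simp: polyring_def keys_filt)

text \<open>The three predicates may differ: cutting a product with a homogeneous factor at degree k
  cuts the other factor at a lower degree. With one predicate throughout, \<open>filt_mult\<close>
  makes the projection a ring homomorphism.\<close>

lemma filt_mult_gen:
  fixes p q :: "('v, 'k::field) mpoly"
  assumes "\<And>m n. m \<in> keys p \<Longrightarrow> n \<in> keys q \<Longrightarrow> A (m + n) \<longleftrightarrow> B m \<and> C n"
  shows "filt A (p * q) = filt B p * filt C q"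
proof -
  have *: "filt A (single m c) = (if A m then single m c else 0)" for A m and c :: 'k
    by (rule poly_mapping_eqI) (auto simp: lookup_filt lookup_single when_def)
  have "filt A (p * q) = filt A (\<Sum>m\<in>keys p. \<Sum>n\<in>keys q. single (m + n) (lookup p m * lookup q n))"
    by (subst poly_eq_sum_singles[of p], subst poly_eq_sum_singles[of q])
      (simp add: sum_product mult_single)
  also have "\<dots> = (\<Sum>m\<in>keys p. \<Sum>n\<in>keys q.
      (if B m then single m (lookup p m) else 0) * (if C n then single n (lookup q n) else 0))"
    unfolding filt_sum by (intro sum.cong refl) (simp add: * assms mult_single)
  also have "\<dots> = filt B (\<Sum>m\<in>keys p. single m (lookup p m)) * filt C (\<Sum>n\<in>keys q. single n (lookup q n))"
    by (simp add: filt_sum sum_product *)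
  finally show ?thesis
    by (simp flip: poly_eq_sum_singles)
qed

lemma filt_mult:
  fixes p q :: "('v, 'k::field) mpoly"
  assumes "\<And>m n. A (m + n) \<longleftrightarrow> A m \<and> A n"
  shows "filt A (p * q) = filt A p * filt A q"
  using assms by (intro filt_mult_gen)

section \<open>The polynomial ring is a domain\<close>

text \<open>Choosing the largest exponent of one variable after another singles out a product
  of monomials that arises in only one way.\<close>
lemma unique_product_aux:
  fixes A B :: "('v \<Rightarrow>\<^sub>0 nat) set"
  assumes "finite V" "finite A" "finite B" "A \<noteq> {}" "B \<noteq> {}"
    and "\<And>m n v. m \<in> A \<Longrightarrow> n \<in> A \<Longrightarrow> v \<notin> V \<Longrightarrow> lookup m v = lookup n v"
    and "\<And>m n v. m \<in> B \<Longrightarrow> n \<in> B \<Longrightarrow> v \<notin> V \<Longrightarrow> lookup m v = lookup n v"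
  shows "\<exists>M\<in>A. \<exists>N\<in>B. \<forall>m\<in>A. \<forall>n\<in>B. m + n = M + N \<longrightarrow> m = M \<and> n = N"
  using assms
proof (induction V arbitrary: A B rule: finite_induct)
  case empty
  then have "\<And>m n. m \<in> A \<Longrightarrow> n \<in> A \<Longrightarrow> m = n" "\<And>m n. m \<in> B \<Longrightarrow> n \<in> B \<Longrightarrow> m = n"
    by (blast intro: poly_mapping_eqI)+
  then show ?case using empty(3,4) by blast
next
  case (insert v V)
  define a where "a = Max ((\<lambda>m. lookup m v) ` A)"
  define b where "b = Max ((\<lambda>m. lookup m v) ` B)"
  define A' where "A' = {m\<in>A. lookup m v = a}"
  define B' where "B' = {m\<in>B. lookup m v = b}"
  have "a \<in> (\<lambda>m. lookup m v) ` A" "b \<in> (\<lambda>m. lookup m v) ` B"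
    unfolding a_def b_def using insert.prems(1-4) by (auto intro!: Max_in)
  then have ne: "A' \<noteq> {}" "B' \<noteq> {}"
    by (auto simp: A'_def B'_def)
  have le: "lookup m v \<le> a" if "m \<in> A" for m
    unfolding a_def using that insert.prems(1-4) by auto
  have le': "lookup m v \<le> b" if "m \<in> B" for m
    unfolding b_def using that insert.prems(1-4) by auto
  \<comment> \<open>Once the exponent of \<open>v\<close> is maximal throughout, it no longer
    distinguishes members, so \<open>v\<close> may leave the set of variables.\<close>
  have agree: "lookup m u = lookup n u" if "m \<in> A'" "n \<in> A'" "u \<notin> V" for m n u
    using insert.prems(5)[of m n u] that by (cases "u = v") (auto simp: A'_def)
  have agree': "lookup m u = lookup n u" if "m \<in> B'" "n \<in> B'" "u \<notin> V" for m n u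
    using insert.prems(6)[of m n u] that by (cases "u = v") (auto simp: B'_def)
  have "\<exists>M\<in>A'. \<exists>N\<in>B'. \<forall>m\<in>A'. \<forall>n\<in>B'. m + n = M + N \<longrightarrow> m = M \<and> n = N"
  proof (rule insert.IH)
    show "finite A'" "finite B'"
      using insert.prems(1,2) by (auto simp: A'_def B'_def)
  qed (use ne agree agree' in blast)+
  then obtain M N where MN: "M \<in> A'" "N \<in> B'"
    and uniq: "\<And>m n. m \<in> A' \<Longrightarrow> n \<in> B' \<Longrightarrow> m + n = M + N \<Longrightarrow> m = M \<and> n = N"
    by blast
  have "m = M \<and> n = N" if "m \<in> A" "n \<in> B" "m + n = M + N" for m n
  proof -
    \<comment> \<open>The two exponents are at most \<open>a\<close> and \<open>b\<close> and add up
      to \<open>a + b\<close>, so both are maximal.\<close>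
    have "lookup m v + lookup n v = a + b"
      using MN arg_cong[OF that(3), of "\<lambda>k. lookup k v"] by (simp add: lookup_add A'_def B'_def)
    then have "m \<in> A'" "n \<in> B'"
      using that le[of m] le'[of n] by (auto simp: A'_def B'_def)
    then show ?thesis using uniq that by blast
  qed
  then show ?case using MN by (auto simp: A'_def B'_def)
qed

text \<open>At a monomial \<open>M + N\<close> that decomposes in only one way, the coefficient of
  the product is a product of two nonzero field elements.\<close>

lemma mpoly_no_zero_divisors:
  fixes p q :: "('v, 'k::field) mpoly"
  assumes "p \<noteq> 0" "q \<noteq> 0"
  shows "p * q \<noteq> 0"
proof -
  let ?V = "\<Union>m\<in>keys p \<union> keys q. keys m"
  have ne: "keys p \<noteq> {}" "keys q \<noteq> {}"
    using assms by (metis keys_eq_empty)+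
  have out: "lookup m v = 0" if "m \<in> keys p \<union> keys q" "v \<notin> ?V" for m v
    using that by (auto simp: in_keys_iff)
  obtain M N where MN: "M \<in> keys p" "N \<in> keys q"
    and uniq: "\<And>m n. m \<in> keys p \<Longrightarrow> n \<in> keys q \<Longrightarrow> m + n = M + N \<Longrightarrow> m = M \<and> n = N"
  proof -
    have "\<exists>M\<in>keys p. \<exists>N\<in>keys q. \<forall>m\<in>keys p. \<forall>n\<in>keys q. m + n = M + N \<longrightarrow> m = M \<and> n = N"
      by (rule unique_product_aux[of ?V]) (use ne in \<open>auto simp: out\<close>)
    then show ?thesis using that by blast
  qed
  have "lookup (p * q) (M + N) = (\<Sum>m\<in>keys p. \<Sum>n\<in>keys q. 
      if m = M then (if n = N then lookup p m * lookup q n else 0) else 0)"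
    unfolding lookup_times by (intro sum.cong refl) (use uniq in auto)
  also have "\<dots> = (\<Sum>m\<in>keys p. if m = M then (\<Sum>n\<in>keys q. if n = N then lookup p m * lookup q n else 0) else 0)"
    by (intro sum.cong) auto
  also have "\<dots> = lookup p M * lookup q N"
    using MN by simp
  also have "\<dots> \<noteq> 0"
    using MN by (simp add: in_keys_iff)
  finally show ?thesis by auto
qed

section \<open>Ideals\<close>

lemma ideal_subset: "is_ideal V J \<Longrightarrow> p \<in> J \<Longrightarrow> p \<in> polyring V"
  by (auto simp: is_ideal_def)

lemma ideal_zero: "is_ideal V J \<Longrightarrow> 0 \<in> J"
  by (simp add: is_ideal_def)

lemma ideal_add: "is_ideal V J \<Longrightarrow> a \<in> J \<Longrightarrow> b \<in> J \<Longrightarrow> a + b \<in> J"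
  by (auto simp: is_ideal_def)

lemma ideal_mult: "is_ideal V J \<Longrightarrow> r \<in> polyring V \<Longrightarrow> a \<in> J \<Longrightarrow> r * a \<in> J"
  by (auto simp: is_ideal_def)

lemma ideal_mult_right: "is_ideal V J \<Longrightarrow> r \<in> polyring V \<Longrightarrow> a \<in> J \<Longrightarrow> a * r \<in> J"
  using ideal_mult[of V J r a] by (simp add: mult.commute)

lemma ideal_uminus: "is_ideal V J \<Longrightarrow> a \<in> J \<Longrightarrow> - a \<in> J"
  using ideal_mult[of V J "-1" a] polyring_uminus[OF polyring_one, of V] by simp

lemma ideal_diff: "is_ideal V J \<Longrightarrow> a \<in> J \<Longrightarrow> b \<in> J \<Longrightarrow> a - b \<in> J"
  using ideal_add[of V J a "- b"] ideal_uminus by auto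

lemma ideal_sum: "is_ideal V J \<Longrightarrow> (\<And>i. i \<in> A \<Longrightarrow> f i \<in> J) \<Longrightarrow> sum f A \<in> J"
  by (induction A rule: infinite_finite_induct) (auto intro: ideal_zero ideal_add)

definition adjoin :: "'v set \<Rightarrow> ('v, 'k::field) mpoly set \<Rightarrow> ('v, 'k) mpoly \<Rightarrow> ('v, 'k) mpoly set" where
  "adjoin V J x = {q + r * x | q r. q \<in> J \<and> r \<in> polyring V}"

definition colon :: "'v set \<Rightarrow> ('v, 'k::field) mpoly set \<Rightarrow> ('v, 'k) mpoly \<Rightarrow> ('v, 'k) mpoly set" where
  "colon V J x = {p\<in>polyring V. x * p \<in> J}"

lemma adjoinI: "q \<in> J \<Longrightarrow> r \<in> polyring V \<Longrightarrow> q + r * x \<in> adjoin V J x"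
  by (auto simp: adjoin_def)

lemma adjoin_superset: "J \<subseteq> adjoin V J x"
  using adjoinI[of _ J 0 V x] by auto

lemma is_ideal_adjoin:
  fixes J :: "('v, 'k::field) mpoly set"
  assumes "is_ideal V J" "x \<in> polyring V"
  shows "is_ideal V (adjoin V J x)"
  unfolding is_ideal_def
proof (intro conjI ballI)
  show "adjoin V J x \<subseteq> polyring V"
    using assms ideal_subset by (auto simp: adjoin_def)
  show "0 \<in> adjoin V J x"
    using adjoin_superset ideal_zero[OF assms(1)] by blast
next
  fix a b :: "('v, 'k) mpoly" assume "a \<in> adjoin V J x" "b \<in> adjoin V J x"
  then obtain q r q' r' where *: "a = q + r * x" "b = q' + r' * x"
    "q \<in> J" "q' \<in> J" "r \<in> polyring V" "r' \<in> polyring V"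
    by (auto simp: adjoin_def)
  have "(q + q') + (r + r') * x \<in> adjoin V J x"
    using * by (intro adjoinI ideal_add[OF assms(1)] polyring_add)
  then show "a + b \<in> adjoin V J x"
    by (simp add: * algebra_simps)
next
  fix s a :: "('v, 'k) mpoly" assume s: "s \<in> polyring V" "a \<in> adjoin V J x"
  then obtain q r where *: "a = q + r * x" "q \<in> J" "r \<in> polyring V"
    by (auto simp: adjoin_def)
  have "s * q + (s * r) * x \<in> adjoin V J x"
    using * s by (intro adjoinI ideal_mult[OF assms(1)] polyring_mult)
  then show "s * a \<in> adjoin V J x"
    by (simp add: * algebra_simps)
qed

lemma ideal_plus_0 [simp]: "ideal_plus V J a 0 = J"
  by (simp add: ideal_plus_def)

text \<open>Turns statements about a sequence into inductions that adjoin one element at a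
  time.\<close>

lemma ideal_plus_Suc: "ideal_plus V J a (Suc t) = adjoin V (ideal_plus V J a t) (a t)"
proof (intro equalityI subsetI)
  fix p assume "p \<in> ideal_plus V J a (Suc t)"
  then obtain q c where *: "p = q + (\<Sum>j<Suc t. c j * a j)" "q \<in> J" "\<forall>j<Suc t. c j \<in> polyring V"
    by (auto simp: ideal_plus_def)
  have "q + (\<Sum>j<t. c j * a j) \<in> ideal_plus V J a t"
    unfolding ideal_plus_def using * by (intro CollectI exI[of _ q] exI[of _ c]) auto
  then have "(q + (\<Sum>j<t. c j * a j)) + c t * a t \<in> adjoin V (ideal_plus V J a t) (a t)"
    using * by (intro adjoinI) auto
  then show "p \<in> adjoin V (ideal_plus V J a t) (a t)"
    by (simp add: * add.assoc)
next
  fix p assume "p \<in> adjoin V (ideal_plus V J a t) (a t)"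
  then obtain q c r where *: "p = q + (\<Sum>j<t. c j * a j) + r * a t" "q \<in> J"
    "\<forall>j<t. c j \<in> polyring V" "r \<in> polyring V"
    by (auto simp: adjoin_def ideal_plus_def)
  define c' where "c' = c(t := r)"
  have "p = q + (\<Sum>j<Suc t. c' j * a j)" "\<forall>j<Suc t. c' j \<in> polyring V"
    using * by (auto simp: c'_def add.assoc less_Suc_eq)
  then show "p \<in> ideal_plus V J a (Suc t)"
    unfolding ideal_plus_def using * by (intro CollectI exI[of _ q] exI[of _ c']) simp
qed

lemma is_ideal_plus:
  "is_ideal V J \<Longrightarrow> (\<And>i. i < t \<Longrightarrow> a i \<in> polyring V) \<Longrightarrow> is_ideal V (ideal_plus V J a t)"
  by (induction t) (auto simp: ideal_plus_Suc intro: is_ideal_adjoin)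

lemma ideal_plus_superset: "J \<subseteq> ideal_plus V J a t"
  by (induction t) (auto simp: ideal_plus_Suc dest: adjoin_superset[THEN subsetD])

lemma is_ideal_max_ideal: "is_ideal V (max_ideal V)"
proof -
  have *: "lookup (r * p) 0 = lookup r 0 * lookup p 0" for r p :: "('v, 'k::field) mpoly"
  proof -
    have 0: "m + n = 0 \<longleftrightarrow> m = 0 \<and> n = 0" for m n :: "'v \<Rightarrow>\<^sub>0 nat"
      by (auto simp: poly_mapping_eq_iff fun_eq_iff lookup_add)
    have "lookup (r * p) 0 = (\<Sum>m\<in>keys r. if m = 0 then (\<Sum>n\<in>keys p. if n = 0 then lookup r m * lookup p n else 0) else 0)"
      unfolding lookup_times by (intro sum.cong refl) (auto simp: 0)
    also have "\<dots> = lookup r 0 * lookup p 0"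
      by (auto simp: in_keys_iff)
    finally show ?thesis .
  qed
  show ?thesis
    by (auto simp: is_ideal_def max_ideal_def * lookup_add)
qed

lemma adjoin_subset:
  "is_ideal V J' \<Longrightarrow> J \<subseteq> J' \<Longrightarrow> x \<in> J' \<Longrightarrow> adjoin V J x \<subseteq> J'"
  by (auto simp: adjoin_def intro!: ideal_add ideal_mult)

lemma ideal_plus_subset:
  "is_ideal V J' \<Longrightarrow> J \<subseteq> J' \<Longrightarrow> (\<And>i. i < t \<Longrightarrow> a i \<in> J') \<Longrightarrow> ideal_plus V J a t \<subseteq> J'"
  by (induction t) (simp_all add: ideal_plus_Suc adjoin_subset)

section \<open>Squarefree monomial ideals\<close>

text \<open>The sets in \<open>F\<close> are the supports of squarefree monomial generators.\<close>
definition sqf :: "'v set \<Rightarrow> 'v set set \<Rightarrow> ('v, 'k::field) mpoly set" where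
  "sqf V F = {p\<in>polyring V. \<forall>m\<in>keys p. \<exists>e\<in>F. e \<subseteq> keys m}"

abbreviation singletons :: "'v set \<Rightarrow> 'v set set" where
  "singletons C \<equiv> (\<lambda>c. {c}) ` C"

lemma sqfI:
  "p \<in> polyring V \<Longrightarrow> (\<And>m. m \<in> keys p \<Longrightarrow> \<exists>e\<in>F. e \<subseteq> keys m) \<Longrightarrow> p \<in> sqf V F"
  by (simp add: sqf_def)

lemma sqfD: "p \<in> sqf V F \<Longrightarrow> p \<in> polyring V" "p \<in> sqf V F \<Longrightarrow> m \<in> keys p \<Longrightarrow> \<exists>e\<in>F. e \<subseteq> keys m"
  by (simp_all add: sqf_def)

lemma is_ideal_sqf: "is_ideal V (sqf V F)"
  unfolding is_ideal_def
proof (intro conjI ballI)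
  show "sqf V F \<subseteq> polyring V" "0 \<in> sqf V F"
    by (simp_all add: sqf_def)
next
  fix a b :: "('a, 'b) mpoly" assume ab: "a \<in> sqf V F" "b \<in> sqf V F"
  show "a + b \<in> sqf V F"
  proof (rule sqfI)
    show "a + b \<in> polyring V" using sqfD(1)[OF ab(1)] sqfD(1)[OF ab(2)] by (rule polyring_add)
    fix m assume "m \<in> keys (a + b)"
    then show "\<exists>e\<in>F. e \<subseteq> keys m"
      using keys_add[of a b] sqfD(2)[OF ab(1)] sqfD(2)[OF ab(2)] by blast
  qed
next
  fix r a :: "('a, 'b) mpoly" assume ra: "r \<in> polyring V" "a \<in> sqf V F"
  show "r * a \<in> sqf V F"
  proof (rule sqfI)
    show "r * a \<in> polyring V" using ra(1) sqfD(1)[OF ra(2)] by (rule polyring_mult)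
    fix m assume m: "m \<in> keys (r * a)"
    obtain n n' where n: "m = n + n'" "n' \<in> keys a"
      using keys_mult[of r a] m by auto
    then obtain e where "e \<in> F" "e \<subseteq> keys n'" using sqfD(2)[OF ra(2)] by blast
    then show "\<exists>e\<in>F. e \<subseteq> keys m"
      unfolding n(1) keys_plus_nat by blast
  qed
qed

lemma sqf_cong:
  assumes "\<And>X. X \<subseteq> V \<Longrightarrow> (\<exists>e\<in>F. e \<subseteq> X) \<longleftrightarrow> (\<exists>e\<in>F'. e \<subseteq> X)"
  shows "sqf V F = sqf V F'"
proof -
  have "(\<exists>e\<in>F. e \<subseteq> keys m) \<longleftrightarrow> (\<exists>e\<in>F'. e \<subseteq> keys m)" if "p \<in> polyring V" "m \<in> keys p"
    for p :: "('a, 'b) mpoly" and m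
    using assms[OF polyringD[OF that]] .
  then show ?thesis
    unfolding sqf_def by (intro Collect_cong conj_cong ball_cong refl)
qed

text \<open>Membership is decided monomial by monomial; with degrees as the predicate this is
  gradedness of the ideal.\<close>

lemma sqf_filt: "p \<in> sqf V F \<Longrightarrow> filt A p \<in> sqf V F"
  by (simp add: sqf_def filt_polyring keys_filt)

lemma single_in_sqf:
  "c \<noteq> 0 \<Longrightarrow> single m c \<in> sqf V F \<longleftrightarrow> keys m \<subseteq> V \<and> (\<exists>e\<in>F. e \<subseteq> keys m)"
  by (simp add: sqf_def polyring_def)

lemma in_ideal_if_monomials_in_ideal:
  assumes "is_ideal V J" "p \<in> polyring V" "\<And>m. m \<in> keys p \<Longrightarrow> single m (lookup p m) \<in> J"
  shows "p \<in> J"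
proof -
  have "(\<Sum>m\<in>keys p. single m (lookup p m)) \<in> J"
    using assms by (intro ideal_sum) auto
  then show ?thesis by (simp flip: poly_eq_sum_singles)
qed

lemma Var_dvd_poly:
  assumes "p \<in> polyring V" "\<And>m. m \<in> keys p \<Longrightarrow> v \<in> keys m"
  obtains q where "q \<in> polyring V" "p = Var v * q"
proof -
  define q where "q = (\<Sum>m\<in>keys p. single (m - single v 1) (lookup p m))"
  have "keys (m - single v 1) \<subseteq> V" if "m \<in> keys p" for m
    using monomial_split[OF assms(2)[OF that]] polyringD[OF assms(1) that]
    by (metis keys_plus_nat le_sup_iff)
  then have "q \<in> polyring V"
    unfolding q_def by (intro polyring_sum polyring_single)
  moreover have "Var v * q = (\<Sum>m\<in>keys p. single m (lookup p m))"
    unfolding q_def sum_distrib_left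
    by (intro sum.cong refl) (simp add: Var_def mult_single monomial_split[OF assms(2), simplified])
  ultimately show ?thesis using that poly_eq_sum_singles[of p] by metis
qed

text \<open>The first summand is \<open>p\<close> with \<open>v\<close> set to zero. What vanishes
  under this substitution can therefore be divided by the variable.\<close>

lemma polyring_split_Var:
  assumes "p \<in> polyring V"
  obtains q where "q \<in> polyring V" "p = filt (\<lambda>m. v \<notin> keys m) p + Var v * q"
proof -
  have 1: "p - filt (\<lambda>m. v \<notin> keys m) p \<in> polyring V"
    using assms by (auto intro: filt_polyring)
  have 2: "v \<in> keys m" if "m \<in> keys (p - filt (\<lambda>m. v \<notin> keys m) p)" for m
    using that by (auto simp: in_keys_iff lookup_minus lookup_filt split: if_splits)
  obtain q where "q \<in> polyring V" "p - filt (\<lambda>m. v \<notin> keys m) p = Var v * q"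
    using Var_dvd_poly[OF 1 2] by blast
  then show ?thesis using that by (metis add.commute diff_add_cancel)
qed

lemma adjoin_sqf:
  assumes "v \<in> V"
  shows "adjoin V (sqf V F) (Var v) = sqf V (insert {v} F)"
proof (intro equalityI subsetI)
  fix p :: "('a, 'b) mpoly" assume "p \<in> adjoin V (sqf V F) (Var v)"
  moreover have "Var v \<in> (sqf V (insert {v} F) :: ('a, 'b) mpoly set)"
    using assms unfolding Var_def by (subst single_in_sqf) auto
  moreover have "sqf V F \<subseteq> (sqf V (insert {v} F) :: ('a, 'b) mpoly set)"
    by (auto simp: sqf_def)
  ultimately show "p \<in> sqf V (insert {v} F)"
    using adjoin_subset[OF is_ideal_sqf] by blast
next
  fix p :: "('a, 'b) mpoly" assume p: "p \<in> sqf V (insert {v} F)"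
  then have pV: "p \<in> polyring V" by (simp add: sqf_def)
  obtain q where q: "q \<in> polyring V" "p = filt (\<lambda>m. v \<notin> keys m) p + Var v * q"
    using polyring_split_Var[OF pV] .
  have "filt (\<lambda>m. v \<notin> keys m) p \<in> sqf V F"
    using p pV by (auto simp: sqf_def filt_polyring keys_filt)
  then show "p \<in> adjoin V (sqf V F) (Var v)"
    using q adjoinI[of _ "sqf V F" q V "Var v"] by (metis mult.commute)
qed

lemma keys_Var_mult: "keys (Var v * p) = (\<lambda>m. single v 1 + m) ` keys p"
proof (intro equalityI subsetI)
  fix m assume "m \<in> keys (Var v * p)"
  then have "v \<in> keys m" "m - single v 1 \<in> keys p"
    by (auto simp: in_keys_iff lookup_Var_mult split: if_splits)
  then show "m \<in> (\<lambda>m. single v 1 + m) ` keys p"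
    by (metis image_eqI monomial_split)
qed (auto simp: in_keys_iff lookup_Var_mult lookup_add)

text \<open>A multiple of x_v by a monomial is divisible by x_e exactly when the monomial itself is
  divisible by the product over \<open>e - {v}\<close>. A generator \<open>{v}\<close> turns into
  the empty support, that is, the unit ideal.\<close>

lemma colon_sqf:
  assumes "v \<in> V"
  shows "colon V (sqf V F) (Var v) = sqf V ((\<lambda>e. e - {v}) ` F)"
proof -
  have "Var v * p \<in> sqf V F \<longleftrightarrow> p \<in> sqf V ((\<lambda>e. e - {v}) ` F)"
    if "p \<in> polyring V" for p :: "('a, 'b) mpoly"
  proof -
    have "Var v * p \<in> polyring V" using that assms by auto
    moreover have "e - {v} \<subseteq> keys m \<longleftrightarrow> e \<subseteq> keys (single v (1::nat) + m)" for e m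
      by (auto simp: keys_plus_nat)
    ultimately show ?thesis using that by (simp add: sqf_def keys_Var_mult)
  qed
  then have "colon V (sqf V F) (Var v) = {p\<in>polyring V. p \<in> (sqf V ((\<lambda>e. e - {v}) ` F) :: ('a, 'b) mpoly set)}"
    unfolding colon_def by blast
  then show ?thesis by (auto simp: sqf_def)
qed

text \<open>If no generator involves \<open>v\<close>, forming the colon by the variable leaves
  every generator as it is.\<close>

lemma sqf_Var_nonzerodivisor:
  assumes "v \<in> V" "v \<notin> \<Union>F" "p \<in> polyring V" "Var v * p \<in> sqf V F"
  shows "p \<in> sqf V F"
proof -
  have "(\<lambda>e. e - {v}) ` F = F"
    using assms(2) by force
  then show ?thesis
    using colon_sqf[OF assms(1), of F] assms by (auto simp: colon_def)
qed

lemma prod_Var: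
  assumes "finite e"
  shows "(\<Prod>v\<in>e. Var v) = (single (\<Sum>v\<in>e. single v 1) 1 :: ('v, 'k::field) mpoly)"
  using assms by (induction e rule: finite_induct) (simp_all add: Var_def mult_single)

lemma keys_sum_single:
  assumes "finite e"
  shows "keys (\<Sum>v\<in>e. single v (Suc 0)) = e"
  using assms by (induction e rule: finite_induct) (simp_all add: keys_plus_nat)

text \<open>Replaces linear combinations of edge monomials by a condition on supports, the form in
  which colons and primes are computed.\<close>

lemma edge_ideal_eq_sqf:
  assumes "is_graph G"
  shows "(edge_ideal G :: ('v, 'k::field) mpoly set) = sqf (fst G) (snd G)"
proof -
  have fin: "finite (snd G)" and sub: "\<And>e. e \<in> snd G \<Longrightarrow> e \<subseteq> fst G"
    using assms finite_subset[of "snd G" "Pow (fst G)"] by (auto simp: is_graph_def)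
  have fe: "finite e" if "e \<in> snd G" for e
    using finite_subset[OF sub[OF that]] assms by (auto simp: is_graph_def)
  have gen: "(\<Prod>v\<in>e. Var v) \<in> (sqf (fst G) (snd G) :: ('v, 'k) mpoly set)" if "e \<in> snd G" for e
    using that sub by (simp add: prod_Var fe single_in_sqf keys_sum_single) blast
  have ideal: "is_ideal (fst G) (edge_ideal G :: ('v, 'k) mpoly set)"
    unfolding is_ideal_def
  proof (intro conjI ballI)
    show "edge_ideal G \<subseteq> (polyring (fst G) :: ('v, 'k) mpoly set)"
      using sub by (auto simp: edge_ideal_def intro!: polyring_sum polyring_mult polyring_prod polyring_Var)
    have "(0 :: ('v, 'k) mpoly) = (\<Sum>e\<in>snd G. 0 * (\<Prod>v\<in>e. Var v))" by simp
    then show "0 \<in> (edge_ideal G :: ('v, 'k) mpoly set)"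
      unfolding edge_ideal_def by (intro CollectI exI[of _ "\<lambda>_. 0"] conjI) simp_all
  next
    fix a b :: "('v, 'k) mpoly" assume "a \<in> edge_ideal G" "b \<in> edge_ideal G"
    then obtain c c' where "a = (\<Sum>e\<in>snd G. c e * (\<Prod>v\<in>e. Var v))" "b = (\<Sum>e\<in>snd G. c' e * (\<Prod>v\<in>e. Var v))"
      "\<forall>e\<in>snd G. c e \<in> polyring (fst G)" "\<forall>e\<in>snd G. c' e \<in> polyring (fst G)"
      by (auto simp: edge_ideal_def)
    then show "a + b \<in> edge_ideal G"
      unfolding edge_ideal_def
      by (intro CollectI exI[of _ "\<lambda>e. c e + c' e"] conjI) (auto simp: sum.distrib algebra_simps)
  next
    fix r a :: "('v, 'k) mpoly" assume "r \<in> polyring (fst G)" "a \<in> edge_ideal G"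
    then obtain c where "a = (\<Sum>e\<in>snd G. c e * (\<Prod>v\<in>e. Var v))"
      "\<forall>e\<in>snd G. c e \<in> polyring (fst G)" "r \<in> polyring (fst G)"
      by (auto simp: edge_ideal_def)
    then show "r * a \<in> edge_ideal G"
      unfolding edge_ideal_def
      by (intro CollectI exI[of _ "\<lambda>e. r * c e"] conjI) (auto simp: sum_distrib_left algebra_simps)
  qed
  show ?thesis
  proof (intro equalityI subsetI)
    fix p :: "('v, 'k) mpoly" assume "p \<in> edge_ideal G"
    then show "p \<in> sqf (fst G) (snd G)"
      unfolding edge_ideal_def by (auto intro!: ideal_sum[OF is_ideal_sqf] ideal_mult[OF is_ideal_sqf] gen)
  next
    fix p :: "('v, 'k) mpoly" assume p: "p \<in> sqf (fst G) (snd G)"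
    show "p \<in> edge_ideal G"
    proof (rule in_ideal_if_monomials_in_ideal[OF ideal])
      show pV: "p \<in> polyring (fst G)" using p by (simp add: sqf_def)
      fix m assume m: "m \<in> keys p"
      then obtain e where e: "e \<in> snd G" "e \<subseteq> keys m"
        using p by (auto simp: sqf_def)
      \<comment> \<open>The exponent vector of x_e. The truncated difference \<open>m - n\<close> is
        a true quotient since \<open>e\<close> lies in the support of \<open>m\<close>.\<close>
      define n where "n = (\<Sum>v\<in>e. single v (Suc 0))"
      have n: "lookup n v = (if v \<in> e then 1 else 0)" for v
        using fe[OF e(1)] by (auto simp: n_def lookup_sum lookup_single when_def)
      have mn: "(m - n) + n = m"
        using e(2) by (intro poly_mapping_eqI) (force simp: lookup_add lookup_minus n in_keys_iff)
      then have "keys (m - n) \<subseteq> fst G"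
        using polyringD[OF pV m] by (metis keys_plus_nat le_sup_iff)
      moreover have "single m (lookup p m) = single (m - n) (lookup p m) * (\<Prod>v\<in>e. Var v)"
      proof -
        have "(\<Prod>v\<in>e. Var v) = (single n 1 :: ('v, 'k) mpoly)"
          unfolding n_def by (simp add: prod_Var[OF fe[OF e(1)]])
        then show ?thesis by (simp add: mult_single mn)
      qed
      moreover have "(\<Prod>v\<in>e. Var v) \<in> (edge_ideal G :: ('v, 'k) mpoly set)"
      proof -
        have "(\<Prod>v\<in>e. Var v) = (\<Sum>e'\<in>snd G. (if e' = e then 1 else 0) * (\<Prod>v\<in>e'. Var v) :: ('v, 'k) mpoly)"
          using fin e(1) by (simp add: if_distrib[of "\<lambda>x. x * _"] cong: if_cong)
        then show ?thesis
          unfolding edge_ideal_def by (intro CollectI exI[of _ "\<lambda>e'. if e' = e then 1 else 0"]) auto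
      qed
      ultimately show "single m (lookup p m) \<in> edge_ideal G"
        by (auto intro!: ideal_mult[OF ideal] polyring_single)
    qed
  qed
qed

section \<open>Free resolutions\<close>

lemma freemodD: "x \<in> freemod V r \<Longrightarrow> x i \<in> polyring V"
  by (cases "i < r") (auto simp: freemod_def)

lemma freemod_beyond: "x \<in> freemod V r \<Longrightarrow> i \<ge> r \<Longrightarrow> x i = 0"
  by (auto simp: freemod_def)

lemma freemodI: "(\<And>i. i < r \<Longrightarrow> x i \<in> polyring V) \<Longrightarrow> (\<And>i. i \<ge> r \<Longrightarrow> x i = 0) \<Longrightarrow> x \<in> freemod V r"
  by (auto simp: freemod_def)

lemma freemod_0 [simp]: "freemod V 0 = {\<lambda>_. 0}"
  by (auto simp: freemod_def)

section \<open>Submodules of free modules and matrices\<close>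

definition submod :: "'v set \<Rightarrow> nat \<Rightarrow> (nat \<Rightarrow> ('v, 'k::field) mpoly) set \<Rightarrow> bool" where
  "submod V r K \<longleftrightarrow> K \<subseteq> freemod V r \<and> (\<lambda>_. 0) \<in> K \<and> (\<forall>x\<in>K. \<forall>y\<in>K. (\<lambda>i. x i + y i) \<in> K)
     \<and> (\<forall>s\<in>polyring V. \<forall>x\<in>K. (\<lambda>i. s * x i) \<in> K)"

lemma submod_subset: "submod V r K \<Longrightarrow> K \<subseteq> freemod V r"
  and submod_zero: "submod V r K \<Longrightarrow> (\<lambda>_. 0) \<in> K"
  and submod_add: "submod V r K \<Longrightarrow> x \<in> K \<Longrightarrow> y \<in> K \<Longrightarrow> (\<lambda>i. x i + y i) \<in> K"
  and submod_scale: "submod V r K \<Longrightarrow> s \<in> polyring V \<Longrightarrow> x \<in> K \<Longrightarrow> (\<lambda>i. s * x i) \<in> K"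
  by (auto simp: submod_def)

lemma submod_diff:
  assumes "submod V r K" "x \<in> K" "y \<in> K"
  shows "(\<lambda>i. x i - y i) \<in> K"
proof -
  have "(\<lambda>i. (-1) * y i) \<in> K"
    using assms by (intro submod_scale[OF assms(1)]) auto
  from submod_add[OF assms(1,2) this] show ?thesis by simp
qed

lemma submod_sum:
  assumes "submod V r K" "\<And>j. j \<in> J \<Longrightarrow> f j \<in> K"
  shows "(\<lambda>i. \<Sum>j\<in>J. f j i) \<in> K"
  using assms(2)
proof (induction J rule: infinite_finite_induct)
  case (insert j J)
  then have "(\<lambda>i. f j i + (\<Sum>j\<in>J. f j i)) \<in> K"
    by (intro submod_add[OF assms(1)]) auto
  then show ?case using insert by simp
qed (auto simp: submod_zero[OF assms(1)])

lemma submod_freemod: "submod V r (freemod V r)"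
  by (auto simp: submod_def freemod_def)

lemma submod_zero_module: "submod V r {\<lambda>_. 0}"
  by (auto simp: submod_def freemod_def)

definition ker :: "'v set \<Rightarrow> nat \<Rightarrow> nat \<Rightarrow> (nat \<Rightarrow> nat \<Rightarrow> ('v, 'k::field) mpoly) \<Rightarrow> (nat \<Rightarrow> ('v, 'k) mpoly) set" where
  "ker V r c A = {x\<in>freemod V c. matapp r c A x = (\<lambda>_. 0)}"

definition img :: "'v set \<Rightarrow> nat \<Rightarrow> nat \<Rightarrow> (nat \<Rightarrow> nat \<Rightarrow> ('v, 'k::field) mpoly) \<Rightarrow> (nat \<Rightarrow> ('v, 'k) mpoly) set" where
  "img V r c A = matapp r c A ` freemod V c"

definition matrix_over :: "'v set \<Rightarrow> nat \<Rightarrow> nat \<Rightarrow> (nat \<Rightarrow> nat \<Rightarrow> ('v, 'k::field) mpoly) \<Rightarrow> bool" where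
  "matrix_over V r c A \<longleftrightarrow> (\<forall>i<r. \<forall>j<c. A i j \<in> polyring V)"

lemma matapp_add: "matapp r c A (\<lambda>i. x i + y i) = (\<lambda>i. matapp r c A x i + matapp r c A y i)"
  by (auto simp: matapp_def algebra_simps sum.distrib)

lemma matapp_scale: "matapp r c A (\<lambda>i. s * x i) = (\<lambda>i. s * matapp r c A x i)"
  by (auto simp: matapp_def sum_distrib_left algebra_simps)

lemma matapp_diff: "matapp r c A (\<lambda>i. x i - y i) = (\<lambda>i. matapp r c A x i - matapp r c A y i)"
  by (auto simp: matapp_def algebra_simps sum_subtractf)

lemma matapp_uminus: "matapp r c A (\<lambda>i. - x i) = (\<lambda>i. - matapp r c A x i)"
  by (auto simp: matapp_def sum_negf)

lemma matapp_zero [simp]: "matapp r c A (\<lambda>_. 0) = (\<lambda>_. 0)"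
  by (auto simp: matapp_def)

lemma matapp_freemod:
  "matrix_over V r c A \<Longrightarrow> x \<in> freemod V c \<Longrightarrow> matapp r c A x \<in> freemod V r"
  by (intro freemodI) (auto simp: matapp_def matrix_over_def freemodD intro!: polyring_sum polyring_mult)

lemma submod_ker: "submod V c (ker V r c A)"
  using submod_freemod[of V c] unfolding submod_def ker_def
  by (auto simp: matapp_add matapp_scale)

lemma submod_img:
  fixes A :: "nat \<Rightarrow> nat \<Rightarrow> ('v, 'k::field) mpoly"
  assumes "matrix_over V r c A"
  shows "submod V r (img V r c A)"
  unfolding submod_def
proof (intro conjI ballI)
  show "img V r c A \<subseteq> freemod V r"
    using assms by (auto simp: img_def intro: matapp_freemod)
  show "(\<lambda>_. 0) \<in> img V r c A"
    unfolding img_def by (intro image_eqI[of _ _ "\<lambda>_. 0"]) (auto simp: freemod_def)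
next
  fix x y :: "nat \<Rightarrow> ('v, 'k) mpoly" assume "x \<in> img V r c A" "y \<in> img V r c A"
  then show "(\<lambda>i. x i + y i) \<in> img V r c A"
    unfolding img_def by (auto simp flip: matapp_add intro!: imageI submod_add[OF submod_freemod])
next
  fix s :: "('v, 'k) mpoly" and x :: "nat \<Rightarrow> ('v, 'k) mpoly" assume "s \<in> polyring V" "x \<in> img V r c A"
  then show "(\<lambda>i. s * x i) \<in> img V r c A"
    unfolding img_def by (auto simp flip: matapp_scale intro!: imageI submod_scale[OF submod_freemod])
qed

text \<open>\<open>res V m K r\<close>: the module \<open>S^r / K\<close> has a free resolution of length \<open>m\<close> starting with
  the projection from \<open>S^r\<close>.\<close>
fun res :: "'v set \<Rightarrow> nat \<Rightarrow> (nat \<Rightarrow> ('v, 'k::field) mpoly) set \<Rightarrow> nat \<Rightarrow> bool" where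
  "res V 0 K r \<longleftrightarrow> K = {\<lambda>_. 0}"
| "res V (Suc m) K r \<longleftrightarrow>
     (\<exists>c A. matrix_over V r c A \<and> K = img V r c A \<and> res V m (ker V r c A) c)"

lemma res_submod: "res V m K r \<Longrightarrow> submod V r K"
  by (cases m) (auto simp: submod_zero_module submod_img)

lemma res_Suc: "res V m K r \<Longrightarrow> res V (Suc m) K r"
proof (induction m arbitrary: K r)
  case 0
  \<comment> \<open>A free module of rank 0 pads the resolution.\<close>
  have "matrix_over V r 0 (\<lambda>_ _. 0)" by (simp add: matrix_over_def)
  moreover have "K = img V r 0 (\<lambda>_ _. 0)" "ker V r 0 (\<lambda>_ _. 0) = {\<lambda>_. 0}"
    using 0 by (auto simp: img_def ker_def)
  ultimately show ?case unfolding res.simps(2) res.simps(1) by blast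
next
  case (Suc m)
  from Suc.prems obtain c A where "matrix_over V r c A" "K = img V r c A" "res V m (ker V r c A) c"
    by auto
  then show ?case using Suc.IH[of "ker V r c A" c] unfolding res.simps(2)[of V "Suc m"] by blast
qed

lemma res_mono:
  assumes "res V m K r" "m \<le> n"
  shows "res V n K r"
  using assms(2)
proof (induction rule: dec_induct)
  case (step n)
  from step.IH show ?case by (rule res_Suc)
qed (rule assms(1))

section \<open>Extensions of resolutions\<close>

definition join :: "nat \<Rightarrow> (nat \<Rightarrow> 'a) \<Rightarrow> (nat \<Rightarrow> 'a) \<Rightarrow> nat \<Rightarrow> 'a" where
  "join a x y = (\<lambda>i. if i < a then x i else y (i - a))"

lemma join_freemod: "x \<in> freemod V a \<Longrightarrow> y \<in> freemod V c \<Longrightarrow> join a x y \<in> freemod V (a + c)"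
  by (auto simp: freemod_def join_def)

lemma freemod_split:
  assumes "z \<in> freemod V (a + c)"
  obtains x y where "x \<in> freemod V a" "y \<in> freemod V c" "z = join a x y"
proof -
  have "(\<lambda>i. if i < a then z i else 0) \<in> freemod V a" "(\<lambda>i. z (i + a)) \<in> freemod V c"
    using assms by (auto simp: freemod_def)
  moreover have "z = join a (\<lambda>i. if i < a then z i else 0) (\<lambda>i. z (i + a))"
    by (auto simp: join_def)
  ultimately show ?thesis using that by blast
qed

lemma join_add: "(\<lambda>i. join a x y i + join a x' y' i) = join a (\<lambda>i. x i + x' i) (\<lambda>i. y i + y' i)"
  and join_diff: "(\<lambda>i. join a u w i - join a u' w' i) = join a (\<lambda>i. u i - u' i) (\<lambda>i. w i - w' i)"
  for u :: "nat \<Rightarrow> 'a::ab_group_add" and x :: "nat \<Rightarrow> 'b::plus"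
  by (auto simp: join_def)

lemma join_zero [simp]: "join a (\<lambda>_. 0) (\<lambda>_. 0) = (\<lambda>_. 0)"
  by (auto simp: join_def)

lemma sum_lessThan_add: "(\<Sum>j<a + c. g j) = (\<Sum>j<a. g j) + (\<Sum>j<c. g (a + j))"
  for g :: "nat \<Rightarrow> 'a::comm_monoid_add"
  by (induction c) (simp_all add: add.assoc)

lemma freemod_unit:
  "j < c \<Longrightarrow> (\<lambda>i. if i = j then 1 else 0) \<in> freemod V c"
  by (auto simp: freemod_def)

lemma matapp_unit:
  "j < c \<Longrightarrow> matapp r c A (\<lambda>i. if i = j then 1 else 0) = (\<lambda>i. if i < r then A i j else 0)"
  by (auto simp: matapp_def if_distrib[of "\<lambda>x. _ * x"] cong: if_cong)

text \<open>The last three hypotheses say that 0 -> \<open>KA\<close> -> \<open>K\<close> ->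
  \<open>KC\<close> -> 0 is exact for the inclusion and projection of the block vectors. Generators
  of \<open>KC\<close> are lifted to \<open>K\<close>, which gives a block triangular matrix; the
  kernels of the three matrices again form such a sequence, so the induction continues with the
  syzygies.\<close>

lemma horseshoe:
  fixes K :: "(nat \<Rightarrow> ('v, 'k::field) mpoly) set"
  assumes "res V m KA a" "res V m KC c" "submod V (a + c) K"
    and "\<And>x. x \<in> freemod V a \<Longrightarrow> join a x (\<lambda>_. 0) \<in> K \<longleftrightarrow> x \<in> KA"
    and "\<And>x y. x \<in> freemod V a \<Longrightarrow> y \<in> freemod V c \<Longrightarrow> join a x y \<in> K \<Longrightarrow> y \<in> KC"
    and "\<And>y. y \<in> KC \<Longrightarrow> \<exists>x\<in>freemod V a. join a x y \<in> K"
  shows "res V m K (a + c)"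
  using assms
proof (induction m arbitrary: KA KC K a c)
  case 0
  have "z = (\<lambda>_. 0)" if "z \<in> K" for z
  proof -
    obtain x y where xy: "x \<in> freemod V a" "y \<in> freemod V c" "z = join a x y"
      using freemod_split[OF subsetD[OF submod_subset[OF 0(3)] \<open>z \<in> K\<close>]] .
    have "y \<in> KC" using 0(5)[OF xy(1,2)] xy(3) that by simp
    then have y: "y = (\<lambda>_. 0)" using 0(2) by simp
    have "x \<in> KA" using 0(4)[OF xy(1)] xy(3) that y by simp
    then have "x = (\<lambda>_. 0)" using 0(1) by simp
    with y xy show ?thesis by simp
  qed
  then show ?case unfolding res.simps(1) using submod_zero[OF 0(3)] by blast
next
  case (Suc m)
  obtain a' A where A: "matrix_over V a a' A" "KA = img V a a' A" "res V m (ker V a a' A) a'"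
    using Suc.prems(1) by auto
  obtain c' C where C: "matrix_over V c c' C" "KC = img V c c' C" "res V m (ker V c c' C) c'"
    using Suc.prems(2) by auto
  \<comment> \<open>The columns of \<open>C\<close> generate \<open>KC\<close>; it suffices to lift
    these finitely many vectors to \<open>K\<close>.\<close>
  define col where "col j = (\<lambda>i. if i < c then C i j else 0)" for j
  have "\<exists>x\<in>freemod V a. join a x (col j) \<in> K" if "j < c'" for j
  proof (rule Suc.prems(6))
    have "col j = matapp c c' C (\<lambda>i. if i = j then 1 else 0)"
      unfolding col_def by (rule matapp_unit[OF that, symmetric])
    then show "col j \<in> KC"
      unfolding C(2) img_def using freemod_unit[OF that] by (rule image_eqI)
  qed
  then obtain b where b: "\<And>j. j < c' \<Longrightarrow> b j \<in> freemod V a" "\<And>j. j < c' \<Longrightarrow> join a (b j) (col j) \<in> K"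
    by metis
  define \<beta> where "\<beta> w = (\<lambda>i. \<Sum>j<c'. w j * b j i)" for w
  have \<beta>: "\<beta> w \<in> freemod V a" if "w \<in> freemod V c'" for w
    unfolding \<beta>_def using that
    by (intro submod_sum[OF submod_freemod] submod_scale[OF submod_freemod]) (auto intro: b simp: freemodD)
  have lift: "join a (\<beta> w) (matapp c c' C w) \<in> K" if "w \<in> freemod V c'" for w
  proof -
    have "(\<lambda>i. \<Sum>j<c'. w j * join a (b j) (col j) i) \<in> K"
      using that by (intro submod_sum[OF Suc.prems(3)] submod_scale[OF Suc.prems(3)]) (auto intro: b simp: freemodD)
    also have "(\<lambda>i. \<Sum>j<c'. w j * join a (b j) (col j) i) = join a (\<beta> w) (matapp c c' C w)"
      by (auto simp: join_def \<beta>_def matapp_def col_def mult.commute)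
    finally show ?thesis .
  qed
  \<comment> \<open>The block matrix with diagonal blocks \<open>A\<close> and \<open>C\<close>, the
    lifts \<open>b\<close> as upper right block, and zero below \<open>A\<close>.\<close>
  define B where "B i j = (if j < a' then (if i < a then A i j else 0)
      else (if i < a then b (j - a') i else C (i - a) (j - a')))" for i j
  have B: "matrix_over V (a + c) (a' + c') B"
    using A(1) C(1) by (auto simp: matrix_over_def B_def freemodD[OF b(1)])
  have app: "matapp (a + c) (a' + c') B (join a' u w) = join a (\<lambda>i. matapp a a' A u i + \<beta> w i) (matapp c c' C w)"
    if "w \<in> freemod V c'" for u w
  proof
    fix i
    have "b j i = 0" if "j < c'" "i \<ge> a" for j
      using b(1)[OF that(1)] that(2) by (rule freemod_beyond)
    then show "matapp (a + c) (a' + c') B (join a' u w) i = join a (\<lambda>i. matapp a a' A u i + \<beta> w i) (matapp c c' C w) i"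
      by (auto simp: matapp_def join_def sum_lessThan_add B_def \<beta>_def mult.commute)
  qed
  have KB: "K = img V (a + c) (a' + c') B"
  proof (intro equalityI subsetI)
    fix z assume z: "z \<in> K"
    obtain x y where xy: "x \<in> freemod V a" "y \<in> freemod V c" "z = join a x y"
      using freemod_split[OF subsetD[OF submod_subset[OF Suc.prems(3)] z]] .
    then have "y \<in> KC" using Suc.prems(5) z by blast
    then obtain w where w: "w \<in> freemod V c'" "y = matapp c c' C w"
      by (auto simp: C(2) img_def)
    have "join a (\<lambda>i. x i - \<beta> w i) (\<lambda>_. 0) \<in> K"
      using submod_diff[OF Suc.prems(3) z lift[OF w(1)]] by (simp add: xy w join_diff)
    moreover have "(\<lambda>i. x i - \<beta> w i) \<in> freemod V a"
      by (rule submod_diff[OF submod_freemod xy(1) \<beta>[OF w(1)]])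
    ultimately have "(\<lambda>i. x i - \<beta> w i) \<in> KA"
      using Suc.prems(4) by blast
    then obtain u where u: "u \<in> freemod V a'" "(\<lambda>i. x i - \<beta> w i) = matapp a a' A u"
      by (auto simp: A(2) img_def)
    have "x = (\<lambda>i. matapp a a' A u i + \<beta> w i)"
      using fun_cong[OF u(2)] by (intro ext) (simp add: algebra_simps)
    then have "z = matapp (a + c) (a' + c') B (join a' u w)"
      using xy w by (simp add: app)
    then show "z \<in> img V (a + c) (a' + c') B"
      using u w unfolding img_def by (auto intro: join_freemod)
  next
    fix z assume "z \<in> img V (a + c) (a' + c') B"
    then obtain t where t: "t \<in> freemod V (a' + c')" "z = matapp (a + c) (a' + c') B t"
      by (auto simp: img_def)
    obtain u w where uw: "u \<in> freemod V a'" "w \<in> freemod V c'" "t = join a' u w"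
      using freemod_split[OF t(1)] .
    have "matapp a a' A u \<in> KA"
      using uw by (auto simp: A(2) img_def)
    then have "join a (matapp a a' A u) (\<lambda>_. 0) \<in> K"
      using Suc.prems(4) A(1) uw matapp_freemod by blast
    from submod_add[OF Suc.prems(3) this lift[OF uw(2)]]
    show "z \<in> K" by (simp add: t uw app join_add)
  qed
  have "res V m (ker V (a + c) (a' + c') B) (a' + c')"
  proof (rule Suc.IH[OF A(3) C(3) submod_ker])
    fix u :: "nat \<Rightarrow> ('v, 'k) mpoly" assume "u \<in> freemod V a'"
    moreover have "(\<lambda>_. 0 :: ('v, 'k) mpoly) \<in> freemod V c'" by (auto simp: freemod_def)
    moreover have "\<beta> (\<lambda>_. 0) = (\<lambda>_. 0)" by (simp add: \<beta>_def)
    moreover have "join a (matapp a a' A u) (\<lambda>_. 0) = (\<lambda>_. 0) \<longleftrightarrow> matapp a a' A u = (\<lambda>_. 0)"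
    proof
      assume "join a (matapp a a' A u) (\<lambda>_. 0) = (\<lambda>_. 0)"
      then have "matapp a a' A u i = 0" for i
        by (cases "i < a") (auto simp: join_def matapp_def dest!: fun_cong[of _ _ i])
      then show "matapp a a' A u = (\<lambda>_. 0)" by auto
    qed simp
    ultimately show "join a' u (\<lambda>_. 0) \<in> ker V (a + c) (a' + c') B \<longleftrightarrow> u \<in> ker V a a' A"
      by (auto simp: ker_def app join_freemod)
  next
    fix u w :: "nat \<Rightarrow> ('v, 'k) mpoly" assume uw: "u \<in> freemod V a'" "w \<in> freemod V c'" "join a' u w \<in> ker V (a + c) (a' + c') B"
    then have "join a (\<lambda>i. matapp a a' A u i + \<beta> w i) (matapp c c' C w) = (\<lambda>_. 0)"
      by (simp add: ker_def app)
    then have "matapp c c' C w i = 0" for i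
      by (auto simp: join_def dest!: fun_cong[of _ _ "i + a"])
    then show "w \<in> ker V c c' C" using uw by (auto simp: ker_def)
  next
    \<comment> \<open>A relation \<open>w\<close> among the columns of \<open>C\<close> lifts to an
      element of \<open>K\<close> without second block. Its first block lies in \<open>KA\<close>,
      hence is \<open>A\<close> applied to some \<open>u\<close>, and \<open>- u\<close> completes
      \<open>w\<close> to a relation among the columns of \<open>B\<close>.\<close>
    fix w assume "w \<in> ker V c c' C"
    then have w: "w \<in> freemod V c'" "matapp c c' C w = (\<lambda>_. 0)" by (auto simp: ker_def)
    then have "\<beta> w \<in> KA"
      using lift[OF w(1)] Suc.prems(4)[OF \<beta>[OF w(1)]] by simp
    then obtain u where u: "u \<in> freemod V a'" "\<beta> w = matapp a a' A u"
      by (auto simp: A(2) img_def)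
    have "(\<lambda>i. - u i) \<in> freemod V a'"
      using submod_scale[OF submod_freemod polyring_uminus[OF polyring_one] u(1)] by simp
    moreover have "join a' (\<lambda>i. - u i) w \<in> ker V (a + c) (a' + c') B"
      using calculation w by (auto simp: ker_def app join_freemod matapp_uminus u)
    ultimately show "\<exists>u\<in>freemod V a'. join a' u w \<in> ker V (a + c) (a' + c') B" by blast
  qed
  then show ?case using B KB by auto
qed

text \<open>The mapping cone of multiplication by a nonzerodivisor: the kernel of the matrix \<open>(B | x)\<close>
  is an extension of \<open>K\<close> by the kernel of \<open>B\<close>.\<close>
lemma res_mod_nonzerodivisor:
  fixes K :: "(nat \<Rightarrow> ('v, 'k::field) mpoly) set"
  assumes "res V m K r" "x \<in> polyring V"
    and nzd: "\<And>u. u \<in> freemod V r \<Longrightarrow> (\<lambda>i. x * u i) \<in> K \<Longrightarrow> u \<in> K"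
  shows "res V (Suc m) {\<lambda>i. k i + x * u i | k u. k \<in> K \<and> u \<in> freemod V r} r"
proof -
  note K = res_submod[OF assms(1)]
  \<comment> \<open>Lengthening by one supplies a matrix with image \<open>K\<close> even for
    \<open>m = 0\<close>.\<close>
  obtain c B where B: "matrix_over V r c B" "K = img V r c B" "res V m (ker V r c B) c"
    using res_Suc[OF assms(1)] by auto
  define D where "D i j = (if j < c then B i j else if j - c = i then x else 0)" for i j
  have D: "matrix_over V r (c + r) D"
    using B(1) assms(2) by (auto simp: matrix_over_def D_def)
  have app: "matapp r (c + r) D (join c y u) = (\<lambda>i. matapp r c B y i + x * u i)"
    if "u \<in> freemod V r" for y u
    using freemod_beyond[OF that]
    by (auto simp: matapp_def sum_lessThan_add D_def join_def if_distrib[of "\<lambda>z. z * _"] cong: if_cong)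
  have "{\<lambda>i. k i + x * u i | k u. k \<in> K \<and> u \<in> freemod V r} = img V r (c + r) D"
  proof (intro equalityI subsetI)
    fix z assume "z \<in> {\<lambda>i. k i + x * u i | k u. k \<in> K \<and> u \<in> freemod V r}"
    then obtain y u where "y \<in> freemod V c" "u \<in> freemod V r" "z = (\<lambda>i. matapp r c B y i + x * u i)"
      by (auto simp: B(2) img_def)
    then show "z \<in> img V r (c + r) D"
      unfolding img_def by (auto simp: app intro!: image_eqI[of _ _ "join c y u"] join_freemod)
  next
    fix z assume "z \<in> img V r (c + r) D"
    then obtain t where t: "t \<in> freemod V (c + r)" "z = matapp r (c + r) D t"
      by (auto simp: img_def)
    obtain y u where "y \<in> freemod V c" "u \<in> freemod V r" "t = join c y u"
      using freemod_split[OF t(1)] .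
    then show "z \<in> {\<lambda>i. k i + x * u i | k u. k \<in> K \<and> u \<in> freemod V r}"
      by (auto simp: t app B(2) img_def)
  qed
  \<comment> \<open>A pair \<open>(y, u)\<close> is in the kernel when B y + x u = 0. Then x u lies
    in \<open>K\<close>, so \<open>u\<close> does; conversely x u lies in \<open>K\<close> for every
    \<open>u\<close> in \<open>K\<close> and is cancelled by some B y.\<close>
  moreover have "res V m (ker V r (c + r) D) (c + r)"
  proof (rule horseshoe[OF B(3) assms(1) submod_ker])
    fix y :: "nat \<Rightarrow> ('v, 'k) mpoly" assume "y \<in> freemod V c"
    moreover have "(\<lambda>_. 0 :: ('v, 'k) mpoly) \<in> freemod V r" by (auto simp: freemod_def)
    ultimately show "join c y (\<lambda>_. 0) \<in> ker V r (c + r) D \<longleftrightarrow> y \<in> ker V r c B"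
      by (auto simp: ker_def app join_freemod)
  next
    fix y u :: "nat \<Rightarrow> ('v, 'k) mpoly" assume yu: "y \<in> freemod V c" "u \<in> freemod V r" "join c y u \<in> ker V r (c + r) D"
    then have 0: "(\<lambda>i. matapp r c B y i + x * u i) = (\<lambda>_. 0)" by (simp add: ker_def app)
    have "matapp r c B y \<in> K" using yu by (auto simp: B(2) img_def)
    then have "(\<lambda>i. (-1) * matapp r c B y i) \<in> K"
      by (intro submod_scale[OF K]) auto
    also have "(\<lambda>i. (-1) * matapp r c B y i) = (\<lambda>i. x * u i)"
      using fun_cong[OF 0] by (intro ext) (metis add_eq_0_iff mult_minus1 minus_minus)
    finally show "u \<in> K" using nzd yu by blast
  next
    fix u assume u: "u \<in> K"
    then have "(\<lambda>i. (- x) * u i) \<in> K"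
      using assms(2) by (intro submod_scale[OF K]) auto
    then obtain y where y: "y \<in> freemod V c" "(\<lambda>i. (- x) * u i) = matapp r c B y"
      by (auto simp: B(2) img_def)
    moreover have "u \<in> freemod V r" using u submod_subset[OF K] by auto
    ultimately have "join c y u \<in> ker V r (c + r) D"
      by (auto simp: ker_def app join_freemod simp flip: y(2))
    then show "\<exists>y\<in>freemod V c. join c y u \<in> ker V r (c + r) D" using y by blast
  qed
  ultimately show ?thesis using D by auto
qed

text \<open>The augmentation may use any finite generating family of S/J, because an extension
  stacks the generators of its two ends and so leaves rank one.\<close>

definition resolvable :: "'v set \<Rightarrow> ('v, 'k::field) mpoly set \<Rightarrow> nat \<Rightarrow> bool" where
  "resolvable V J m \<longleftrightarrow> (\<exists>r g. (\<forall>j<r. g j \<in> polyring V)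
     \<and> (\<forall>p\<in>polyring V. \<exists>x\<in>freemod V r. (\<Sum>j<r. x j * g j) - p \<in> J)
     \<and> res V m {x\<in>freemod V r. (\<Sum>j<r. x j * g j) \<in> J} r)"

lemma resolvableE:
  assumes "resolvable V J m"
  obtains r g where "\<forall>j<r. g j \<in> polyring V"
      "\<forall>p\<in>polyring V. \<exists>u\<in>freemod V r. (\<Sum>j<r. u j * g j) - p \<in> J"
      "res V m {u\<in>freemod V r. (\<Sum>j<r. u j * g j) \<in> J} r"
  using assms unfolding resolvable_def by (elim exE conjE)

definition exact_complex :: "'v set \<Rightarrow> (nat \<Rightarrow> ('v, 'k::field) mpoly) set \<Rightarrow> nat \<Rightarrow> (nat \<Rightarrow> nat)
    \<Rightarrow> (nat \<Rightarrow> nat \<Rightarrow> nat \<Rightarrow> ('v, 'k) mpoly) \<Rightarrow> bool" where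
  "exact_complex V K m r d \<longleftrightarrow>
     (\<forall>k\<in>{1..m}. matrix_over V (r (k - 1)) (r k) (d k))
   \<and> K = (if m = 0 then {\<lambda>_. 0} else img V (r 0) (r 1) (d 1))
   \<and> (\<forall>k. 0 < k \<and> k < m \<longrightarrow> ker V (r (k - 1)) (r k) (d k) = img V (r k) (r (k + 1)) (d (k + 1)))
   \<and> (0 < m \<longrightarrow> ker V (r (m - 1)) (r m) (d m) = {\<lambda>_. 0})"

text \<open>Splitting off the first map and shifting indices matches the indexed complexes with the
  recursion of \<open>res\<close>.\<close>

lemma exact_complex_Suc:
  "exact_complex V K (Suc m) r d \<longleftrightarrow> matrix_over V (r 0) (r 1) (d 1) \<and> K = img V (r 0) (r 1) (d 1)
     \<and> exact_complex V (ker V (r 0) (r 1) (d 1)) m (\<lambda>k. r (Suc k)) (\<lambda>k. d (Suc k))"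
proof -
  have 1: "(\<forall>k\<in>{1..Suc m}. P k) \<longleftrightarrow> P 1 \<and> (\<forall>k\<in>{1..m}. P (Suc k))" for P
  proof (intro iffI conjI ballI)
    fix k assume *: "P 1 \<and> (\<forall>k\<in>{1..m}. P (Suc k))" "k \<in> {1..Suc m}"
    then obtain l where "k = Suc l" by (cases k) auto
    then show "P k" using * by (cases l) auto
  qed auto
  have 2: "(\<forall>k. 0 < k \<and> k < Suc m \<longrightarrow> P k) \<longleftrightarrow> (0 < m \<longrightarrow> P 1) \<and> (\<forall>k. 0 < k \<and> k < m \<longrightarrow> P (Suc k))" for P
  proof (intro iffI conjI allI impI)
    fix k assume *: "(0 < m \<longrightarrow> P 1) \<and> (\<forall>k. 0 < k \<and> k < m \<longrightarrow> P (Suc k))" "0 < k \<and> k < Suc m"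
    then obtain l where "k = Suc l" by (cases k) auto
    then show "P k" using * by (cases l) auto
  qed auto
  show ?thesis
    unfolding exact_complex_def 1 2 by (cases m) (auto cong: conj_cong)
qed

lemma res_iff_exact_complex:
  "res V m K r0 \<longleftrightarrow> (\<exists>r d. r 0 = r0 \<and> exact_complex V K m r d)"
proof (induction m arbitrary: K r0)
  case 0
  show ?case by (auto simp: exact_complex_def intro: exI[of _ "\<lambda>_. r0"])
next
  case (Suc m)
  show ?case
  proof
    assume "res V (Suc m) K r0"
    then obtain c A where A: "matrix_over V r0 c A" "K = img V r0 c A" "res V m (ker V r0 c A) c"
      by auto
    then obtain r d where rd: "r 0 = c" "exact_complex V (ker V r0 c A) m r d"
      using Suc.IH by blast
    define r' where "r' = case_nat r0 r"
    define d' where "d' k = (if k = Suc 0 then A else d (k - 1))" for k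
    have "(\<lambda>k. r' (Suc k)) = r" by (simp add: r'_def)
    moreover have "exact_complex V (ker V r0 c A) m r (\<lambda>k. d' (Suc k))"
      using rd(2) unfolding exact_complex_def d'_def by auto
    ultimately have "exact_complex V (ker V r0 c A) m (\<lambda>k. r' (Suc k)) (\<lambda>k. d' (Suc k))"
      by simp
    then have "exact_complex V K (Suc m) r' d'"
      using A rd(1) unfolding exact_complex_Suc by (simp add: r'_def d'_def)
    then show "\<exists>r d. r 0 = r0 \<and> exact_complex V K (Suc m) r d"
      by (intro exI[of _ r'] exI[of _ d']) (simp add: r'_def)
  next
    assume "\<exists>r d. r 0 = r0 \<and> exact_complex V K (Suc m) r d"
    then obtain r d where rd: "r 0 = r0" "exact_complex V K (Suc m) r d" by blast
    then have "res V m (ker V (r 0) (r 1) (d 1)) (r 1)"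
      using Suc.IH unfolding exact_complex_Suc by auto
    then show "res V (Suc m) K r0"
      using rd unfolding exact_complex_Suc by auto
  qed
qed

lemma free_resolution_iff:
  "free_resolution V J m r d g \<longleftrightarrow> (\<forall>j<r 0. g j \<in> polyring V)
     \<and> (\<forall>p\<in>polyring V. \<exists>x\<in>freemod V (r 0). (\<Sum>j<r 0. x j * g j) - p \<in> J)
     \<and> exact_complex V {x\<in>freemod V (r 0). (\<Sum>j<r 0. x j * g j) \<in> J} m r d"
proof -
  let ?M = "\<forall>k\<in>{1..m}. matrix_over V (r (k - 1)) (r k) (d k)"
  have K0: "(\<forall>x\<in>freemod V (r 0). ((\<Sum>j<r 0. x j * g j) \<in> J) \<longleftrightarrow>
         (if m = 0 then x = (\<lambda>_. 0) else (\<exists>y\<in>freemod V (r 1). x = matapp (r 0) (r 1) (d 1) y)))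
      \<longleftrightarrow> {x\<in>freemod V (r 0). (\<Sum>j<r 0. x j * g j) \<in> J} =
          (if m = 0 then {\<lambda>_. 0} else img V (r 0) (r 1) (d 1))" if ?M
  proof -
    have "(if m = 0 then {\<lambda>_. 0} else img V (r 0) (r 1) (d 1)) \<subseteq> freemod V (r 0)"
      using that[rule_format, of 1] submod_subset[OF submod_img[of V "r 0" "r 1" "d 1"]] submod_zero[OF submod_freemod, of V "r 0"] by auto
    then show ?thesis by (auto simp: img_def split: if_splits)
  qed
  have K1: "(\<forall>x\<in>freemod V (r k). matapp (r (k - 1)) (r k) (d k) x = (\<lambda>_. 0) \<longleftrightarrow>
         (\<exists>y\<in>freemod V (r (k + 1)). x = matapp (r k) (r (k + 1)) (d (k + 1)) y))
      \<longleftrightarrow> ker V (r (k - 1)) (r k) (d k) = img V (r k) (r (k + 1)) (d (k + 1))" if ?M "0 < k \<and> k < m" for k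
  proof -
    have "matrix_over V (r k) (r (k + 1)) (d (k + 1))"
      using that(1)[rule_format, of "k + 1"] that(2) by simp
    from submod_subset[OF submod_img[OF this]]
    show ?thesis by (auto simp: img_def ker_def)
  qed
  have K2: "(\<forall>x\<in>freemod V (r m). matapp (r (m - 1)) (r m) (d m) x = (\<lambda>_. 0) \<longrightarrow> x = (\<lambda>_. 0))
      \<longleftrightarrow> ker V (r (m - 1)) (r m) (d m) = {\<lambda>_. 0}"
    using submod_zero[OF submod_freemod, of V "r m"] by (auto simp: ker_def)
  have M: "(\<forall>k\<in>{1..m}. \<forall>i<r (k - 1). \<forall>j<r k. d k i j \<in> polyring V) \<longleftrightarrow> ?M"
    by (simp add: matrix_over_def)
  show ?thesis
  \<comment> \<open>The comparison of elementwise exactness with equality of submodules uses that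
    images stay inside the free modules, which holds for polynomial entries. If some entry is not in
    the ring, both sides fail.\<close>
  proof (cases ?M)
    case True
    show ?thesis
      unfolding free_resolution_def exact_complex_def M K2 K0[OF True] using K1[OF True] by auto
  next
    case False
    then show ?thesis unfolding free_resolution_def exact_complex_def M by blast
  qed
qed

lemma resolvable_iff_free_resolution:
  "resolvable V J m \<longleftrightarrow> (\<exists>r d g. free_resolution V J m r d g)"
proof
  assume "resolvable V J m"
  then obtain r0 g where *: "\<forall>j<r0. g j \<in> polyring V"
     "\<forall>p\<in>polyring V. \<exists>x\<in>freemod V r0. (\<Sum>j<r0. x j * g j) - p \<in> J"
     "res V m {x\<in>freemod V r0. (\<Sum>j<r0. x j * g j) \<in> J} r0"
    unfolding resolvable_def by (elim exE conjE)
  from *(3) obtain r d where "r 0 = r0" "exact_complex V {x\<in>freemod V r0. (\<Sum>j<r0. x j * g j) \<in> J} m r d"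
    unfolding res_iff_exact_complex by (elim exE conjE)
  with * have "free_resolution V J m r d g"
    unfolding free_resolution_iff by simp
  then show "\<exists>r d g. free_resolution V J m r d g" by blast
next
  assume "\<exists>r d g. free_resolution V J m r d g"
  then obtain r d g where "free_resolution V J m r d g" by blast
  then show "resolvable V J m"
    unfolding free_resolution_iff resolvable_def res_iff_exact_complex
    by (intro exI[of _ "r 0"] exI[of _ g]) blast
qed

lemma resolvable_mono: "resolvable V J m \<Longrightarrow> m \<le> n \<Longrightarrow> resolvable V J n"
  unfolding resolvable_def by (elim exE conjE) (intro exI conjI, assumption, assumption, rule res_mono)

lemma resolvable_zero: "resolvable V ({0} :: ('a, 'b::field) mpoly set) 0"
  unfolding resolvable_def
proof (intro exI[of _ 1] exI[of _ "\<lambda>_. 1"] conjI)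
  show "\<forall>p\<in>polyring V. \<exists>x\<in>freemod V 1. (\<Sum>j<1. x j * 1) - p \<in> {0}"
  proof
    fix p assume "p \<in> polyring V"
    then show "\<exists>x\<in>freemod V 1. (\<Sum>j<1. x j * 1) - p \<in> {0}"
      by (intro bexI[of _ "\<lambda>i. if i = 0 then p else 0"]) (auto simp: freemod_def)
  qed
  show "res V 0 {x :: nat \<Rightarrow> ('a, 'b) mpoly. x \<in> freemod V 1 \<and> (\<Sum>j<1. x j * 1) \<in> {0}} 1"
  proof -
    have "x = (\<lambda>_. 0)" if "x \<in> freemod V 1" "x 0 = 0" for x :: "nat \<Rightarrow> ('a, 'b) mpoly"
    proof
      fix i show "x i = 0" using that by (cases i) (auto simp: freemod_def)
    qed
    then have "{x\<in>freemod V 1. x 0 = 0} = {\<lambda>_. 0 :: ('a, 'b) mpoly}"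
      using submod_zero[OF submod_freemod, of V 1] by blast
    then show ?thesis by simp
  qed
qed simp

lemma resolvable_split:
  fixes J :: "('v, 'k::field) mpoly set"
  assumes J: "is_ideal V J" and x: "x \<in> polyring V"
    and "resolvable V (colon V J x) m" "resolvable V (adjoin V J x) m"
  shows "resolvable V J m"
proof -
  obtain a gA where gA: "\<forall>j<a. gA j \<in> polyring V"
      "\<forall>p\<in>polyring V. \<exists>u\<in>freemod V a. (\<Sum>j<a. u j * gA j) - p \<in> colon V J x"
      "res V m {u\<in>freemod V a. (\<Sum>j<a. u j * gA j) \<in> colon V J x} a"
    using resolvableE[OF assms(3)] .
  obtain c gC where gC: "\<forall>j<c. gC j \<in> polyring V"
      "\<forall>p\<in>polyring V. \<exists>u\<in>freemod V c. (\<Sum>j<c. u j * gC j) - p \<in> adjoin V J x"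
      "res V m {u\<in>freemod V c. (\<Sum>j<c. u j * gC j) \<in> adjoin V J x} c"
    using resolvableE[OF assms(4)] .
  define sA where "sA u = (\<Sum>j<a. u j * gA j)" for u
  define sC where "sC u = (\<Sum>j<c. u j * gC j)" for u
  \<comment> \<open>Multiplication by \<open>x\<close> embeds S/(J : x) into S/J, so its generators
    appear there as \<open>x * gA j\<close>.\<close>
  define g where "g = join a (\<lambda>j. x * gA j) gC"
  define s where "s z = (\<Sum>j<a + c. z j * g j)" for z
  have s: "s (join a u w) = x * sA u + sC w" for u w
    by (simp add: s_def sA_def sC_def sum_lessThan_add g_def join_def sum_distrib_left algebra_simps)
  have g: "g j \<in> polyring V" if "j < a + c" for j
    using that x gA(1) gC(1) by (auto simp: g_def join_def)
  have sA: "sA u \<in> polyring V" if "u \<in> freemod V a" for u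
    unfolding sA_def using that gA(1) by (auto intro!: polyring_sum polyring_mult simp: freemodD)
  have sC: "sC u \<in> polyring V" if "u \<in> freemod V c" for u
    unfolding sC_def using that gC(1) by (auto intro!: polyring_sum polyring_mult simp: freemodD)
  \<comment> \<open>Every element of (J, x) can be moved into \<open>J\<close> by a combination of
    the generators \<open>x * gA j\<close>. This gives both the lifting of relations and the
    surjectivity of the new augmentation.\<close>
  have lift: "\<exists>u\<in>freemod V a. x * sA u + (q + r * x) \<in> J" if "q \<in> J" "r \<in> polyring V" for q r
  proof -
    obtain u where u: "u \<in> freemod V a" "sA u - (- r) \<in> colon V J x"
      using gA(2)[rule_format, of "- r"] \<open>r \<in> polyring V\<close> by (auto simp: sA_def)
    then have "q + x * (sA u - (- r)) \<in> J"
      using \<open>q \<in> J\<close> by (auto simp: colon_def intro: ideal_add[OF J])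
    then show ?thesis using u(1) by (auto simp: algebra_simps intro!: bexI[of _ u])
  qed
  have sub: "submod V (a + c) {z\<in>freemod V (a + c). s z \<in> J}"
    using submod_freemod[of V "a + c"] unfolding submod_def
    by (auto simp: s_def algebra_simps sum.distrib ideal_zero[OF J] intro: ideal_add[OF J])
      (simp add: ideal_mult[OF J] flip: sum_distrib_left)
  have "res V m {z\<in>freemod V (a + c). s z \<in> J} (a + c)"
  proof (rule horseshoe[OF gA(3) gC(3) sub, folded sA_def sC_def])
    fix u :: "nat \<Rightarrow> ('v, 'k) mpoly" assume u: "u \<in> freemod V a"
    have "sC (\<lambda>_. 0) = 0" "(\<lambda>_. 0 :: ('v, 'k) mpoly) \<in> freemod V c" by (auto simp: sC_def freemod_def)
    then show "join a u (\<lambda>_. 0) \<in> {z\<in>freemod V (a + c). s z \<in> J} \<longleftrightarrow> u \<in> {u\<in>freemod V a. sA u \<in> colon V J x}"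
      using u sA[OF u] by (auto simp: s colon_def join_freemod)
  next
    fix u w :: "nat \<Rightarrow> ('v, 'k) mpoly" assume uw: "u \<in> freemod V a" "w \<in> freemod V c" "join a u w \<in> {z\<in>freemod V (a + c). s z \<in> J}"
    then have "s (join a u w) + (- sA u) * x \<in> adjoin V J x"
      using sA by (intro adjoinI) auto
    then show "w \<in> {u\<in>freemod V c. sC u \<in> adjoin V J x}"
      using uw by (simp add: s algebra_simps)
  next
    fix w assume "w \<in> {u\<in>freemod V c. sC u \<in> adjoin V J x}"
    then obtain q r where *: "w \<in> freemod V c" "sC w = q + r * x" "q \<in> J" "r \<in> polyring V"
      by (auto simp: adjoin_def)
    then show "\<exists>u\<in>freemod V a. join a u w \<in> {z\<in>freemod V (a + c). s z \<in> J}"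
      using lift[OF *(3,4)] by (auto simp: s join_freemod)
  qed
  moreover have "\<exists>z\<in>freemod V (a + c). s z - p \<in> J" if p: "p \<in> polyring V" for p
  proof -
    obtain w where w: "w \<in> freemod V c" "sC w - p \<in> adjoin V J x"
      using gC(2)[rule_format, OF p] by (auto simp: sC_def)
    then obtain q r where *: "sC w - p = q + r * x" "q \<in> J" "r \<in> polyring V"
      by (auto simp: adjoin_def)
    from lift[OF *(2,3)] obtain u where "u \<in> freemod V a" "x * sA u + (sC w - p) \<in> J"
      unfolding *(1) by blast
    then show ?thesis
      using w by (intro bexI[of _ "join a u w"]) (auto simp: s join_freemod algebra_simps)
  qed
  ultimately show ?thesis
    unfolding resolvable_def s_def using g by (intro exI[of _ "a + c"] exI[of _ g]) auto
qed

text \<open>The generators of S/J still generate S/(J, x), and their relations become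
  \<open>K\<close> plus the multiples of \<open>x\<close>; this is the module resolved in
  \<open>res_mod_nonzerodivisor\<close>.\<close>

lemma resolvable_adjoin_nonzerodivisor:
  fixes J :: "('v, 'k::field) mpoly set"
  assumes J: "is_ideal V J" and x: "x \<in> polyring V" and "resolvable V J m"
    and nzd: "\<And>p. p \<in> polyring V \<Longrightarrow> x * p \<in> J \<Longrightarrow> p \<in> J"
  shows "resolvable V (adjoin V J x) (Suc m)"
proof -
  obtain r g where g: "\<forall>j<r. g j \<in> polyring V"
      "\<forall>p\<in>polyring V. \<exists>u\<in>freemod V r. (\<Sum>j<r. u j * g j) - p \<in> J"
      "res V m {u\<in>freemod V r. (\<Sum>j<r. u j * g j) \<in> J} r"
    using resolvableE[OF assms(3)] .
  define s where "s u = (\<Sum>j<r. u j * g j)" for u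
  define K where "K = {u\<in>freemod V r. s u \<in> J}"
  have s: "s u \<in> polyring V" if "u \<in> freemod V r" for u
    unfolding s_def using that g(1) by (auto intro!: polyring_sum polyring_mult simp: freemodD)
  have s_scale: "s (\<lambda>i. p * u i) = p * s u" for p u
    by (simp add: s_def sum_distrib_left algebra_simps)
  have s_add: "s (\<lambda>i. u i + w i) = s u + s w" for u w
    by (simp add: s_def sum.distrib algebra_simps)
  have "res V m K r" using g(3) by (simp add: K_def s_def)
  moreover have "u \<in> K" if "u \<in> freemod V r" "(\<lambda>i. x * u i) \<in> K" for u
    using that nzd s by (auto simp: K_def s_scale)
  ultimately have "res V (Suc m) {\<lambda>i. k i + x * u i | k u. k \<in> K \<and> u \<in> freemod V r} r"
    using res_mod_nonzerodivisor x by blast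
  also have "{\<lambda>i. k i + x * u i | k u. k \<in> K \<and> u \<in> freemod V r} = {u\<in>freemod V r. s u \<in> adjoin V J x}"
  proof (intro equalityI subsetI)
    fix z assume "z \<in> {\<lambda>i. k i + x * u i | k u. k \<in> K \<and> u \<in> freemod V r}"
    then obtain k u where z: "z = (\<lambda>i. k i + x * u i)" "k \<in> freemod V r" "s k \<in> J" "u \<in> freemod V r"
      by (auto simp: K_def)
    then have "s k + s u * x \<in> adjoin V J x"
      using s by (intro adjoinI) auto
    then have "s z \<in> adjoin V J x"
      by (simp add: z(1) s_add s_scale mult.commute)
    moreover have "z \<in> freemod V r"
      unfolding z(1) using z x by (intro submod_add[OF submod_freemod] submod_scale[OF submod_freemod])
    ultimately show "z \<in> {u\<in>freemod V r. s u \<in> adjoin V J x}" by simp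
  next
    fix z assume "z \<in> {u\<in>freemod V r. s u \<in> adjoin V J x}"
    then obtain q t where z: "z \<in> freemod V r" "s z = q + t * x" "q \<in> J" "t \<in> polyring V"
      by (auto simp: adjoin_def)
    obtain u where u: "u \<in> freemod V r" "s u - t \<in> J"
      using g(2)[rule_format, OF z(4)] by (auto simp: s_def)
    \<comment> \<open>If \<open>s z\<close> is in (J, x) with coefficient \<open>t\<close> of
      \<open>x\<close>, subtracting \<open>x\<close> times a preimage of \<open>t\<close> leaves a
      relation modulo \<open>J\<close>.\<close>
    define k where "k = (\<lambda>i. z i + (- x) * u i)"
    have "q + (- x) * (s u - t) \<in> J"
      using z u x by (intro ideal_add[OF J] ideal_mult[OF J]) auto
    then have "s k \<in> J"
      unfolding k_def s_add s_scale z(2) by (simp add: algebra_simps)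
    moreover have "k \<in> freemod V r"
      unfolding k_def using z u x by (intro submod_add[OF submod_freemod] submod_scale[OF submod_freemod]) auto
    moreover have "z = (\<lambda>i. k i + x * u i)"
      by (simp add: k_def)
    ultimately show "z \<in> {\<lambda>i. k i + x * u i | k u. k \<in> K \<and> u \<in> freemod V r}"
      using u by (auto simp: K_def)
  qed
  finally have R: "res V (Suc m) {u\<in>freemod V r. s u \<in> adjoin V J x} r" .
  have "\<exists>u\<in>freemod V r. s u - p \<in> adjoin V J x" if "p \<in> polyring V" for p
    using g(2)[rule_format, OF that] adjoin_superset by (fastforce simp: s_def)
  with R show ?thesis
    unfolding resolvable_def s_def using g(1) by blast
qed

section \<open>Lower bound for the length of a resolution\<close>

lemma Var_mult_eq_0_iff: "Var v * p = 0 \<longleftrightarrow> p = 0"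
  using Var_mult_cancel[of v p 0] by auto

lemma filt_Var_mult_self: "filt (\<lambda>n. v \<notin> keys n) (Var v * p) = 0"
  by (rule poly_mapping_eqI) (auto simp: lookup_filt lookup_Var_mult)

lemma filt_Var_mult_other:
  assumes "w \<noteq> v"
  shows "filt (\<lambda>n. v \<notin> keys n) (Var w * p) = Var w * filt (\<lambda>n. v \<notin> keys n) p"
proof -
  have "filt (\<lambda>n. v \<notin> keys n) (Var w) = (Var w :: ('a, 'b) mpoly)"
    using assms by (intro filt_eq) (auto simp: keys_Var)
  then show ?thesis by (subst filt_mult) (auto simp: keys_plus_nat)
qed

text \<open>A map between free modules commutes with multiplication by a variable and its target has
  no torsion. Syzygy modules thus satisfy the hypothesis of \<open>res_specialize\<close>.\<close>

lemma ker_Var_torsion_free: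
  assumes "y \<in> freemod V c" "(\<lambda>i. Var v * y i) \<in> ker V r c A"
  shows "y \<in> ker V r c A"
proof -
  have "(\<lambda>i. Var v * matapp r c A y i) = (\<lambda>_. 0)"
    using assms(2) by (simp add: ker_def matapp_scale)
  then have "matapp r c A y i = 0" for i
    by (simp add: fun_eq_iff Var_mult_eq_0_iff)
  then show ?thesis using assms(1) by (auto simp: ker_def)
qed

text \<open>Setting a variable to zero is exact on a resolution of a module on which the variable is a
  nonzerodivisor.\<close>
lemma res_specialize:
  fixes L :: "(nat \<Rightarrow> ('v, 'k::field) mpoly) set"
  assumes "res V m L r" "v \<in> V"
    and "\<And>y. y \<in> freemod V r \<Longrightarrow> (\<lambda>i. Var v * y i) \<in> L \<Longrightarrow> y \<in> L"
  shows "res (V - {v}) m ((\<lambda>y i. filt (\<lambda>n. v \<notin> keys n) (y i)) ` L) r"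
  using assms(1,3)
proof (induction m arbitrary: L r)
  case 0
  then show ?case by auto
next
  case (Suc m)
  let ?\<sigma> = "filt (\<lambda>n. v \<notin> keys n) :: ('v, 'k) mpoly \<Rightarrow> _"
  obtain c A where A: "matrix_over V r c A" "L = img V r c A" "res V m (ker V r c A) c"
    using Suc.prems(1) by auto
  have \<sigma>_mult: "?\<sigma> (p * q) = ?\<sigma> p * ?\<sigma> q" for p q
    by (rule filt_mult) (auto simp: keys_plus_nat)
  have \<sigma>_ring: "?\<sigma> p \<in> polyring (V - {v})" if "p \<in> polyring V" for p
    using that by (auto simp: polyring_def keys_filt)
  have \<sigma>_id: "?\<sigma> p = p" if "p \<in> polyring (V - {v})" for p
    using that by (intro filt_eq) (auto simp: polyring_def)
  define A' where "A' i j = ?\<sigma> (A i j)" for i j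
  have A': "matrix_over (V - {v}) r c A'"
    using A(1) \<sigma>_ring by (auto simp: matrix_over_def A'_def)
  have app: "matapp r c A' (\<lambda>i. ?\<sigma> (y i)) = (\<lambda>i. ?\<sigma> (matapp r c A y i))" for y
    by (auto simp: matapp_def A'_def filt_sum \<sigma>_mult)
  have \<sigma>_free: "(\<lambda>i. ?\<sigma> (y i)) \<in> freemod (V - {v}) c" if "y \<in> freemod V c" for y
    using that \<sigma>_ring by (auto simp: freemod_def)
  have free_\<sigma>: "(\<lambda>i. ?\<sigma> (y i)) = y" "y \<in> freemod V c" if "y \<in> freemod (V - {v}) c" for y c
    using that \<sigma>_id freemodD[OF that] polyring_mono[of "V - {v}" V] by (auto simp: freemod_def)
  have "(\<lambda>y i. ?\<sigma> (y i)) ` L = img (V - {v}) r c A'"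
  proof (intro equalityI subsetI)
    fix z assume "z \<in> (\<lambda>y i. ?\<sigma> (y i)) ` L"
    then obtain y where "y \<in> freemod V c" "z = (\<lambda>i. ?\<sigma> (matapp r c A y i))"
      by (auto simp: A(2) img_def)
    then show "z \<in> img (V - {v}) r c A'"
      unfolding img_def by (intro image_eqI[of _ _ "\<lambda>i. ?\<sigma> (y i)"]) (auto simp: app \<sigma>_free)
  next
    fix z assume "z \<in> img (V - {v}) r c A'"
    then obtain y where "y \<in> freemod (V - {v}) c" "z = matapp r c A' y"
      by (auto simp: img_def)
    then show "z \<in> (\<lambda>y i. ?\<sigma> (y i)) ` L"
      using free_\<sigma>[of y c] app[of y] by (auto simp: A(2) img_def image_iff)
  qed
  \<comment> \<open>If \<open>A z\<close> vanishes after setting \<open>v\<close> to zero, it is a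
    multiple x_v w. By hypothesis \<open>w\<close> lies in \<open>L\<close>, say w = A t, and z -
    x_v t is a genuine syzygy with the same specialisation as \<open>z\<close>.\<close>
  moreover have "ker (V - {v}) r c A' = (\<lambda>y i. ?\<sigma> (y i)) ` ker V r c A"
  proof (intro equalityI subsetI)
    fix z assume z: "z \<in> ker (V - {v}) r c A'"
    then have z0: "z \<in> freemod (V - {v}) c" "z \<in> freemod V c" "(\<lambda>i. ?\<sigma> (z i)) = z"
      using free_\<sigma> by (auto simp: ker_def)
    have 0: "?\<sigma> (matapp r c A z i) = 0" for i
      using z app[of z] by (simp add: z0(3) ker_def fun_eq_iff)
    have "\<exists>q\<in>polyring V. matapp r c A z i = Var v * q" for i
      using polyring_split_Var[OF freemodD[OF matapp_freemod[OF A(1) z0(2)]], of i v] 0[of i] by (metis add_0)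
    then obtain w where w: "\<And>i. w i \<in> polyring V" "\<And>i. matapp r c A z i = Var v * w i"
      by metis
    have "w i = 0" if "i \<ge> r" for i
      using w(2)[of i] that by (simp add: matapp_def Var_mult_eq_0_iff)
    then have "w \<in> freemod V r" using w by (auto simp: freemod_def)
    moreover have "(\<lambda>i. Var v * w i) \<in> L"
      unfolding A(2) img_def w(2)[symmetric] using z0 by auto
    ultimately have "w \<in> L" by (rule Suc.prems(2))
    then obtain t where t: "t \<in> freemod V c" "w = matapp r c A t"
      by (auto simp: A(2) img_def)
    have "(\<lambda>i. z i - Var v * t i) \<in> ker V r c A"
      unfolding ker_def using z0 t \<open>v \<in> V\<close> w(2)
      by (auto simp: matapp_diff matapp_scale intro!: submod_diff[OF submod_freemod] submod_scale[OF submod_freemod])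
    moreover have "(\<lambda>i. ?\<sigma> (z i - Var v * t i)) = z"
      using z0(3) by (simp add: filt_diff filt_Var_mult_self)
    ultimately show "z \<in> (\<lambda>y i. ?\<sigma> (y i)) ` ker V r c A"
      by (intro image_eqI[where x = "\<lambda>i. z i - Var v * t i"]) simp_all
  next
    fix z assume "z \<in> (\<lambda>y i. ?\<sigma> (y i)) ` ker V r c A"
    then show "z \<in> ker (V - {v}) r c A'"
      by (auto simp: ker_def app \<sigma>_free)
  qed
  moreover have "res (V - {v}) m ((\<lambda>y i. ?\<sigma> (y i)) ` ker V r c A) c"
    using A(3) ker_Var_torsion_free by (rule Suc.IH)
  ultimately show ?case
    unfolding res.simps(2) using A' by (intro exI[of _ c] exI[of _ A'] conjI) simp_all
qed

text \<open>If \<open>u\<close> is killed by more variables than the length of the resolution, then \<open>u = 0\<close> in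
  \<open>S^r / K\<close>: dividing the first syzygy module by one of these variables trades that variable for
  one step of the resolution.\<close>
lemma res_annihilated:
  fixes K :: "(nat \<Rightarrow> ('v, 'k::field) mpoly) set"
  assumes "res V m K r" "C \<subseteq> V" "m < card C" "u \<in> freemod V r"
    and "\<And>v. v \<in> C \<Longrightarrow> (\<lambda>i. Var v * u i) \<in> K"
  shows "u \<in> K"
  using assms
proof (induction m arbitrary: V K r C u)
  case 0
  then have "C \<noteq> {}" by auto
  then obtain v where "v \<in> C" by blast
  then have "(\<lambda>i. Var v * u i) \<in> K" by (rule 0(5))
  then have "(\<lambda>i. Var v * u i) = (\<lambda>_. 0)" using 0(1) by simp
  then have "u = (\<lambda>_. 0)" by (simp add: fun_eq_iff Var_mult_eq_0_iff)
  then show ?case using 0(1) by simp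
next
  case (Suc m)
  obtain c A where A: "matrix_over V r c A" "K = img V r c A" "res V m (ker V r c A) c"
    using Suc.prems(1) by auto
  have "C \<noteq> {}" using Suc.prems(3) by auto
  then obtain v where v: "v \<in> C" by blast
  let ?\<sigma> = "filt (\<lambda>n. v \<notin> keys n) :: ('v, 'k) mpoly \<Rightarrow> _"
  have vV: "v \<in> V" using v Suc.prems(2) by blast
  have fin: "finite C" using Suc.prems(3) by (intro card_ge_0_finite) simp
  have "(\<lambda>i. Var v * u i) \<in> img V r c A"
    using Suc.prems(5)[OF v] A(2) by simp
  \<comment> \<open>The specialisation of \<open>y\<close> is the vector to which the induction
    hypothesis is applied.\<close>
  then obtain y where y: "y \<in> freemod V c" "(\<lambda>i. Var v * u i) = matapp r c A y"
    by (auto simp: img_def)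
  have "res (V - {v}) m ((\<lambda>y i. ?\<sigma> (y i)) ` ker V r c A) c"
    using A(3) vV ker_Var_torsion_free by (rule res_specialize)
  moreover have "C - {v} \<subseteq> V - {v}" "m < card (C - {v})"
    using Suc.prems(2,3) v fin by auto
  moreover have "(\<lambda>i. ?\<sigma> (y i)) \<in> freemod (V - {v}) c"
    using y by (auto simp: freemod_def polyring_def keys_filt)
  \<comment> \<open>With x_w u = A t, the vector x_w y - x_v t is a syzygy, because \<open>A\<close>
    sends both products to x_v x_w u; its specialisation is x_w times that of
    \<open>y\<close>.\<close>
  moreover have "(\<lambda>i. Var w * ?\<sigma> (y i)) \<in> (\<lambda>y i. ?\<sigma> (y i)) ` ker V r c A" if w: "w \<in> C - {v}" for w
  proof -
    have "(\<lambda>i. Var w * u i) \<in> img V r c A" using Suc.prems(5)[of w] w A(2) by simp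
    then obtain t where t: "t \<in> freemod V c" "(\<lambda>i. Var w * u i) = matapp r c A t"
      by (auto simp: img_def)
    have "Var w * matapp r c A y i - Var v * matapp r c A t i = 0" for i
      by (simp add: algebra_simps flip: y(2) t(2))
    then have "(\<lambda>i. Var w * y i - Var v * t i) \<in> ker V r c A"
      unfolding ker_def using y t vV w Suc.prems(2)
      by (auto simp: matapp_diff matapp_scale intro!: submod_diff[OF submod_freemod] submod_scale[OF submod_freemod])
    moreover have "?\<sigma> (Var w * y i - Var v * t i) = Var w * ?\<sigma> (y i)" for i
      using w by (simp add: filt_diff filt_Var_mult_self filt_Var_mult_other)
    ultimately show ?thesis
      by (intro image_eqI[where x = "\<lambda>i. Var w * y i - Var v * t i"]) simp_all
  qed
  ultimately have "(\<lambda>i. ?\<sigma> (y i)) \<in> (\<lambda>y i. ?\<sigma> (y i)) ` ker V r c A"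
    by (rule Suc.IH)
  \<comment> \<open>The syzygy \<open>l\<close> agrees with \<open>y\<close> at v = 0, so y - l =
    x_v s. Applying \<open>A\<close> gives x_v u = x_v A s, and x_v cancels.\<close>
  then obtain l where l: "l \<in> ker V r c A" "(\<lambda>i. ?\<sigma> (y i)) = (\<lambda>i. ?\<sigma> (l i))" by auto
  have lfree: "l \<in> freemod V c" using l by (simp add: ker_def)
  have d: "(\<lambda>i. y i - l i) \<in> freemod V c"
    by (rule submod_diff[OF submod_freemod y(1) lfree])
  have "\<exists>q\<in>polyring V. y i - l i = Var v * q" for i
  proof -
    obtain q where "q \<in> polyring V" "y i - l i = ?\<sigma> (y i - l i) + Var v * q"
      using polyring_split_Var[OF freemodD[OF d]] .
    moreover have "?\<sigma> (y i - l i) = 0" using fun_cong[OF l(2), of i] by (simp add: filt_diff)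
    ultimately show ?thesis by (metis add_0)
  qed
  then obtain s where s: "\<And>i. s i \<in> polyring V" "\<And>i. y i - l i = Var v * s i"
    by metis
  have "s i = 0" if "i \<ge> c" for i
    using s(2)[of i] freemod_beyond[OF d that] by (simp add: Var_mult_eq_0_iff)
  then have sfree: "s \<in> freemod V c" using s by (auto simp: freemod_def)
  have "Var v * u i = Var v * matapp r c A s i" for i
  proof -
    have "Var v * matapp r c A s i = matapp r c A (\<lambda>i. y i - l i) i"
      by (simp add: s(2) matapp_scale)
    also have "\<dots> = Var v * u i"
      using l(1) fun_cong[OF y(2), of i] by (simp add: matapp_diff ker_def)
    finally show ?thesis by simp
  qed
  then have "u = matapp r c A s"
    by (intro ext) (rule Var_mult_cancel)
  then show ?case using sfree A(2) by (auto simp: img_def)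
qed

text \<open>A lift of \<open>p\<close> to the free module turns annihilation modulo \<open>J\<close>
  into annihilation modulo the relations.\<close>

lemma resolvable_lower_bound:
  fixes J :: "('v, 'k::field) mpoly set"
  assumes J: "is_ideal V J" and "resolvable V J m" "C \<subseteq> V" "p \<in> polyring V" "p \<notin> J"
    and "\<And>v. v \<in> C \<Longrightarrow> Var v * p \<in> J"
  shows "card C \<le> m"
proof (rule ccontr)
  assume "\<not> card C \<le> m"
  obtain r g where g: "\<forall>j<r. g j \<in> polyring V"
      "\<forall>p\<in>polyring V. \<exists>u\<in>freemod V r. (\<Sum>j<r. u j * g j) - p \<in> J"
      "res V m {u\<in>freemod V r. (\<Sum>j<r. u j * g j) \<in> J} r"
    using resolvableE[OF assms(2)] .
  obtain u where u: "u \<in> freemod V r" "(\<Sum>j<r. u j * g j) - p \<in> J"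
    using g(2) assms by blast
  have "(\<lambda>i. Var v * u i) \<in> {u\<in>freemod V r. (\<Sum>j<r. u j * g j) \<in> J}" if "v \<in> C" for v
  proof -
    have vV: "Var v \<in> polyring V" using that assms by auto
    have "Var v * ((\<Sum>j<r. u j * g j) - p) + Var v * p \<in> J"
      by (rule ideal_add[OF J ideal_mult[OF J vV u(2)] assms(6)[OF that]])
    then have "(\<Sum>j<r. (Var v * u j) * g j) \<in> J"
      by (simp add: algebra_simps sum_distrib_left)
    then show ?thesis using submod_scale[OF submod_freemod vV u(1)] by simp
  qed
  with res_annihilated[OF g(3) assms(3) _ u(1)] \<open>\<not> card C \<le> m\<close>
  have "(\<Sum>j<r. u j * g j) \<in> J" by simp
  then have "(\<Sum>j<r. u j * g j) - ((\<Sum>j<r. u j * g j) - p) \<in> J"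
    using u(2) by (rule ideal_diff[OF J])
  then show False using assms by simp
qed

section \<open>A universal regular sequence\<close>

text \<open>The nonzerodivisor conditions of \<open>regular_seq\<close>, which are what an exact
  sequence transports. Properness and membership in the maximal ideal are checked in
  \<open>regular_seq_esym\<close>.\<close>

definition reg :: "'v set \<Rightarrow> ('v, 'k::field) mpoly set \<Rightarrow> (nat \<Rightarrow> ('v, 'k) mpoly) \<Rightarrow> nat \<Rightarrow> bool" where
  "reg V J a t \<longleftrightarrow> (\<forall>i<t. \<forall>b\<in>polyring V. a i * b \<in> ideal_plus V J a i \<longrightarrow> b \<in> ideal_plus V J a i)"

lemma regD:
  "reg V J a t \<Longrightarrow> i < t \<Longrightarrow> b \<in> polyring V \<Longrightarrow> a i * b \<in> ideal_plus V J a i \<Longrightarrow> b \<in> ideal_plus V J a i"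
  by (simp add: reg_def)

lemma adjoinE:
  assumes "p \<in> adjoin V J x"
  obtains q r where "p = q + r * x" "q \<in> J" "r \<in> polyring V"
  using assms unfolding adjoin_def by blast

lemma ideal_plusI:
  "q \<in> J \<Longrightarrow> (\<And>j. j < t \<Longrightarrow> c j \<in> polyring V) \<Longrightarrow> q + (\<Sum>j<t. c j * a j) \<in> ideal_plus V J a t"
  unfolding ideal_plus_def by blast

lemma ideal_plusE:
  assumes "p \<in> ideal_plus V J a t"
  obtains q c where "p = q + (\<Sum>j<t. c j * a j)" "q \<in> J" "\<forall>j<t. c j \<in> polyring V"
  using assms unfolding ideal_plus_def by blast

lemma ideal_plus_adjoin:
  "ideal_plus V (adjoin V J x) a t = adjoin V (ideal_plus V J a t) x"
proof (intro equalityI subsetI)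
  fix p assume "p \<in> ideal_plus V (adjoin V J x) a t"
  then obtain q' c where *: "p = q' + (\<Sum>j<t. c j * a j)" "q' \<in> adjoin V J x" "\<forall>j<t. c j \<in> polyring V"
    by (rule ideal_plusE)
  from *(2) obtain q r where q: "q' = q + r * x" "q \<in> J" "r \<in> polyring V"
    by (rule adjoinE)
  have "(q + (\<Sum>j<t. c j * a j)) + r * x \<in> adjoin V (ideal_plus V J a t) x"
    using q *(3) by (intro adjoinI ideal_plusI) auto
  then show "p \<in> adjoin V (ideal_plus V J a t) x"
    unfolding *(1) q(1) by (simp add: algebra_simps)
next
  fix p assume "p \<in> adjoin V (ideal_plus V J a t) x"
  then obtain q' r where q: "p = q' + r * x" "q' \<in> ideal_plus V J a t" "r \<in> polyring V"
    by (rule adjoinE)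
  from q(2) obtain q c where *: "q' = q + (\<Sum>j<t. c j * a j)" "q \<in> J" "\<forall>j<t. c j \<in> polyring V"
    by (rule ideal_plusE)
  have "(q + r * x) + (\<Sum>j<t. c j * a j) \<in> ideal_plus V (adjoin V J x) a t"
    using q(3) *(2,3) by (intro adjoinI ideal_plusI) auto
  then show "p \<in> ideal_plus V (adjoin V J x) a t"
    unfolding *(1) q(1) by (simp add: algebra_simps)
qed

lemma mult_ideal_plus_colon:
  assumes "p \<in> ideal_plus V (colon V J x) a t" "x \<in> polyring V"
  shows "x * p \<in> ideal_plus V J a t"
proof -
  from assms(1) obtain q c where *: "p = q + (\<Sum>j<t. c j * a j)" "q \<in> colon V J x" "\<forall>j<t. c j \<in> polyring V"
    by (rule ideal_plusE)
  have "x * q + (\<Sum>j<t. (x * c j) * a j) \<in> ideal_plus V J a t"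
    using *(2,3) assms(2) by (intro ideal_plusI) (auto simp: colon_def)
  then show ?thesis
    unfolding *(1) by (simp add: algebra_simps sum_distrib_left)
qed

lemma ideal_plus_adjoin_reg:
  assumes "reg V (adjoin V J x) a t" "i < t" "s \<in> polyring V"
    and "a i * s \<in> adjoin V (ideal_plus V J a i) x"
  shows "s \<in> adjoin V (ideal_plus V J a i) x"
  using regD[OF assms(1-3)] assms(4) unfolding ideal_plus_adjoin by blast

text \<open>The embedding of S/(J : x) into S/J stays injective modulo a sequence that is regular on
  the cokernel S/(J, x). If x p = q + s a_i, regularity on the cokernel gives s = q' + s' x, and p -
  s' a_i is handled by the previous ideal.\<close>

lemma ideal_plus_colon_reg:
  fixes J :: "('v, 'k::field) mpoly set"
  assumes J: "is_ideal V J" and a: "\<And>i. a i \<in> polyring V" and rA: "reg V (adjoin V J x) a t"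
    and "i \<le> t" "p \<in> polyring V" "x * p \<in> ideal_plus V J a i"
  shows "p \<in> ideal_plus V (colon V J x) a i"
  using assms(4-)
proof (induction i arbitrary: p)
  case 0
  then show ?case by (simp add: colon_def)
next
  case (Suc i)
  have I: "is_ideal V (ideal_plus V J a i)"
    using J a by (rule is_ideal_plus)
  from Suc.prems(3) obtain q s where qs: "x * p = q + s * a i" "q \<in> ideal_plus V J a i" "s \<in> polyring V"
    unfolding ideal_plus_Suc by (rule adjoinE)
  have "(- q) + p * x \<in> adjoin V (ideal_plus V J a i) x"
    using qs Suc.prems(2) by (intro adjoinI ideal_uminus[OF I])
  then have "a i * s \<in> adjoin V (ideal_plus V J a i) x"
    using qs(1) by (simp add: algebra_simps)
  then have "s \<in> adjoin V (ideal_plus V J a i) x"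
    using ideal_plus_adjoin_reg[OF rA, of i s] Suc.prems(1) qs(3) by simp
  then obtain q' s' where q': "s = q' + s' * x" "q' \<in> ideal_plus V J a i" "s' \<in> polyring V"
    by (rule adjoinE)
  have "x * (p - s' * a i) = q + q' * a i"
    using qs(1) q'(1) by (simp add: algebra_simps)
  also have "\<dots> \<in> ideal_plus V J a i"
    by (rule ideal_add[OF I qs(2) ideal_mult_right[OF I a q'(2)]])
  finally have "p - s' * a i \<in> ideal_plus V (colon V J x) a i"
    using Suc.prems(1,2) q'(3) a by (intro Suc.IH) auto
  then have "(p - s' * a i) + s' * a i \<in> ideal_plus V (colon V J x) a (Suc i)"
    unfolding ideal_plus_Suc using q'(3) by (rule adjoinI)
  then show ?case by simp
qed

text \<open>Regularity on S/(J, x) reduces \<open>b\<close> to a multiple c x. Injectivity from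
  \<open>ideal_plus_colon_reg\<close> carries the condition on c x over to \<open>c\<close> in S/(J
  : x), where regularity of the other end applies.\<close>

lemma reg_split:
  fixes J :: "('v, 'k::field) mpoly set"
  assumes J: "is_ideal V J" and x: "x \<in> polyring V" and a: "\<And>i. a i \<in> polyring V"
    and rC: "reg V (colon V J x) a t" and rA: "reg V (adjoin V J x) a t"
  shows "reg V J a t"
proof -
  have I: "is_ideal V (ideal_plus V J a i)" for i
    using J a by (rule is_ideal_plus)
  show ?thesis
    unfolding reg_def
  proof (intro allI impI ballI)
    fix i b assume i: "i < t" and b: "b \<in> polyring V" and ab: "a i * b \<in> ideal_plus V J a i"
    have "b \<in> adjoin V (ideal_plus V J a i) x"
      using ideal_plus_adjoin_reg[OF rA i b] ab adjoin_superset[of "ideal_plus V J a i" V x] by blast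
    then obtain q c where qc: "b = q + c * x" "q \<in> ideal_plus V J a i" "c \<in> polyring V"
      by (rule adjoinE)
    have "x * (a i * c) = a i * b - a i * q"
      unfolding qc(1) by (simp add: algebra_simps)
    also have "\<dots> \<in> ideal_plus V J a i"
      by (rule ideal_diff[OF I ab ideal_mult[OF I a qc(2)]])
    finally have "a i * c \<in> ideal_plus V (colon V J x) a i"
      using i a qc(3) by (intro ideal_plus_colon_reg[OF J a rA]) auto
    then have "c \<in> ideal_plus V (colon V J x) a i"
      using regD[OF rC i qc(3)] by blast
    then have "x * c \<in> ideal_plus V J a i"
      using x by (rule mult_ideal_plus_colon)
    with qc(2) have "q + x * c \<in> ideal_plus V J a i"
      by (rule ideal_add[OF I])
    then show "b \<in> ideal_plus V J a i"
      unfolding qc(1) by (simp add: mult.commute)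
  qed
qed

section \<open>Graded ideals and permuting regular sequences\<close>

definition homogeneous :: "nat \<Rightarrow> ('v, 'k::field) mpoly \<Rightarrow> bool" where
  "homogeneous d p \<longleftrightarrow> (\<forall>m\<in>keys p. mdeg m = d)"

definition trunc :: "nat \<Rightarrow> ('v, 'k::field) mpoly \<Rightarrow> ('v, 'k) mpoly" where
  "trunc k = filt (\<lambda>m. mdeg m < k)"

text \<open>For an ideal this is gradedness: homogeneous components are differences of consecutive
  truncations.\<close>

definition trunc_closed :: "('v, 'k::field) mpoly set \<Rightarrow> bool" where
  "trunc_closed J \<longleftrightarrow> (\<forall>k. \<forall>p\<in>J. trunc k p \<in> J)"

lemma trunc_closedD: "trunc_closed J \<Longrightarrow> p \<in> J \<Longrightarrow> trunc k p \<in> J"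
  by (simp add: trunc_closed_def)

lemma trunc_closed_sqf: "trunc_closed (sqf V F)"
  by (simp add: trunc_closed_def trunc_def sqf_filt)

lemma trunc_polyring: "p \<in> polyring V \<Longrightarrow> trunc k p \<in> polyring V"
  unfolding trunc_def by (rule filt_polyring)

lemma trunc_add: "trunc k (p + q) = trunc k p + trunc k q"
  by (simp add: trunc_def filt_add)

text \<open>Truncated subtraction gives the right value also for k at most d, where both sides
  vanish.\<close>

lemma trunc_mult_homogeneous:
  assumes "homogeneous d e"
  shows "trunc k (c * e) = trunc (k - d) c * e"
proof -
  have "filt (\<lambda>m. mdeg m < k) (c * e) = filt (\<lambda>m. mdeg m < k - d) c * filt (\<lambda>_. True) e"
    using assms by (intro filt_mult_gen) (auto simp: mdeg_add homogeneous_def)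
  then show ?thesis by (simp add: trunc_def filt_eq)
qed

lemma trunc_closed_adjoin:
  assumes "trunc_closed J" "homogeneous d e"
  shows "trunc_closed (adjoin V J e)"
  unfolding trunc_closed_def
proof (intro allI ballI)
  fix k p assume "p \<in> adjoin V J e"
  then obtain q r where qr: "p = q + r * e" "q \<in> J" "r \<in> polyring V" by (rule adjoinE)
  have "trunc k q + trunc (k - d) r * e \<in> adjoin V J e"
    using qr by (intro adjoinI trunc_closedD[OF assms(1)] trunc_polyring)
  then show "trunc k p \<in> adjoin V J e"
    unfolding qr(1) trunc_add trunc_mult_homogeneous[OF assms(2)] .
qed

lemma trunc_closed_ideal_plus:
  assumes "trunc_closed J" "\<And>i. \<exists>d. homogeneous d (a i)"
  shows "trunc_closed (ideal_plus V J a t)"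
proof (induction t)
  case (Suc t)
  from assms(2) obtain d where "homogeneous d (a t)" by blast
  with Suc show ?case unfolding ideal_plus_Suc by (rule trunc_closed_adjoin)
qed (simp add: assms(1))

lemma trunc_eq_large: "\<exists>k0. \<forall>k\<ge>k0. trunc k p = p" for p :: "('v, 'k::field) mpoly"
proof (intro exI allI impI)
  fix k assume k: "k \<ge> Suc (Max (mdeg ` keys p))"
  have "mdeg m < k" if "m \<in> keys p" for m
  proof -
    have "mdeg m \<le> Max (mdeg ` keys p)" using that by simp
    with k show ?thesis by simp
  qed
  then show "trunc k p = p" unfolding trunc_def by (rule filt_eq)
qed

lemma Var_power: "Var v ^ k = (single (single v k) 1 :: ('v, 'k::field) mpoly)"
  by (induction k) (simp_all add: Var_def mult_single flip: single_add)

lemma trunc_mult_Var_power: "trunc k (c * Var v ^ k) = (0 :: ('v, 'k::field) mpoly)"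
proof -
  have "homogeneous k (Var v ^ k :: ('v, 'k) mpoly)" by (simp add: Var_power homogeneous_def)
  then show ?thesis
    by (simp add: trunc_mult_homogeneous) (simp add: trunc_def filt_def)
qed

text \<open>Graded modules satisfy \<open>\<Inter>\<^sub>k x^k M = 0\<close>, so regular sequences containing \<open>x\<close> may be permuted.\<close>
lemma separated:
  fixes J :: "('v, 'k::field) mpoly set"
  assumes J: "is_ideal V J" and "trunc_closed J" and v: "v \<in> V"
    and "b \<in> B" and B: "\<And>b. b \<in> B \<Longrightarrow> \<exists>q\<in>J. \<exists>c\<in>B. b = q + c * Var v"
  shows "b \<in> J"
proof -
  have "\<exists>q\<in>J. \<exists>c\<in>B. b = q + c * Var v ^ k" for k
  proof (induction k)
    case 0
    show ?case using assms(4) ideal_zero[OF J] by (intro bexI[of _ 0] bexI[of _ b]) simp_all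
  next
    case (Suc k)
    then obtain q c where qc: "q \<in> J" "c \<in> B" "b = q + c * Var v ^ k" by blast
    from B[OF qc(2)] obtain q' c' where q': "q' \<in> J" "c' \<in> B" "c = q' + c' * Var v" by blast
    have "q + q' * Var v ^ k \<in> J"
      using qc(1) q'(1) v by (intro ideal_add[OF J] ideal_mult_right[OF J]) auto
    moreover have "b = (q + q' * Var v ^ k) + c' * Var v ^ Suc k"
      unfolding qc(3) q'(3) by (simp add: algebra_simps)
    ultimately show ?case using q'(2) by blast
  qed
  \<comment> \<open>For k above the degree of \<open>b\<close>, truncation fixes \<open>b\<close>
    and kills the multiple of x_v^k, so \<open>b\<close> is the truncation of an element of
    \<open>J\<close>.\<close>
  moreover obtain k where k: "trunc k b = b" using trunc_eq_large by blast
  ultimately obtain q c where "q \<in> J" "b = q + c * Var v ^ k" by blast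
  then have "trunc k b \<in> J"
    using trunc_closedD[OF assms(2), of q k] by (simp add: trunc_add trunc_mult_Var_power)
  then show ?thesis using k by simp
qed

text \<open>The hypotheses make x_v, a_0, ..., a_(t-1) regular on S/J; the two conclusions say that
  x_v may be moved to the end.\<close>

lemma reg_lift:
  fixes J :: "('v, 'k::field) mpoly set"
  assumes J: "is_ideal V J" and tc: "trunc_closed J" and v: "v \<in> V"
    and nzd: "\<And>p. p \<in> polyring V \<Longrightarrow> Var v * p \<in> J \<Longrightarrow> p \<in> J"
    and a: "\<And>i. a i \<in> polyring V" and hom: "\<And>i. \<exists>d. homogeneous d (a i)"
    and rA: "reg V (adjoin V J (Var v)) a t"
  shows "reg V J a t"
    and "\<And>p. p \<in> polyring V \<Longrightarrow> Var v * p \<in> ideal_plus V J a t \<Longrightarrow> p \<in> ideal_plus V J a t"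
proof -
  let ?x = "Var v :: ('v, 'k) mpoly"
  have I: "is_ideal V (ideal_plus V J a i)" for i
    using J a by (rule is_ideal_plus)
  have "colon V J ?x = J"
    using nzd v ideal_subset[OF J] ideal_mult[OF J polyring_Var[OF v]] unfolding colon_def by blast
  then have nzd': "p \<in> ideal_plus V J a i"
    if "i \<le> t" "p \<in> polyring V" "?x * p \<in> ideal_plus V J a i" for i p
    using ideal_plus_colon_reg[OF J a rA that] by simp
  then show "\<And>p. p \<in> polyring V \<Longrightarrow> Var v * p \<in> ideal_plus V J a t \<Longrightarrow> p \<in> ideal_plus V J a t"
    by blast
  show "reg V J a t"
    unfolding reg_def
  proof (intro allI impI ballI)
    fix i b assume i: "i < t" and b: "b \<in> polyring V" "a i * b \<in> ideal_plus V J a i"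
    \<comment> \<open>Each element of \<open>B\<close> is, modulo the current ideal, x_v times
      another element of \<open>B\<close>. Being infinitely divisible by x_v, it is zero
      there.\<close>
    define B where "B = {b\<in>polyring V. a i * b \<in> ideal_plus V J a i}"
    have tc': "trunc_closed (ideal_plus V J a i)"
      using tc hom by (rule trunc_closed_ideal_plus)
    have bB: "b \<in> B" using b by (simp add: B_def)
    have step: "\<exists>q\<in>ideal_plus V J a i. \<exists>c\<in>B. b = q + c * ?x" if "b \<in> B" for b
    proof -
      have b: "b \<in> polyring V" "a i * b \<in> ideal_plus V J a i" using that by (simp_all add: B_def)
      have "b \<in> adjoin V (ideal_plus V J a i) ?x"
        using ideal_plus_adjoin_reg[OF rA i b(1)] b(2) adjoin_superset[of "ideal_plus V J a i" V ?x] by blast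
      then obtain q c where qc: "b = q + c * ?x" "q \<in> ideal_plus V J a i" "c \<in> polyring V"
        by (rule adjoinE)
      have "?x * (a i * c) = a i * b - a i * q"
        unfolding qc(1) by (simp add: algebra_simps)
      also have "\<dots> \<in> ideal_plus V J a i"
        by (rule ideal_diff[OF I b(2) ideal_mult[OF I a qc(2)]])
      finally have m: "?x * (a i * c) \<in> ideal_plus V J a i" .
      have "a i * c \<in> ideal_plus V J a i"
        by (rule nzd'[OF _ _ m]) (use i a qc(3) in auto)
      then have "c \<in> B" using qc(3) by (simp add: B_def)
      then show ?thesis using qc by blast
    qed
    show "b \<in> ideal_plus V J a i"
      by (rule separated[OF I tc' v bB step])
  qed
qed

section \<open>Elementary symmetric polynomials\<close>

definition esym :: "'v set \<Rightarrow> nat \<Rightarrow> ('v, 'k::field) mpoly" where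
  "esym V k = (\<Sum>X | X \<subseteq> V \<and> card X = k. \<Prod>v\<in>X. Var v)"

lemma esym_polyring: "esym V k \<in> polyring V"
  unfolding esym_def by (intro polyring_sum polyring_prod polyring_Var) auto

lemma homogeneous_sum: "(\<And>i. i \<in> A \<Longrightarrow> homogeneous d (f i)) \<Longrightarrow> homogeneous d (sum f A)"
  unfolding homogeneous_def
proof (induction A rule: infinite_finite_induct)
  case (insert x A)
  then show ?case using keys_add[of "f x" "sum f A"] by auto
qed auto

lemma homogeneous_esym:
  assumes "finite V"
  shows "homogeneous k (esym V k)"
  unfolding esym_def
proof (rule homogeneous_sum)
  fix X assume "X \<in> {X. X \<subseteq> V \<and> card X = k}"
  then have X: "finite X" "card X = k" using assms finite_subset by auto
  have "mdeg (\<Sum>v\<in>X. single v (Suc 0)) = card X"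
    using X(1) by (induction X rule: finite_induct) (simp_all add: mdeg_add, simp add: mdeg_def)
  then show "homogeneous k (\<Prod>v\<in>X. Var v)"
    using X by (simp add: prod_Var homogeneous_def)
qed

text \<open>Among the subsets of \<open>V\<close> of this size only \<open>V - W\<close> avoids
  \<open>W\<close>.\<close>

lemma esym_mod_singletons:
  assumes "finite V" "W \<subseteq> V"
  shows "esym V (card (V - W)) - (\<Prod>v\<in>V - W. Var v) \<in> (sqf V (singletons W) :: ('v, 'k::field) mpoly set)"
proof -
  let ?S = "{X. X \<subseteq> V \<and> card X = card (V - W)}"
  have fin: "finite ?S" using assms by simp
  have "esym V (card (V - W)) = (\<Prod>v\<in>V - W. Var v) + (\<Sum>X\<in>?S - {V - W}. \<Prod>v\<in>X. Var v :: ('v, 'k) mpoly)"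
    unfolding esym_def using fin by (intro sum.remove) auto
  moreover have "(\<Sum>X\<in>?S - {V - W}. \<Prod>v\<in>X. Var v) \<in> (sqf V (singletons W) :: ('v, 'k) mpoly set)"
  proof (rule ideal_sum[OF is_ideal_sqf])
    fix X assume X: "X \<in> ?S - {V - W}"
    then have fX: "finite X" using assms finite_subset by auto
    have "\<not> X \<subseteq> V - W"
      using X card_subset_eq[of "V - W" X] assms by auto
    then obtain w where "w \<in> X" "w \<in> W" using X by auto
    then show "(\<Prod>v\<in>X. Var v) \<in> (sqf V (singletons W) :: ('v, 'k) mpoly set)"
      using X fX by (simp add: prod_Var single_in_sqf keys_sum_single) blast
  qed
  ultimately show ?thesis by simp
qed

lemma nonzerodivisor_prod:
  assumes "finite X" "X \<subseteq> V"
    and "\<And>v p. v \<in> X \<Longrightarrow> p \<in> polyring V \<Longrightarrow> Var v * p \<in> I \<Longrightarrow> p \<in> I"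
    and "p \<in> polyring V" "(\<Prod>v\<in>X. Var v) * p \<in> I"
  shows "p \<in> I"
  using assms
proof (induction X arbitrary: p rule: finite_induct)
  case (insert v X)
  have "Var v * ((\<Prod>v\<in>X. Var v) * p) \<in> I"
    using insert.prems(4) insert.hyps by (simp add: mult.assoc)
  moreover have "(\<Prod>v\<in>X. Var v) * p \<in> polyring V"
    using insert.prems(1,3) by (intro polyring_mult polyring_prod polyring_Var) auto
  ultimately have m: "(\<Prod>v\<in>X. Var v) * p \<in> I"
    using insert.prems(2)[of v "(\<Prod>v\<in>X. Var v) * p"] by simp
  have X: "X \<subseteq> V" using insert.prems(1) by simp
  show ?case
    by (rule insert.IH[OF X _ insert.prems(3) m]) (rule insert.prems(2), simp_all)
qed simp

lemma adjoin_singletons: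
  "v \<in> V \<Longrightarrow> adjoin V (sqf V (singletons W)) (Var v) = sqf V (singletons (insert v W))"
  by (simp add: adjoin_sqf)

lemma reg_mono: "reg V J a t \<Longrightarrow> s \<le> t \<Longrightarrow> reg V J a s"
  by (simp add: reg_def)

text \<open>Let n + 1 variables lie outside \<open>W\<close>. For each such v the first n
  polynomials are regular modulo \<open>W\<close> and v by induction, so by \<open>reg_lift\<close>
  they are regular modulo \<open>W\<close> and v is a nonzerodivisor after them. The polynomial of
  degree n + 1 is, modulo \<open>W\<close>, the product of these nonzerodivisors.\<close>

lemma reg_esym:
  assumes "finite V" "W \<subseteq> V" "t \<le> card (V - W)"
  shows "reg V (sqf V (singletons W) :: ('v, 'k::field) mpoly set) (\<lambda>i. esym V (Suc i)) t"
  using assms(2,3)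
proof (induction "card (V - W)" arbitrary: W t)
  case 0
  then show ?case by (simp add: reg_def)
next
  case (Suc n)
  let ?J = "sqf V (singletons W) :: ('v, 'k) mpoly set"
  let ?a = "\<lambda>i. esym V (Suc i) :: ('v, 'k) mpoly"
  have a: "\<And>i. ?a i \<in> polyring V" by (rule esym_polyring)
  have hom: "\<And>i. \<exists>d. homogeneous d (?a i)" using homogeneous_esym[OF assms(1)] by blast
  have lift: "reg V ?J ?a n" "\<And>p. p \<in> polyring V \<Longrightarrow> Var v * p \<in> ideal_plus V ?J ?a n \<Longrightarrow> p \<in> ideal_plus V ?J ?a n"
    if v: "v \<in> V - W" for v
  proof -
    have "V - insert v W = (V - W) - {v}" by auto
    then have n: "n = card (V - insert v W)"
      using v Suc.hyps(2) assms(1) by simp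
    have "reg V (sqf V (singletons (insert v W))) ?a n"
      using v Suc.prems(1) n by (intro Suc.hyps(1)) auto
    then have r: "reg V (adjoin V ?J (Var v)) ?a n"
      using v by (simp add: adjoin_singletons)
    have vV: "v \<in> V" using v by simp
    have nzd: "\<And>p. p \<in> polyring V \<Longrightarrow> Var v * p \<in> ?J \<Longrightarrow> p \<in> ?J"
      by (rule sqf_Var_nonzerodivisor[OF vV]) (use v in auto)
    show "reg V ?J ?a n"
      by (rule reg_lift(1)[OF is_ideal_sqf trunc_closed_sqf vV nzd a hom r])
    show "\<And>p. p \<in> polyring V \<Longrightarrow> Var v * p \<in> ideal_plus V ?J ?a n \<Longrightarrow> p \<in> ideal_plus V ?J ?a n"
      by (rule reg_lift(2)[OF is_ideal_sqf trunc_closed_sqf vV nzd a hom r])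
  qed
  have "V - W \<noteq> {}" using Suc.hyps(2) by (metis card.empty nat.distinct(1))
  then have regn: "reg V ?J ?a n" using lift(1) by blast
  have I: "is_ideal V (ideal_plus V ?J ?a n)"
    using is_ideal_sqf a by (rule is_ideal_plus)
  have last: "b \<in> ideal_plus V ?J ?a n"
    if b: "b \<in> polyring V" "?a n * b \<in> ideal_plus V ?J ?a n" for b
  proof -
    have "?a n - (\<Prod>v\<in>V - W. Var v) \<in> ideal_plus V ?J ?a n"
      using esym_mod_singletons[OF assms(1) Suc.prems(1)] ideal_plus_superset[of ?J V ?a n]
      unfolding Suc.hyps(2)[symmetric] by blast
    from ideal_diff[OF I b(2) ideal_mult_right[OF I b(1) this]]
    have "?a n * b - (?a n - (\<Prod>v\<in>V - W. Var v)) * b \<in> ideal_plus V ?J ?a n" .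
    then have m: "(\<Prod>v\<in>V - W. Var v) * b \<in> ideal_plus V ?J ?a n"
      by (simp add: algebra_simps)
    show ?thesis
      by (rule nonzerodivisor_prod[OF _ _ lift(2) b(1) m]) (use assms(1) in auto)
  qed
  have "reg V ?J ?a (Suc n)"
    using regn last unfolding reg_def by (simp add: less_Suc_eq)
  then show ?case by (rule reg_mono) (use Suc.prems(2) Suc.hyps(2) in simp)
qed

text \<open>The shift by \<open>Suc\<close> omits e_0 = 1. All polynomials and generators then have
  zero constant term, so the final ideal is proper.\<close>

lemma regular_seq_esym:
  assumes "finite V" "{} \<notin> F"
    and "reg V (sqf V F :: ('v, 'k::field) mpoly set) (\<lambda>i. esym V (Suc i)) t"
  shows "regular_seq V (sqf V F :: ('v, 'k::field) mpoly set) (\<lambda>i. esym V (Suc i)) t"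
proof -
  have max: "esym V (Suc i) \<in> (max_ideal V :: ('v, 'k) mpoly set)" for i
  proof -
    have "0 \<notin> keys (esym V (Suc i) :: ('v, 'k) mpoly)"
      using homogeneous_esym[OF assms(1), of "Suc i"] unfolding homogeneous_def by (force simp: mdeg_def)
    then show ?thesis by (simp add: max_ideal_def esym_polyring in_keys_iff)
  qed
  have sub: "sqf V F \<subseteq> (max_ideal V :: ('v, 'k) mpoly set)"
  proof
    fix p :: "('v, 'k) mpoly" assume p: "p \<in> sqf V F"
    have "0 \<notin> keys p" using sqfD(2)[OF p, of 0] assms(2) by auto
    then show "p \<in> max_ideal V" using sqfD(1)[OF p] by (simp add: max_ideal_def in_keys_iff)
  qed
  have "ideal_plus V (sqf V F) (\<lambda>i. esym V (Suc i)) t \<subseteq> (max_ideal V :: ('v, 'k) mpoly set)"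
    by (rule ideal_plus_subset[OF is_ideal_max_ideal sub max])
  moreover have "(1 :: ('v, 'k) mpoly) \<notin> max_ideal V" by (simp add: max_ideal_def)
  ultimately have "ideal_plus V (sqf V F) (\<lambda>i. esym V (Suc i)) t \<noteq> (polyring V :: ('v, 'k) mpoly set)"
    using polyring_one by blast
  then show ?thesis
    using max assms(3) by (simp add: regular_seq_def reg_def)
qed

section \<open>Koszul homology and the depth\<close>

text \<open>Exchanging the indices only shows that the sum is its own negative, which is no
  information in characteristic 2. The induction cancels the terms in pairs.\<close>

lemma antisymmetric_sum_zero:
  fixes g :: "'a \<Rightarrow> 'a \<Rightarrow> 'b::ab_group_add"
  assumes "finite A" "\<And>v w. v \<in> A \<Longrightarrow> w \<in> A \<Longrightarrow> v \<noteq> w \<Longrightarrow> g v w = - g w v"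
  shows "(\<Sum>v\<in>A. \<Sum>w\<in>A - {v}. g v w) = 0"
  using assms
proof (induction A rule: finite_induct)
  case (insert a A)
  have "(\<Sum>w\<in>insert a A - {v}. g v w) = g v a + (\<Sum>w\<in>A - {v}. g v w)" if "v \<in> A" for v
  proof -
    have "insert a A - {v} = insert a (A - {v})" using that insert.hyps by auto
    then show ?thesis using insert.hyps by simp
  qed
  then have "(\<Sum>v\<in>A. \<Sum>w\<in>insert a A - {v}. g v w) = (\<Sum>v\<in>A. g v a) + (\<Sum>v\<in>A. \<Sum>w\<in>A - {v}. g v w)"
    by (simp add: sum.distrib)
  moreover have "(\<Sum>v\<in>A. \<Sum>w\<in>A - {v}. g v w) = 0"
    by (rule insert.IH) (rule insert.prems, simp_all)
  moreover have "(\<Sum>w\<in>A. g a w) = (\<Sum>w\<in>A. - g w a)"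
  proof (rule sum.cong[OF refl])
    fix w assume "w \<in> A"
    then show "g a w = - g w a" using insert.hyps by (intro insert.prems) auto
  qed
  moreover have "insert a A - {a} = A" using insert.hyps by auto
  ultimately show ?case using insert.hyps by (simp add: sum_negf)
qed simp

text \<open>A function on sets lists coefficients of the basis e_T of an exterior algebra, and
  \<open>sg v T\<close> is the sign in e_v e_T = sg e_(T + v). Then \<open>sg_anti\<close> is
  anticommutativity of e_v and e_w, applied to e_T.\<close>

locale koszul =
  fixes V :: "'v set" and sg :: "'v \<Rightarrow> 'v set \<Rightarrow> ('v, 'k::field) mpoly"
  assumes finite_V: "finite V"
    and sg_unit: "sg v T = 1 \<or> sg v T = - 1"
    and sg_anti: "v \<in> V \<Longrightarrow> w \<in> V \<Longrightarrow> T \<subseteq> V \<Longrightarrow> v \<noteq> w \<Longrightarrow> v \<notin> T \<Longrightarrow> w \<notin> T \<Longrightarrow>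
      sg v T * sg w (insert v T) = - (sg w T * sg v (insert w T))"
begin

lemma sg_square [simp]: "sg v T * sg v T = 1"
  using sg_unit[of v T] by auto

lemma sg_cancel [simp]: "sg v T * (sg v T * p) = p"
  by (simp flip: mult.assoc)

lemma sg_polyring: "sg v T \<in> polyring U"
  using sg_unit[of v T] polyring_uminus[OF polyring_one, of U] by auto

lemma sg_homogeneous: "homogeneous 0 (sg v T)"
  using sg_unit[of v T] by (auto simp: homogeneous_def keys_uminus_eq mdeg_def)

text \<open>The Koszul differential in terms of coefficients: e_T receives a contribution from each
  e_U with U = T + v.\<close>

definition bd :: "'v set \<Rightarrow> ('v set \<Rightarrow> ('v, 'k) mpoly) \<Rightarrow> 'v set \<Rightarrow> ('v, 'k) mpoly" where
  "bd X f T = (\<Sum>v\<in>X - T. sg v T * (Var v * f (insert v T)))"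

definition chain :: "'v set \<Rightarrow> nat \<Rightarrow> ('v set \<Rightarrow> ('v, 'k) mpoly) \<Rightarrow> bool" where
  "chain X j f \<longleftrightarrow> (\<forall>T. f T \<in> polyring V \<and> (f T \<noteq> 0 \<longrightarrow> T \<subseteq> X \<and> card T = j))"

text \<open>\<open>vanish J X j\<close>: the \<open>j\<close>-th Koszul homology of \<open>S/J\<close> with respect to the variables in \<open>X\<close> is zero.\<close>
definition vanish :: "('v, 'k) mpoly set \<Rightarrow> 'v set \<Rightarrow> nat \<Rightarrow> bool" where
  "vanish J X j \<longleftrightarrow> (\<forall>f. chain X j f \<longrightarrow> (\<forall>T\<subseteq>V. bd X f T \<in> J) \<longrightarrow>
     (\<exists>w. chain X (Suc j) w \<and> (\<forall>T\<subseteq>V. f T - bd X w T \<in> J)))"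

lemma chainD1: "chain X j f \<Longrightarrow> f T \<in> polyring V"
  by (simp add: chain_def)

lemma chainD2: "chain X j f \<Longrightarrow> \<not> (T \<subseteq> X \<and> card T = j) \<Longrightarrow> f T = 0"
  unfolding chain_def by metis

lemma chainD3: "chain X j f \<Longrightarrow> f T \<noteq> 0 \<Longrightarrow> T \<subseteq> X \<and> card T = j"
  by (simp add: chain_def)

lemma chainI:
  "(\<And>T. f T \<in> polyring V) \<Longrightarrow> (\<And>T. f T \<noteq> 0 \<Longrightarrow> T \<subseteq> X \<and> card T = j) \<Longrightarrow> chain X j f"
  unfolding chain_def by metis

lemma bd_add: "bd X (\<lambda>T. f T + g T) T = bd X f T + bd X g T"
  by (simp add: bd_def sum.distrib algebra_simps)

lemma bd_scale: "bd X (\<lambda>T. c * f T) T = c * bd X f T"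
  by (simp add: bd_def sum_distrib_left algebra_simps)

lemma bd_sum: "bd X (\<lambda>T. \<Sum>v\<in>A. f v T) T = (\<Sum>v\<in>A. bd X (f v) T)"
  unfolding bd_def by (subst sum.swap) (simp add: sum_distrib_left)

lemma bd_in_ideal:
  assumes "is_ideal V J" "X \<subseteq> V" "T \<subseteq> V" "\<And>U. U \<subseteq> V \<Longrightarrow> f U \<in> J"
  shows "bd X f T \<in> J"
  unfolding bd_def
proof (rule ideal_sum[OF assms(1)])
  fix v assume "v \<in> X - T"
  then have "v \<in> V" "insert v T \<subseteq> V" using assms(2,3) by auto
  then show "sg v T * (Var v * f (insert v T)) \<in> J"
    using assms(4) by (intro ideal_mult[OF assms(1)] sg_polyring polyring_Var) auto
qed

lemma bd_polyring:
  assumes "X \<subseteq> V" "\<And>U. f U \<in> polyring V"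
  shows "bd X f T \<in> polyring V"
  unfolding bd_def using assms by (intro polyring_sum polyring_mult sg_polyring polyring_Var) auto

lemma bd_bd:
  assumes "X \<subseteq> V" "T \<subseteq> V"
  shows "bd X (bd X f) T = 0"
proof -
  let ?g = "\<lambda>v w. sg v T * (Var v * (sg w (insert v T) * (Var w * f (insert w (insert v T)))))"
  have "X - insert v T = (X - T) - {v}" for v by auto
  then have "bd X (bd X f) T = (\<Sum>v\<in>X - T. \<Sum>w\<in>(X - T) - {v}. ?g v w)"
    by (simp add: bd_def sum_distrib_left)
  also have "\<dots> = 0"
  proof (rule antisymmetric_sum_zero)
    show "finite (X - T)" using assms(1) finite_V finite_subset by auto
    fix v w assume vw: "v \<in> X - T" "w \<in> X - T" "v \<noteq> w"
    have "?g v w = (sg v T * sg w (insert v T)) * (Var v * Var w * f (insert w (insert v T)))"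
      by (simp add: algebra_simps)
    also have "sg v T * sg w (insert v T) = - (sg w T * sg v (insert w T))"
      using vw assms by (intro sg_anti) auto
    also have "- (sg w T * sg v (insert w T)) * (Var v * Var w * f (insert w (insert v T))) = - ?g w v"
      by (simp add: algebra_simps insert_commute)
    finally show "?g v w = - ?g w v" .
  qed
  finally show ?thesis .
qed

text \<open>Exterior multiplication by e_v.\<close>

definition hom :: "'v \<Rightarrow> ('v set \<Rightarrow> ('v, 'k) mpoly) \<Rightarrow> 'v set \<Rightarrow> ('v, 'k) mpoly" where
  "hom v f T = (if v \<in> T then sg v (T - {v}) * f (T - {v}) else 0)"

lemma chain_hom:
  assumes "chain V j f" "v \<in> V"
  shows "chain V (Suc j) (hom v f)"
proof (rule chainI)
  fix T show "hom v f T \<in> polyring V"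
    unfolding hom_def by (simp add: polyring_mult sg_polyring chainD1[OF assms(1)])
  assume "hom v f T \<noteq> 0"
  then have "v \<in> T" "f (T - {v}) \<noteq> 0" by (auto simp: hom_def split: if_splits)
  then have "T - {v} \<subseteq> V" "card (T - {v}) = j" using chainD3[OF assms(1), of "T - {v}"] by simp_all
  then have "T \<subseteq> V" using assms(2) by auto
  then have "finite T" using finite_V finite_subset by auto
  then have "card T = Suc j" using card.remove[of T v] \<open>v \<in> T\<close> \<open>card (T - {v}) = j\<close> by simp
  with \<open>T \<subseteq> V\<close> show "T \<subseteq> V \<and> card T = Suc j" by simp
qed

text \<open>Contraction and exterior multiplication anticommute up to the pairing of e_v with
  itself, which is x_v: all terms with w different from v cancel by \<open>sg_anti\<close>.\<close>

lemma homotopy: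
  assumes v: "v \<in> V" and T: "T \<subseteq> V"
  shows "bd V (hom v f) T + hom v (bd V f) T = Var v * f T"
proof (cases "v \<in> T")
  case False
  have "bd V (hom v f) T = (\<Sum>w\<in>V - T. if w = v then Var v * f T else 0)"
    unfolding bd_def
  proof (rule sum.cong[OF refl])
    fix w assume "w \<in> V - T"
    show "sg w T * (Var w * hom v f (insert w T)) = (if w = v then Var v * f T else 0)"
    proof (cases "w = v")
      case True
      then have "insert v T - {v} = T" using False by auto
      then show ?thesis using True by (simp add: hom_def mult.left_commute)
    qed (use False in \<open>simp add: hom_def\<close>)
  qed
  also have "\<dots> = Var v * f T" using v False finite_V by simp
  finally show ?thesis using False by (simp add: hom_def)
next
  case True
  define U where "U = T - {v}"
  have TU: "T = insert v U" "v \<notin> U" using True by (auto simp: U_def)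
  have UV: "U \<subseteq> V" using T by (auto simp: U_def)
  have VU: "V - U = insert v (V - T)" using v by (auto simp: U_def)
  have fin: "finite (V - T)" "v \<notin> V - T" using finite_V True by auto
  have "bd V f U = sg v U * (Var v * f T) + (\<Sum>w\<in>V - T. sg w U * (Var w * f (insert w U)))"
    unfolding bd_def VU using fin by (simp flip: TU(1))
  then have h: "hom v (bd V f) T = Var v * f T + (\<Sum>w\<in>V - T. sg v U * (sg w U * (Var w * f (insert w U))))"
    using True by (simp add: hom_def distrib_left sum_distrib_left flip: U_def)
  have "bd V (hom v f) T = (\<Sum>w\<in>V - T. - (sg v U * (sg w U * (Var w * f (insert w U)))))"
    unfolding bd_def
  proof (rule sum.cong[OF refl])
    fix w assume w: "w \<in> V - T"
    then have wU: "w \<noteq> v" "w \<notin> U" "w \<in> V" using TU by auto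
    have "insert w T - {v} = insert w U" using wU TU by auto
    then have "sg w T * (Var w * hom v f (insert w T)) =
        (sg w (insert v U) * sg v (insert w U)) * (Var w * f (insert w U))"
      using True by (simp add: hom_def TU(1) algebra_simps)
    also have "sg w (insert v U) * sg v (insert w U) = - (sg v U * sg w U)"
    proof -
      have "sg v U * sg w (insert v U) = - (sg w U * sg v (insert w U))"
        using v wU UV TU by (intro sg_anti) auto
      then have "sg v U * (sg v U * sg w (insert v U)) * sg v (insert w U) =
          sg v U * (- (sg w U * sg v (insert w U))) * sg v (insert w U)" by simp
      also have "\<dots> = - (sg v U * sg w U) * (sg v (insert w U) * sg v (insert w U))"
        by (simp add: algebra_simps)
      finally show ?thesis by simp
    qed
    finally show "sg w T * (Var w * hom v f (insert w T)) = - (sg v U * (sg w U * (Var w * f (insert w U))))"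
      by (simp add: algebra_simps)
  qed
  then show ?thesis using h by (simp add: sum_negf)
qed

lemma sqf_singletons_sum:
  assumes "finite C" "C \<subseteq> V" "p \<in> sqf V (singletons C)"
  shows "\<exists>s. (\<forall>v. s v \<in> polyring V) \<and> (p :: ('v, 'k) mpoly) = (\<Sum>v\<in>C. s v * Var v)"
  using assms
proof (induction C arbitrary: p rule: finite_induct)
  case empty
  have "m \<notin> keys p" for m using sqfD(2)[OF empty(2), of m] by auto
  then have "keys p = {}" by blast
  then have "p = 0" by simp
  then show ?case by (intro exI[of _ "\<lambda>_. 0"]) simp
next
  case (insert c C)
  have cV: "c \<in> V" using insert.prems by simp
  have "p \<in> adjoin V (sqf V (singletons C)) (Var c)"
    using insert.prems(2) by (simp add: adjoin_singletons[OF cV])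
  then obtain q r where qr: "p = q + r * Var c" "q \<in> sqf V (singletons C)" "r \<in> polyring V"
    by (rule adjoinE)
  obtain s where s: "\<forall>v. s v \<in> polyring V" "q = (\<Sum>v\<in>C. s v * Var v)"
    using insert.IH[OF _ qr(2)] insert.prems(1) by auto
  have "p = (\<Sum>v\<in>insert c C. (s(c := r)) v * Var v)"
  proof -
    have "(\<Sum>v\<in>C. (s(c := r)) v * Var v) = (\<Sum>v\<in>C. s v * Var v)"
      using insert.hyps by (intro sum.cong) auto
    then show ?thesis using insert.hyps qr(1) s(2) by (simp add: add.commute)
  qed
  then show ?case using s(1) qr(3) by (intro exI[of _ "s(c := r)"]) simp
qed

lemma max_ideal_sum:
  assumes "p \<in> max_ideal V"
  shows "\<exists>s. (\<forall>v. s v \<in> polyring V) \<and> (p :: ('v, 'k) mpoly) = (\<Sum>v\<in>V. s v * Var v)"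
proof (rule sqf_singletons_sum[OF finite_V order_refl])
  have p: "p \<in> polyring V" "0 \<notin> keys p" using assms by (auto simp: max_ideal_def in_keys_iff)
  show "p \<in> sqf V (singletons V)"
  proof (rule sqfI[OF p(1)])
    fix m assume m: "m \<in> keys p"
    then have "m \<noteq> 0" using p(2) by auto
    then have "keys m \<noteq> {}" by simp
    then obtain v where "v \<in> keys m" by blast
    moreover have "v \<in> V" using polyringD[OF p(1) m] calculation by blast
    ultimately show "\<exists>e\<in>singletons V. e \<subseteq> keys m" by auto
  qed
qed

text \<open>Multiplication by \<open>x \<in> \<mm>\<close> is null-homotopic on the Koszul complex, so a nonzerodivisor
  in \<open>\<mm>\<close> shifts vanishing by one degree.\<close>
lemma vanish_step:
  assumes J: "is_ideal V J" and x: "x \<in> max_ideal V"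
    and nzd: "\<And>b. b \<in> polyring V \<Longrightarrow> x * b \<in> J \<Longrightarrow> b \<in> J"
    and van: "vanish (adjoin V J x) V (Suc j)"
  shows "vanish J V j"
  unfolding vanish_def
proof (intro allI impI)
  fix f assume f: "chain V j f" and cyc: "\<forall>T\<subseteq>V. bd V f T \<in> J"
  have xV: "x \<in> polyring V" using x by (simp add: max_ideal_def)
  obtain s where s: "\<And>v. s v \<in> polyring V" "x = (\<Sum>v\<in>V. s v * Var v)"
    using max_ideal_sum[OF x] by blast
  \<comment> \<open>The combined homotopy for x = sum of s_v x_v, applied to the cycle
    \<open>f\<close>. Its boundary is x f modulo \<open>J\<close>, so \<open>y\<close> is a cycle
    modulo (J, x).\<close>
  define y where "y T = (\<Sum>v\<in>V. s v * hom v f T)" for T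
  have y: "chain V (Suc j) y"
  proof (rule chainI)
    fix T show "y T \<in> polyring V"
      unfolding y_def using s(1) chainD1[OF chain_hom[OF f]] by (intro polyring_sum polyring_mult)
    assume "y T \<noteq> 0"
    then obtain v where "v \<in> V" "s v * hom v f T \<noteq> 0"
      unfolding y_def by (rule sum.not_neutral_contains_not_neutral)
    then have "v \<in> V" "hom v f T \<noteq> 0" by auto
    then show "T \<subseteq> V \<and> card T = Suc j" using chainD3[OF chain_hom[OF f]] by simp
  qed
  have bdy: "x * f T - bd V y T \<in> J" if T: "T \<subseteq> V" for T
  proof -
    have "bd V y T = (\<Sum>v\<in>V. s v * bd V (hom v f) T)"
      unfolding y_def bd_sum bd_scale ..
    also have "\<dots> = (\<Sum>v\<in>V. s v * (Var v * f T) - s v * hom v (bd V f) T)"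
    proof (rule sum.cong[OF refl])
      fix v assume "v \<in> V"
      have "bd V (hom v f) T = Var v * f T - hom v (bd V f) T"
        using homotopy[OF \<open>v \<in> V\<close> T, of f] by (simp add: algebra_simps)
      then show "s v * bd V (hom v f) T = s v * (Var v * f T) - s v * hom v (bd V f) T"
        by (simp add: right_diff_distrib)
    qed
    also have "\<dots> = x * f T - (\<Sum>v\<in>V. s v * hom v (bd V f) T)"
      by (simp add: sum_subtractf s(2) sum_distrib_right mult.assoc)
    finally have "x * f T - bd V y T = (\<Sum>v\<in>V. s v * hom v (bd V f) T)" by simp
    moreover have "s v * hom v (bd V f) T \<in> J" for v
    proof (cases "v \<in> T")
      case True
      have "T - {v} \<subseteq> V" using T by auto
      then have "sg v (T - {v}) * bd V f (T - {v}) \<in> J"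
        using cyc by (intro ideal_mult[OF J] sg_polyring) auto
      then show ?thesis using True ideal_mult[OF J s(1)] by (simp add: hom_def)
    qed (simp add: hom_def ideal_zero[OF J])
    moreover from this have "(\<Sum>v\<in>V. s v * hom v (bd V f) T) \<in> J"
      by (intro ideal_sum[OF J])
    ultimately show ?thesis by simp
  qed
  have "bd V y T \<in> adjoin V J x" if T: "T \<subseteq> V" for T
  proof -
    have "- (x * f T - bd V y T) + f T * x \<in> adjoin V J x"
      by (rule adjoinI[OF ideal_uminus[OF J bdy[OF T]] chainD1[OF f]])
    then show ?thesis by (simp add: mult.commute)
  qed
  then obtain w where w: "chain V (Suc (Suc j)) w" "\<And>T. T \<subseteq> V \<Longrightarrow> y T - bd V w T \<in> adjoin V J x"
    using van y unfolding vanish_def by blast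
  have "\<exists>r. r \<in> polyring V \<and> y T - bd V w T - r * x \<in> J \<and> (r \<noteq> 0 \<longrightarrow> T \<subseteq> V \<and> card T = Suc j)"
    if T: "T \<subseteq> V" for T
  proof (cases "card T = Suc j")
    case True
    obtain q r where "y T - bd V w T = q + r * x" "q \<in> J" "r \<in> polyring V"
      using w(2)[OF T] by (rule adjoinE)
    then show ?thesis using T True by (intro exI[of _ r]) simp
  next
    case False
    then have "y T = 0" using chainD2[OF y, of T] by simp
    moreover have "bd V w T = 0"
      unfolding bd_def
    proof (rule sum.neutral, rule ballI)
      fix v assume v: "v \<in> V - T"
      have "finite T" using T finite_V finite_subset by auto
      then have "card (insert v T) \<noteq> Suc (Suc j)" using v False by simp
      then show "sg v T * (Var v * w (insert v T)) = 0" using chainD2[OF w(1), of "insert v T"] by simp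
    qed
    ultimately show ?thesis by (intro exI[of _ 0]) (simp add: ideal_zero[OF J])
  qed
  then obtain r where r: "\<And>T. T \<subseteq> V \<Longrightarrow> r T \<in> polyring V \<and> y T - bd V w T - r T * x \<in> J \<and> (r T \<noteq> 0 \<longrightarrow> T \<subseteq> V \<and> card T = Suc j)"
    by metis
  \<comment> \<open>The coefficient of \<open>x\<close> in y - bd w, chosen to be zero away from
    sets of size j + 1 so that it is a chain.\<close>
  define z where "z T = (if T \<subseteq> V then r T else 0)" for T
  have z: "chain V (Suc j) z"
  proof (rule chainI)
    fix T show "z T \<in> polyring V" using r[of T] by (simp add: z_def)
    assume "z T \<noteq> 0"
    then show "T \<subseteq> V \<and> card T = Suc j" using r[of T] by (auto simp: z_def split: if_splits)
  qed
  \<comment> \<open>All values of \<open>q\<close> lie in \<open>J\<close>, hence so does its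
    boundary bd y - x bd z. Comparison with bd y = x f modulo \<open>J\<close> shows that x (f - bd
    z) lies in \<open>J\<close>, and \<open>x\<close> cancels.\<close>
  define q where "q T = y T + (- 1) * bd V w T + (- x) * z T" for T
  have q: "q T \<in> J" if "T \<subseteq> V" for T
    using r[OF that] that by (simp add: q_def z_def algebra_simps)
  have "f T - bd V z T \<in> J" if T: "T \<subseteq> V" for T
  proof -
    have "bd V q T = bd V y T + (- 1) * bd V (bd V w) T + (- x) * bd V z T"
      unfolding q_def bd_add bd_scale ..
    also have "bd V (bd V w) T = 0" using T by (intro bd_bd) auto
    finally have bq: "bd V y T - x * bd V z T = bd V q T" by simp
    have "bd V y T - x * bd V z T \<in> J"
      unfolding bq using J order_refl T q by (rule bd_in_ideal)
    then have "(x * f T - bd V y T) + (bd V y T - x * bd V z T) \<in> J"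
      using bdy[OF T] by (intro ideal_add[OF J])
    then have "x * (f T - bd V z T) \<in> J" by (simp add: algebra_simps)
    moreover have "f T - bd V z T \<in> polyring V"
      using chainD1[OF f] chainD1[OF z] by (intro polyring_diff bd_polyring) auto
    ultimately show ?thesis using nzd by blast
  qed
  then show "\<exists>w. chain V (Suc j) w \<and> (\<forall>T\<subseteq>V. f T - bd V w T \<in> J)" using z by blast
qed

lemma vanish_above:
  assumes "is_ideal V J" "j > card V"
  shows "vanish J V j"
  unfolding vanish_def
proof (intro allI impI)
  fix f assume f: "chain V j f"
  have "f T = 0" for T
  proof (rule ccontr)
    assume "f T \<noteq> 0"
    then have "T \<subseteq> V" "card T = j" using chainD3[OF f] by simp_all
    with card_mono[OF finite_V, of T] assms(2) show False by simp
  qed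
  moreover have "chain V (Suc j) (\<lambda>_. 0)" by (rule chainI) auto
  moreover have "bd V (\<lambda>_. 0) T = 0" for T by (simp add: bd_def)
  ultimately show "\<exists>w. chain V (Suc j) w \<and> (\<forall>T\<subseteq>V. f T - bd V w T \<in> J)"
    using ideal_zero[OF assms(1)] by (intro exI[of _ "\<lambda>_. 0"]) simp
qed

text \<open>Modulo the whole sequence homology vanishes in degrees above |V|. Removing the elements
  from last to first lowers this threshold by one each time, by \<open>vanish_step\<close>;
  \<open>d\<close> counts the removed elements.\<close>

lemma vanish_regular:
  assumes J: "is_ideal V J" and a: "\<And>i. i < t \<Longrightarrow> a i \<in> max_ideal V" and r: "reg V J a t"
    and "card V < j + t"
  shows "vanish J V j"
proof -
  have I: "is_ideal V (ideal_plus V J a i)" if "i \<le> t" for i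
  proof (rule is_ideal_plus[OF J])
    fix k assume "k < i"
    then have "a k \<in> max_ideal V" using that by (intro a) simp
    then show "a k \<in> polyring V" by (simp add: max_ideal_def)
  qed
  have "vanish (ideal_plus V J a (t - d)) V j" if "d \<le> t" "card V < j + d" for d j
    using that
  proof (induction d arbitrary: j)
    case 0
    then show ?case using I[of t] by (intro vanish_above) simp_all
  next
    case (Suc d)
    let ?i = "t - Suc d"
    have i: "?i < t" "Suc ?i = t - d" using Suc.prems by auto
    have v: "vanish (adjoin V (ideal_plus V J a ?i) (a ?i)) V (Suc j)"
      using Suc.IH[of "Suc j"] Suc.prems unfolding ideal_plus_Suc[symmetric] i(2) by simp
    show ?case
      by (rule vanish_step[OF I[OF less_imp_le[OF i(1)]] a[OF i(1)] regD[OF r i(1)] v])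
  qed
  from this[of t j] show ?thesis using assms(4) by simp
qed

section \<open>Dropping variables from the Koszul complex\<close>

lemma chain_trunc: "chain X j f \<Longrightarrow> chain X j (\<lambda>T. trunc k (f T))"
proof (rule chainI)
  fix T assume f: "chain X j f"
  show "trunc k (f T) \<in> polyring V" by (rule trunc_polyring[OF chainD1[OF f]])
  assume "trunc k (f T) \<noteq> 0"
  then have "f T \<noteq> 0" by (auto simp: trunc_def)
  then show "T \<subseteq> X \<and> card T = j" by (rule chainD3[OF f])
qed

lemma trunc_bd: "trunc k (bd X f T) = bd X (\<lambda>T. trunc (k - 1) (f T)) T"
proof -
  have Var: "homogeneous 1 (Var v :: ('v, 'k) mpoly)" for v
    by (simp add: homogeneous_def keys_Var)
  have "trunc k (sg v T * (Var v * p)) = sg v T * (Var v * trunc (k - 1) p)" for v p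
    using trunc_mult_homogeneous[OF sg_homogeneous[of v T], of k "Var v * p"]
      trunc_mult_homogeneous[OF Var[of v], of k p] by (simp add: mult.commute)
  then show ?thesis unfolding bd_def by (simp add: trunc_def filt_sum)
qed

text \<open>In the long exact sequence, the cokernel of x_w on the homology over \<open>X\<close>
  embeds into the homology over \<open>insert w X\<close>. If the latter vanishes, x_w is surjective
  on the former, and a graded form of Nakayama's lemma makes it zero.\<close>

lemma vanish_insert:
  assumes J: "is_ideal V J" and tc: "trunc_closed J" and X: "X \<subseteq> V" and w: "w \<in> V" "w \<notin> X"
    and van: "vanish J (insert w X) c"
  shows "vanish J X c"
  unfolding vanish_def
proof (intro allI impI)
  let ?X = "insert w X"
  define Z where "Z f \<longleftrightarrow> chain X c f \<and> (\<forall>T\<subseteq>V. bd X f T \<in> J)" for f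
  have finX: "finite (X - T)" for T using X finite_V finite_subset by auto
  have step: "\<exists>p q. chain X (Suc c) p \<and> Z q \<and> (\<forall>T\<subseteq>V. f T - bd X p T - Var w * q T \<in> J)" if "Z f" for f
  proof -
    have f: "chain X c f" and cyc: "\<And>T. T \<subseteq> V \<Longrightarrow> bd X f T \<in> J" using that by (auto simp: Z_def)
    have fw: "f T = 0" if "w \<in> T" for T using chainD2[OF f, of T] that w(2) by blast
    have "bd ?X f T = bd X f T" for T
    proof (cases "w \<in> T")
      case False
      have "?X - T = insert w (X - T)" using False by auto
      then show ?thesis using finX w(2) by (simp add: bd_def fw)
    next
      case True
      then have "?X - T = X - T" by auto
      then show ?thesis by (simp add: bd_def)
    qed
    moreover have "chain ?X c f"
      using f unfolding chain_def by blast
    ultimately obtain g where g: "chain ?X (Suc c) g" "\<And>T. T \<subseteq> V \<Longrightarrow> f T - bd ?X g T \<in> J"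
      using van cyc unfolding vanish_def by metis
    \<comment> \<open>A chain over \<open>insert w X\<close> is p + e_w q with \<open>p\<close> and
      \<open>q\<close> free of \<open>w\<close>.\<close>
    define p where "p T = (if w \<in> T then 0 else g T)" for T
    define q where "q T = (if w \<in> T then 0 else sg w T * g (insert w T))" for T
    have p: "chain X (Suc c) p"
    proof (rule chainI)
      fix T show "p T \<in> polyring V" using chainD1[OF g(1)] by (simp add: p_def)
      assume "p T \<noteq> 0"
      then have "w \<notin> T" "g T \<noteq> 0" by (auto simp: p_def split: if_splits)
      then show "T \<subseteq> X \<and> card T = Suc c" using chainD3[OF g(1), of T] by auto
    qed
    have q: "chain X c q"
    proof (rule chainI)
      fix T show "q T \<in> polyring V" using chainD1[OF g(1)] by (simp add: q_def polyring_mult sg_polyring)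
      assume "q T \<noteq> 0"
      then have wT: "w \<notin> T" "g (insert w T) \<noteq> 0" by (auto simp: q_def split: if_splits)
      then have "insert w T \<subseteq> ?X" "card (insert w T) = Suc c" using chainD3[OF g(1), of "insert w T"] by simp_all
      moreover from this have "finite T" by (metis card_ge_0_finite finite_insert zero_less_Suc)
      ultimately show "T \<subseteq> X \<and> card T = c" using wT by auto
    qed
    have 1: "bd ?X g T = bd X p T + Var w * q T" if "w \<notin> T" for T
    proof -
      have "?X - T = insert w (X - T)" using that by auto
      then have "bd ?X g T = sg w T * (Var w * g (insert w T)) + bd X g T"
        using finX w(2) by (simp add: bd_def)
      moreover have "bd X g T = bd X p T"
        unfolding bd_def using that w(2) by (intro sum.cong) (auto simp: p_def)
      ultimately show ?thesis using that by (simp add: q_def algebra_simps)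
    qed
    \<comment> \<open>The coefficients at sets containing \<open>w\<close>, where \<open>f\<close>
      is zero; they show that \<open>q\<close> is a cycle modulo \<open>J\<close>.\<close>
    have 2: "bd ?X g (insert w T) = - (sg w T * bd X q T)" if "w \<notin> T" "T \<subseteq> V" for T
    proof -
      have "?X - insert w T = X - T" using w(2) by auto
      then have "bd ?X g (insert w T) = (\<Sum>v\<in>X - T. sg v (insert w T) * (Var v * g (insert v (insert w T))))"
        by (simp add: bd_def)
      also have "\<dots> = (\<Sum>v\<in>X - T. - (sg w T * (sg v T * (Var v * q (insert v T)))))"
      proof (rule sum.cong[OF refl])
        fix v assume v: "v \<in> X - T"
        then have vw: "v \<noteq> w" "v \<in> V" using w(2) X by auto
        have "sg w T * (sg v T * (Var v * q (insert v T))) =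
            (sg v T * sg w (insert v T)) * (sg w T * (Var v * g (insert w (insert v T))))"
          using vw that(1) by (simp add: q_def algebra_simps)
        also have "sg v T * sg w (insert v T) = - (sg w T * sg v (insert w T))"
          using vw v that w by (intro sg_anti) auto
        also have "- (sg w T * sg v (insert w T)) * (sg w T * (Var v * g (insert w (insert v T)))) =
            - ((sg w T * sg w T) * (sg v (insert w T) * (Var v * g (insert w (insert v T)))))"
          by (simp only: mult_minus_left mult_minus_right mult.assoc mult.left_commute mult.commute)
        finally show "sg v (insert w T) * (Var v * g (insert v (insert w T))) =
            - (sg w T * (sg v T * (Var v * q (insert v T))))"
          by (simp add: insert_commute)
      qed
      also have "\<dots> = - (sg w T * bd X q T)"
        by (simp add: bd_def sum_distrib_left sum_negf)
      finally show ?thesis .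
    qed
    have cycq: "bd X q T \<in> J" if T: "T \<subseteq> V" for T
    proof (cases "w \<in> T")
      case True
      then have "bd X q T = 0" by (simp add: bd_def q_def)
      then show ?thesis using ideal_zero[OF J] by simp
    next
      case False
      have "insert w T \<subseteq> V" using T w by auto
      then have "f (insert w T) - bd ?X g (insert w T) \<in> J" by (rule g(2))
      then have "sg w T * bd X q T \<in> J" using 2[OF False T] fw[of "insert w T"] by simp
      then have "sg w T * (sg w T * bd X q T) \<in> J" by (rule ideal_mult[OF J sg_polyring])
      then show ?thesis by simp
    qed
    have "f T - bd X p T - Var w * q T \<in> J" if T: "T \<subseteq> V" for T
    proof (cases "w \<in> T")
      case True
      then have "bd X p T = 0" by (simp add: bd_def p_def)
      then show ?thesis using True fw[OF True] ideal_zero[OF J] by (simp add: q_def)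
    next
      case False
      then show ?thesis using g(2)[OF T] 1[OF False] by (simp add: algebra_simps)
    qed
    with p q cycq show ?thesis unfolding Z_def by blast
  qed
  fix f assume "chain X c f" "\<forall>T\<subseteq>V. bd X f T \<in> J"
  then have Zf: "Z f" by (simp add: Z_def)
  \<comment> \<open>Repeating the step makes \<open>f\<close> homologous to a multiple of x_w^k for
    every k.\<close>
  have iter: "\<exists>p q. chain X (Suc c) p \<and> Z q \<and> (\<forall>T\<subseteq>V. f T - bd X p T - Var w ^ k * q T \<in> J)" for k
  proof (induction k)
    case 0
    have "chain X (Suc c) (\<lambda>_. 0)" by (rule chainI) auto
    moreover have "bd X (\<lambda>_. 0) T = 0" for T by (simp add: bd_def)
    ultimately show ?case using Zf ideal_zero[OF J] by (intro exI[of _ "\<lambda>_. 0"] exI[of _ f]) simp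
  next
    case (Suc k)
    then obtain p q where pq: "chain X (Suc c) p" "Z q" "\<And>T. T \<subseteq> V \<Longrightarrow> f T - bd X p T - Var w ^ k * q T \<in> J"
      by blast
    from step[OF pq(2)] obtain p' q' where pq': "chain X (Suc c) p'" "Z q'"
      "\<And>T. T \<subseteq> V \<Longrightarrow> q T - bd X p' T - Var w * q' T \<in> J" by blast
    define p'' where "p'' T = p T + Var w ^ k * p' T" for T
    have xk: "Var w ^ k \<in> polyring V" using w(1) by auto
    have "chain X (Suc c) p''"
    proof (rule chainI)
      fix T show "p'' T \<in> polyring V"
        unfolding p''_def using chainD1[OF pq(1)] chainD1[OF pq'(1)] xk by auto
      assume "p'' T \<noteq> 0"
      then have "p T \<noteq> 0 \<or> p' T \<noteq> 0" by (auto simp: p''_def)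
      then show "T \<subseteq> X \<and> card T = Suc c" using chainD3[OF pq(1), of T] chainD3[OF pq'(1), of T] by auto
    qed
    moreover have "f T - bd X p'' T - Var w ^ Suc k * q' T \<in> J" if T: "T \<subseteq> V" for T
    proof -
      have "(f T - bd X p T - Var w ^ k * q T) + Var w ^ k * (q T - bd X p' T - Var w * q' T) \<in> J"
        by (rule ideal_add[OF J pq(3)[OF T] ideal_mult[OF J xk pq'(3)[OF T]]])
      then show ?thesis unfolding p''_def bd_add bd_scale by (simp add: algebra_simps)
    qed
    ultimately show ?case using pq'(2) by blast
  qed
  have "\<forall>T. \<exists>k0. \<forall>k\<ge>k0. trunc k (f T) = f T" using trunc_eq_large by blast
  then obtain k0 where k0: "\<And>T k. k \<ge> k0 T \<Longrightarrow> trunc k (f T) = f T" by metis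
  \<comment> \<open>The sum is a bound common to the finitely many coefficients of
    \<open>f\<close>.\<close>
  define k where "k = (\<Sum>T\<in>Pow V. k0 T)"
  have k: "trunc k (f T) = f T" if "T \<subseteq> V" for T
    using that finite_V unfolding k_def by (intro k0 member_le_sum) auto
  obtain p q where pq: "chain X (Suc c) p" "\<And>T. T \<subseteq> V \<Longrightarrow> f T - bd X p T - Var w ^ k * q T \<in> J"
    using iter[of k] by blast
  \<comment> \<open>Truncation fixes \<open>f\<close> and kills the multiple of x_w^k. Since the
    differential raises degrees by one, \<open>p\<close> is cut at k - 1.\<close>
  have "f T - bd X (\<lambda>T. trunc (k - 1) (p T)) T \<in> J" if T: "T \<subseteq> V" for T
  proof -
    have "trunc k (Var w ^ k * q T) = 0"
      using trunc_mult_Var_power[of k "q T" w] by (simp add: mult.commute)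
    then have "trunc k (f T - bd X p T - Var w ^ k * q T) = f T - bd X (\<lambda>T. trunc (k - 1) (p T)) T"
      using k[OF T] trunc_bd[of k X p T] by (simp add: trunc_def filt_diff)
    then show ?thesis using trunc_closedD[OF tc pq(2)[OF T], of k] by simp
  qed
  then show "\<exists>w. chain X (Suc c) w \<and> (\<forall>T\<subseteq>V. f T - bd X w T \<in> J)"
    using chain_trunc[OF pq(1)] by blast
qed

text \<open>In the top degree |C| a cycle is u e_C with \<open>u\<close> annihilated by all
  variables in \<open>C\<close>, and there are no chains above whose boundary it could be.\<close>

lemma vanish_socle:
  assumes J: "is_ideal V J" and C: "C \<subseteq> V" and u: "u \<in> polyring V"
    and ann: "\<And>v. v \<in> C \<Longrightarrow> Var v * u \<in> J" and van: "vanish J C (card C)"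
  shows "u \<in> J"
proof -
  define f where "f T = (if T = C then u else 0)" for T
  have "chain C (card C) f"
    by (rule chainI) (use u in \<open>auto simp: f_def split: if_splits\<close>)
  moreover have "bd C f T \<in> J" for T
    unfolding bd_def
  proof (rule ideal_sum[OF J])
    fix v assume "v \<in> C - T"
    then have "Var v * f (insert v T) \<in> J" using ann ideal_zero[OF J] by (auto simp: f_def)
    then show "sg v T * (Var v * f (insert v T)) \<in> J" by (rule ideal_mult[OF J sg_polyring])
  qed
  ultimately obtain w where w: "chain C (Suc (card C)) w" "\<And>T. T \<subseteq> V \<Longrightarrow> f T - bd C w T \<in> J"
    using van unfolding vanish_def by blast
  have "bd C w C = 0" by (simp add: bd_def)
  then show ?thesis using w(2)[OF C] by (simp add: f_def)
qed

text \<open>A longer sequence would kill homology over \<open>V\<close> in degree |C|. Dropping the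
  variables outside \<open>C\<close> one by one keeps this degree and ends in a contradiction to
  \<open>vanish_socle\<close>.\<close>

lemma regular_length_bound:
  fixes J :: "('v, 'k) mpoly set"
  assumes J: "is_ideal V J" and tc: "trunc_closed J" and C: "C \<subseteq> V"
    and u: "u \<in> polyring V" "u \<notin> J" and ann: "\<And>v. v \<in> C \<Longrightarrow> Var v * u \<in> J"
    and a: "\<And>i. i < t \<Longrightarrow> a i \<in> max_ideal V" and r: "reg V J a t"
  shows "t + card C \<le> card V"
proof (rule ccontr)
  assume "\<not> t + card C \<le> card V"
  then have van: "vanish J V (card C)"
    by (intro vanish_regular[OF J a r]) auto
  have "vanish J (C \<union> D) (card C) \<Longrightarrow> vanish J C (card C)" if "finite D" "D \<subseteq> V - C" for D
    using that
  proof (induction D rule: finite_induct)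
    case (insert w D)
    have "vanish J (insert w (C \<union> D)) (card C)" using insert.prems(1) by simp
    then have "vanish J (C \<union> D) (card C)"
      by (rule vanish_insert[OF J tc, rotated 3]) (use insert.prems(2) insert.hyps C in auto)
    then show ?case using insert.IH insert.prems(2) by simp
  qed simp
  from this[of "V - C"] van C have "vanish J C (card C)"
    using finite_V by (simp add: Un_absorb1)
  then show False using vanish_socle[OF J C u(1) ann] u(2) by blast
qed

end

text \<open>The usual sign, given by the number of elements of \<open>T\<close> that precede
  \<open>v\<close> in a numbering of \<open>V\<close>.\<close>

lemma koszul_exists:
  assumes "finite (V :: 'v set)"
  obtains sg :: "'v \<Rightarrow> 'v set \<Rightarrow> ('v, 'k::field) mpoly" where "koszul V sg"
proof -
  obtain \<iota> :: "'v \<Rightarrow> nat" where \<iota>: "inj_on \<iota> V"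
    using finite_imp_inj_to_nat_seg[OF assms] by blast
  define lower where "lower v T = {u\<in>T. \<iota> u < \<iota> v}" for v T
  define sg :: "'v \<Rightarrow> 'v set \<Rightarrow> ('v, 'k) mpoly" where "sg v T = (- 1) ^ card (lower v T)" for v T
  have less: "sg w (insert v T) = - sg w T" "sg v (insert w T) = sg v T"
    if "T \<subseteq> V" "v \<notin> T" "\<iota> v < \<iota> w" for v w T
  proof -
    have "finite (lower w T)" using finite_subset[OF that(1) assms] by (simp add: lower_def)
    moreover have "lower w (insert v T) = insert v (lower w T)" "v \<notin> lower w T" "lower v (insert w T) = lower v T"
      using that by (auto simp: lower_def)
    ultimately show "sg w (insert v T) = - sg w T" "sg v (insert w T) = sg v T"
      by (simp_all add: sg_def)
  qed
  have "koszul V sg"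
  proof
    show "finite V" by (rule assms)
    show "sg v T = 1 \<or> sg v T = - 1" for v T
      unfolding sg_def by (induction "card (lower v T)") (auto simp: minus_one_power_iff)
    fix v w T assume *: "v \<in> V" "w \<in> V" "T \<subseteq> V" "v \<noteq> w" "v \<notin> T" "w \<notin> T"
    have "\<iota> v \<noteq> \<iota> w" using \<iota> * by (auto dest: inj_onD)
    then consider "\<iota> v < \<iota> w" | "\<iota> w < \<iota> v" by linarith
    then show "sg v T * sg w (insert v T) = - (sg w T * sg v (insert w T))"
      using less[OF *(3,5)] less[OF *(3,6)] by cases (simp_all add: mult.commute)
  qed
  then show ?thesis by (rule that)
qed

lemma regular_seq_length_bound:
  fixes F :: "'v set set" and u :: "('v, 'k::field) mpoly"
  assumes "finite V" "C \<subseteq> V" "u \<in> polyring V" "u \<notin> sqf V F"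
    and "\<And>v. v \<in> C \<Longrightarrow> Var v * u \<in> sqf V F"
    and "regular_seq V (sqf V F :: ('v, 'k) mpoly set) a t"
  shows "t + card C \<le> card V"
proof -
  obtain sg :: "'v \<Rightarrow> 'v set \<Rightarrow> ('v, 'k) mpoly" where "koszul V sg"
    using koszul_exists[OF assms(1)] .
  then interpret koszul V sg .
  show ?thesis
    by (rule regular_length_bound[OF is_ideal_sqf trunc_closed_sqf assms(2-5), of _ a])
      (use assms(6) in \<open>simp_all add: regular_seq_def reg_def\<close>)
qed

section \<open>Chains of primes\<close>

text \<open>Gaussian elimination: more unknowns, indexed by \<open>E\<close>, than equations,
  indexed by \<open>T\<close>.\<close>

lemma homogeneous_system_solution:
  fixes c :: "'e \<Rightarrow> 't \<Rightarrow> 'k::field"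
  assumes "finite T" "finite E" "card T < card E"
  shows "\<exists>q. (\<exists>e\<in>E. q e \<noteq> 0) \<and> (\<forall>m\<in>T. (\<Sum>e\<in>E. q e * c e m) = 0)"
  using assms
proof (induction T arbitrary: E c rule: finite_induct)
  case empty
  then have "E \<noteq> {}" by auto
  then show ?case by (intro exI[of _ "\<lambda>_. 1"]) auto
next
  case (insert m T)
  show ?case
  proof (cases "\<forall>e\<in>E. c e m = 0")
    case True
    obtain q where "\<exists>e\<in>E. q e \<noteq> 0" "\<forall>m\<in>T. (\<Sum>e\<in>E. q e * c e m) = 0"
      using insert.IH[of E c] insert.prems insert.hyps by auto
    with True show ?thesis by (intro exI[of _ q]) simp
  next
    case False
    then obtain e0 where e0: "e0 \<in> E" "c e0 m \<noteq> 0" by blast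
    \<comment> \<open>Equation \<open>m\<close> is used to eliminate the unknown
      \<open>e0\<close>.\<close>
    define c' where "c' e n = c e n - (c e m / c e0 m) * c e0 n" for e n
    have "card T < card (E - {e0})"
      using insert.prems insert.hyps e0 by simp
    then obtain q where q: "\<exists>e\<in>E - {e0}. q e \<noteq> 0" "\<forall>n\<in>T. (\<Sum>e\<in>E - {e0}. q e * c' e n) = 0"
      using insert.IH[of "E - {e0}" c'] insert.prems by auto
    define q' where "q' e = (if e = e0 then - (\<Sum>e\<in>E - {e0}. q e * (c e m / c e0 m)) else q e)" for e
    have sum: "(\<Sum>e\<in>E. q' e * c e n) = (\<Sum>e\<in>E - {e0}. q e * c' e n)" for n
    proof -
      have "(\<Sum>e\<in>E. q' e * c e n) = q' e0 * c e0 n + (\<Sum>e\<in>E - {e0}. q' e * c e n)"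
        using insert.prems e0 by (intro sum.remove)
      also have "(\<Sum>e\<in>E - {e0}. q' e * c e n) = (\<Sum>e\<in>E - {e0}. q e * c e n)"
        by (intro sum.cong) (auto simp: q'_def)
      also have "q' e0 * c e0 n = - (\<Sum>e\<in>E - {e0}. q e * (c e m / c e0 m * c e0 n))"
        by (simp add: q'_def sum_distrib_right mult.assoc)
      finally show ?thesis
        by (simp add: c'_def right_diff_distrib sum_subtractf)
    qed
    have "(\<Sum>e\<in>E. q' e * c e n) = 0" if "n \<in> insert m T" for n
    proof (cases "n = m")
      case True
      have "c' e m = 0" for e using e0(2) by (simp add: c'_def)
      with True show ?thesis unfolding sum by simp
    qed (use that q(2) in \<open>simp add: sum\<close>)
    moreover have "\<exists>e\<in>E. q' e \<noteq> 0" using q(1) by (auto simp: q'_def)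
    ultimately show ?thesis by blast
  qed
qed

section \<open>Algebraic dependence by counting monomials\<close>

definition exponent_bound :: "nat \<Rightarrow> ('v, 'k::field) mpoly \<Rightarrow> bool" where
  "exponent_bound B p \<longleftrightarrow> (\<forall>m\<in>keys p. \<forall>v. lookup m v \<le> B)"

lemma exponent_bound_exists: "\<exists>B. exponent_bound B p"
proof -
  let ?S = "\<Union>m\<in>keys p. lookup m ` keys m"
  have "lookup m v \<le> Max (insert 0 ?S)" if "m \<in> keys p" for m v
  proof (cases "v \<in> keys m")
    case True
    then have "lookup m v \<in> insert 0 ?S" using that by blast
    then show ?thesis by (intro Max_ge) simp_all
  qed (simp add: in_keys_iff)
  then show ?thesis unfolding exponent_bound_def by blast
qed

lemma exponent_bound_mono: "exponent_bound B p \<Longrightarrow> B \<le> B' \<Longrightarrow> exponent_bound B' p"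
  unfolding exponent_bound_def by (meson le_trans)

lemma exponent_bound_one: "exponent_bound 0 1"
  by (simp add: exponent_bound_def)

lemma exponent_bound_mult:
  assumes "exponent_bound A p" "exponent_bound B q"
  shows "exponent_bound (A + B) (p * q)"
  unfolding exponent_bound_def
proof (intro ballI allI)
  fix m v assume "m \<in> keys (p * q)"
  then obtain a b where "m = a + b" "a \<in> keys p" "b \<in> keys q" using keys_mult[of p q] by blast
  then show "lookup m v \<le> A + B"
    using assms unfolding exponent_bound_def by (simp add: lookup_add add_mono)
qed

lemma exponent_bound_power: "exponent_bound B p \<Longrightarrow> exponent_bound (k * B) (p ^ k)"
proof (induction k)
  case (Suc k)
  then show ?case using exponent_bound_mult[of B p "k * B" "p ^ k"] by simp
qed (simp add: exponent_bound_one)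

lemma exponent_bound_prod:
  "finite A \<Longrightarrow> (\<And>i. i \<in> A \<Longrightarrow> exponent_bound (B i) (f i)) \<Longrightarrow> exponent_bound (sum B A) (prod f A)"
proof (induction A rule: finite_induct)
  case (insert i A)
  then show ?case using exponent_bound_mult[of "B i" "f i" "sum B A" "prod f A"] by simp
qed (simp add: exponent_bound_one)

lemma bounded_monomials:
  assumes "finite V"
  shows "finite {m :: 'v \<Rightarrow>\<^sub>0 nat. keys m \<subseteq> V \<and> (\<forall>v. lookup m v \<le> B)}"
    and "card {m :: 'v \<Rightarrow>\<^sub>0 nat. keys m \<subseteq> V \<and> (\<forall>v. lookup m v \<le> B)} \<le> (B + 1) ^ card V"
proof -
  let ?T = "{m :: 'v \<Rightarrow>\<^sub>0 nat. keys m \<subseteq> V \<and> (\<forall>v. lookup m v \<le> B)}"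
  let ?P = "PiE V (\<lambda>_. {..B})"
  define \<phi> where "\<phi> m = restrict (lookup m) V" for m :: "'v \<Rightarrow>\<^sub>0 nat"
  have "inj_on \<phi> ?T"
  proof (rule inj_onI)
    fix m n assume mn: "m \<in> ?T" "n \<in> ?T" "\<phi> m = \<phi> n"
    show "m = n"
    proof (rule poly_mapping_eqI)
      fix v show "lookup m v = lookup n v"
      proof (cases "v \<in> V")
        case True
        then show ?thesis using fun_cong[OF mn(3), of v] by (simp add: \<phi>_def)
      next
        case False
        then have "v \<notin> keys m" "v \<notin> keys n" using mn(1,2) by auto
        then show ?thesis by (simp add: in_keys_iff)
      qed
    qed
  qed
  moreover have "\<phi> ` ?T \<subseteq> ?P" by (auto simp: \<phi>_def)
  moreover have "finite ?P" using assms by (intro finite_PiE) auto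
  moreover have "card ?P = (B + 1) ^ card V" using assms by (simp add: card_PiE)
  ultimately show "finite ?T" "card ?T \<le> (B + 1) ^ card V"
    using inj_on_finite[of \<phi> ?T ?P] card_inj_on_le[of \<phi> ?T ?P] by simp_all
qed

text \<open>There are N^(n+1) power products with exponents below \<open>N\<close>, but only (M+1)^n
  monomials can occur in them, so for large \<open>N\<close> a linear relation exists. The exponent
  vectors are extensional functions, hence determined by their values up to n.\<close>

lemma algebraic_dependence:
  fixes a :: "nat \<Rightarrow> ('v, 'k::field) mpoly"
  assumes "finite V" "\<And>i. i \<le> card V \<Longrightarrow> a i \<in> polyring V"
  obtains E q where "finite E" "E \<noteq> {}" "E \<subseteq> PiE {..card V} (\<lambda>_. UNIV)" "\<And>e. e \<in> E \<Longrightarrow> q e \<noteq> (0 :: 'k)"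
    "(\<Sum>e\<in>E. single 0 (q e) * (\<Prod>i\<le>card V. a i ^ e i)) = 0"
proof -
  let ?n = "card V"
  have "\<forall>i. \<exists>B. exponent_bound B (a i)" using exponent_bound_exists by blast
  then obtain B where B: "\<And>i. exponent_bound (B i) (a i)" by metis
  define D where "D = (\<Sum>i\<le>?n. B i)"
  have D: "exponent_bound D (a i)" if "i \<le> ?n" for i
  proof (rule exponent_bound_mono[OF B])
    show "B i \<le> D" unfolding D_def using that by (intro member_le_sum) auto
  qed
  \<comment> \<open>Chosen so that M + 1 is at most N((n+1)D + 1) and ((n+1)D + 1)^n is less than N,
    which together give (M+1)^n < N^(n+1).\<close>
  define N where "N = ((?n + 1) * D + 1) ^ ?n + 1"
  define M where "M = (?n + 1) * N * D"
  define T where "T = {m :: 'v \<Rightarrow>\<^sub>0 nat. keys m \<subseteq> V \<and> (\<forall>v. lookup m v \<le> M)}"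
  define E where "E = PiE {..?n} (\<lambda>_. {..<N})"
  define p where "p e = (\<Prod>i\<le>?n. a i ^ e i)" for e
  have T: "finite T" "card T \<le> (M + 1) ^ ?n"
    unfolding T_def using bounded_monomials[OF assms(1)] by blast+
  have E: "finite E" "card E = N ^ (?n + 1)"
    unfolding E_def by (auto intro!: finite_PiE simp: card_PiE)
  have "M + 1 \<le> N * ((?n + 1) * D + 1)" by (simp add: M_def N_def algebra_simps)
  then have "(M + 1) ^ ?n \<le> (N * ((?n + 1) * D + 1)) ^ ?n" by (rule power_mono) simp
  also have "\<dots> = N ^ ?n * ((?n + 1) * D + 1) ^ ?n" by (rule power_mult_distrib)
  also have "\<dots> < N ^ ?n * N" by (intro mult_strict_left_mono) (simp_all add: N_def)
  finally have "card T < card E" using T(2) E(2) by (simp add: mult.commute)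
  then obtain q where q: "\<exists>e\<in>E. q e \<noteq> 0" "\<And>m. m \<in> T \<Longrightarrow> (\<Sum>e\<in>E. q e * lookup (p e) m) = 0"
    using homogeneous_system_solution[OF T(1) E(1), of "\<lambda>e. lookup (p e)"] by blast
  have keysp: "keys (p e) \<subseteq> T" if "e \<in> E" for e
  proof
    fix m assume m: "m \<in> keys (p e)"
    have "p e \<in> polyring V"
      unfolding p_def using assms(2) by (intro polyring_prod polyring_power) simp
    then have "keys m \<subseteq> V" using m by (rule polyringD)
    moreover have "exponent_bound (\<Sum>i\<le>?n. e i * D) (p e)"
      unfolding p_def by (intro exponent_bound_prod exponent_bound_power D) simp_all
    moreover have "(\<Sum>i\<le>?n. e i * D) \<le> M"
    proof -
      have "(\<Sum>i\<le>?n. e i * D) \<le> (\<Sum>i\<le>?n. N * D)"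
        using that by (intro sum_mono mult_right_mono) (auto simp: E_def intro: less_imp_le)
      then show ?thesis by (simp add: M_def algebra_simps)
    qed
    ultimately show "m \<in> T"
      using m unfolding T_def exponent_bound_def by (blast intro: le_trans)
  qed
  have zero: "(\<Sum>e\<in>E. single 0 (q e) * p e) = 0"
  proof (rule poly_mapping_eqI)
    fix m
    have scale: "lookup (single 0 c * r) m = c * lookup r m" for c and r :: "('v, 'k) mpoly"
    proof (cases "c = 0")
      case False
      then have "lookup (single 0 c * r) m = (\<Sum>n\<in>keys r. if n = m then c * lookup r n else 0)"
        by (simp add: lookup_times)
      then show ?thesis by (auto simp: in_keys_iff)
    qed simp
    have "(\<Sum>e\<in>E. q e * lookup (p e) m) = 0"
    proof (cases "m \<in> T")
      case False
      then have "lookup (p e) m = 0" if "e \<in> E" for e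
        using keysp[OF that] by (auto simp: in_keys_iff)
      then show ?thesis by (intro sum.neutral) simp
    qed (rule q(2))
    then show "lookup (\<Sum>e\<in>E. single 0 (q e) * p e) m = lookup 0 m"
      by (simp add: lookup_sum scale)
  qed
  show ?thesis
  proof (rule that[of "{e\<in>E. q e \<noteq> 0}" q])
    show "(\<Sum>e\<in>{e\<in>E. q e \<noteq> 0}. single 0 (q e) * (\<Prod>i\<le>?n. a i ^ e i)) = 0"
    proof -
      have "(\<Sum>e\<in>{e\<in>E. q e \<noteq> 0}. single 0 (q e) * p e) = (\<Sum>e\<in>E. single 0 (q e) * p e)"
        using E(1) by (intro sum.mono_neutral_left) auto
      then show ?thesis using zero by (simp add: p_def)
    qed
    show "{e\<in>E. q e \<noteq> 0} \<subseteq> PiE {..?n} (\<lambda>_. UNIV)" by (auto simp: E_def PiE_def)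
  qed (use q(1) E(1) in auto)
qed

section \<open>Prime ideals and the length of their chains\<close>

lemma prime_ideal: "is_prime V P \<Longrightarrow> is_ideal V P"
  by (simp add: is_prime_def)

lemma primeD:
  "is_prime V P \<Longrightarrow> a \<in> polyring V \<Longrightarrow> b \<in> polyring V \<Longrightarrow> a * b \<in> P \<Longrightarrow> a \<in> P \<or> b \<in> P"
  by (simp add: is_prime_def)

lemma one_notin_prime: "is_prime V P \<Longrightarrow> 1 \<notin> P"
proof
  assume P: "is_prime V P" "1 \<in> P"
  have "r \<in> P" if "r \<in> polyring V" for r
    using ideal_mult[OF prime_ideal[OF P(1)] that P(2)] by simp
  then have "P = polyring V" using ideal_subset[OF prime_ideal[OF P(1)]] by blast
  then show False using P(1) by (simp add: is_prime_def)
qed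

lemma prime_power_cancel:
  assumes "is_prime V P" "a \<in> polyring V" "a \<notin> P" "s \<in> polyring V"
  shows "a ^ k * s \<in> P \<Longrightarrow> s \<in> P"
proof (induction k)
  case (Suc k)
  have "a * (a ^ k * s) \<in> P" using Suc.prems by (simp add: mult.assoc)
  then have "a ^ k * s \<in> P"
    using primeD[OF assms(1,2), of "a ^ k * s"] assms(2-4) by blast
  then show ?case by (rule Suc.IH)
qed simp

text \<open>Every \<open>n + 1\<close> polynomials satisfy an algebraic relation. Reading it modulo the members of
  a chain of primes, each \<open>a\<^sub>k \<in> P\<^sub>k\<^sub>+\<^sub>1 - P\<^sub>k\<close> selects the terms of lowest degree in \<open>a\<^sub>k\<close>, until a
  nonzero constant is left.\<close>
lemma prime_chain_length:
  fixes P :: "nat \<Rightarrow> ('v, 'k::field) mpoly set"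
  assumes fin: "finite V" and chain: "prime_chain V t P"
  shows "t \<le> card V"
proof (rule ccontr)
  assume "\<not> t \<le> card V"
  then have t: "card V < t" by simp
  let ?n = "card V"
  have prime: "is_prime V (P i)" if "i \<le> t" for i using chain that by (simp add: prime_chain_def)
  have strict: "P i \<subset> P (Suc i)" if "i < t" for i using chain that by (simp add: prime_chain_def)
  have "\<exists>x. x \<in> P (Suc i) \<and> x \<notin> P i" if "i < t" for i using strict[OF that] by blast
  then obtain a where a: "\<And>i. i < t \<Longrightarrow> a i \<in> P (Suc i)" "\<And>i. i < t \<Longrightarrow> a i \<notin> P i" by metis
  have aV: "a i \<in> polyring V" if "i < t" for i
    using ideal_subset[OF prime_ideal[OF prime] a(1)[OF that]] that by simp
  obtain E q where E: "finite E" "E \<noteq> {}" "E \<subseteq> PiE {..?n} (\<lambda>_. UNIV)" "\<And>e. e \<in> E \<Longrightarrow> q e \<noteq> (0 :: 'k)"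
    and dep: "(\<Sum>e\<in>E. single 0 (q e) * (\<Prod>i\<le>?n. a i ^ e i)) = 0"
  proof (rule algebraic_dependence[OF fin, of a])
    show "\<And>i. i \<le> ?n \<Longrightarrow> a i \<in> polyring V" using aV t by simp
  qed blast
  \<comment> \<open>The term of the relation with the factors a_i for i < k removed. At stage k the
    surviving exponent vectors agree below k, and their terms \<open>tm k\<close> sum to an element
    of \<open>P k\<close>.\<close>
  define tm where "tm k e = single 0 (q e) * (\<Prod>i\<in>{k..?n}. a i ^ e i)" for k e
  have tmV: "tm k e \<in> polyring V" for k e
    unfolding tm_def using aV t by (intro polyring_mult polyring_prod polyring_power polyring_single) auto
  have "\<exists>E'. E' \<subseteq> E \<and> E' \<noteq> {} \<and> (\<forall>e\<in>E'. \<forall>e'\<in>E'. \<forall>i<k. e i = e' i) \<and> (\<Sum>e\<in>E'. tm k e) \<in> P k"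
    if "k \<le> Suc ?n" for k
    using that
  proof (induction k)
    case 0
    have "(\<Sum>e\<in>E. tm 0 e) = 0" using dep by (simp add: tm_def atLeast0AtMost)
    then have "(\<Sum>e\<in>E. tm 0 e) \<in> P 0" using ideal_zero[OF prime_ideal[OF prime]] by simp
    then show ?case using E(2) by (intro exI[of _ E]) simp
  next
    case (Suc k)
    then obtain E' where E': "E' \<subseteq> E" "E' \<noteq> {}" "\<And>e e' i. e \<in> E' \<Longrightarrow> e' \<in> E' \<Longrightarrow> i < k \<Longrightarrow> e i = e' i"
        "(\<Sum>e\<in>E'. tm k e) \<in> P k" by (metis Suc_leD)
    have kn: "k \<le> ?n" "k < t" using Suc.prems t by simp_all
    have finE': "finite E'" using E'(1) E(1) by (rule finite_subset)
    \<comment> \<open>The power a_k^m is factored out and cancelled modulo \<open>P k\<close>. Terms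
      with larger exponent keep a factor a_k and so lie in \<open>P (Suc k)\<close>; only those with
      exponent \<open>m\<close> survive.\<close>
    define m where "m = Min ((\<lambda>e. e k) ` E')"
    have m: "m \<le> e k" if "e \<in> E'" for e unfolding m_def using that finE' by simp
    have "m \<in> (\<lambda>e. e k) ` E'" unfolding m_def using finE' E'(2) by (intro Min_in) auto
    define E'' where "E'' = {e\<in>E'. e k = m}"
    define rest where "rest e = a k ^ (e k - m) * tm (Suc k) e" for e
    have restV: "rest e \<in> polyring V" for e
      unfolding rest_def using aV[OF kn(2)] tmV by auto
    have split: "tm k e = a k ^ m * rest e" if "e \<in> E'" for e
    proof -
      have "{k..?n} = insert k {Suc k..?n}" using kn by auto
      then have "tm k e = a k ^ e k * tm (Suc k) e"
        by (simp add: tm_def algebra_simps)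
      also have "a k ^ e k = a k ^ m * a k ^ (e k - m)"
        using m[OF that] by (simp flip: power_add)
      finally show ?thesis by (simp add: rest_def mult.assoc)
    qed
    have pk: "is_prime V (P k)" and pk': "is_prime V (P (Suc k))" using prime kn by simp_all
    have "(\<Sum>e\<in>E'. tm k e) = a k ^ m * (\<Sum>e\<in>E'. rest e)"
      unfolding sum_distrib_left by (rule sum.cong[OF refl split])
    then have mem: "a k ^ m * (\<Sum>e\<in>E'. rest e) \<in> P k" using E'(4) by simp
    have "(\<Sum>e\<in>E'. rest e) \<in> P k"
      by (rule prime_power_cancel[OF pk aV[OF kn(2)] a(2)[OF kn(2)] _ mem]) (intro polyring_sum restV)
    then have 1: "(\<Sum>e\<in>E'. rest e) \<in> P (Suc k)" using strict[OF kn(2)] by blast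
    have 2: "(\<Sum>e\<in>E' - E''. rest e) \<in> P (Suc k)"
    proof (rule ideal_sum[OF prime_ideal[OF pk']])
      fix e assume e: "e \<in> E' - E''"
      then have "m < e k" using m[of e] by (auto simp: E''_def)
      then obtain d where "e k - m = Suc d" by (metis Suc_diff_Suc)
      then have "rest e = (a k ^ d * tm (Suc k) e) * a k" by (simp add: rest_def algebra_simps)
      also have "\<dots> \<in> P (Suc k)"
        using aV[OF kn(2)] tmV a(1)[OF kn(2)]
        by (intro ideal_mult[OF prime_ideal[OF pk']] polyring_mult polyring_power)
      finally show "rest e \<in> P (Suc k)" .
    qed
    have "(\<Sum>e\<in>E'. rest e) - (\<Sum>e\<in>E' - E''. rest e) \<in> P (Suc k)"
      by (rule ideal_diff[OF prime_ideal[OF pk'] 1 2])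
    also have "(\<Sum>e\<in>E'. rest e) - (\<Sum>e\<in>E' - E''. rest e) = (\<Sum>e\<in>E''. rest e)"
      using finE' by (subst sum.subset_diff[of E'' E']) (auto simp: E''_def)
    also have "\<dots> = (\<Sum>e\<in>E''. tm (Suc k) e)"
      by (rule sum.cong) (auto simp: E''_def rest_def)
    finally have "(\<Sum>e\<in>E''. tm (Suc k) e) \<in> P (Suc k)" .
    moreover have "E'' \<noteq> {}" using \<open>m \<in> (\<lambda>e. e k) ` E'\<close> by (auto simp: E''_def)
    moreover have "E'' \<subseteq> E" using E'(1) by (auto simp: E''_def)
    moreover have "e i = e' i" if "e \<in> E''" "e' \<in> E''" "i < Suc k" for e e' i
    proof (cases "i = k")
      case True
      with that show ?thesis by (simp add: E''_def)
    next
      case False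
      with that show ?thesis by (intro E'(3)) (simp_all add: E''_def)
    qed
    ultimately show ?case by blast
  qed
  from this[of "Suc ?n"] obtain E' where E': "E' \<subseteq> E" "E' \<noteq> {}"
      "\<And>e e' i. e \<in> E' \<Longrightarrow> e' \<in> E' \<Longrightarrow> i < Suc ?n \<Longrightarrow> e i = e' i"
      "(\<Sum>e\<in>E'. tm (Suc ?n) e) \<in> P (Suc ?n)" by blast
  obtain e where e: "e \<in> E'" using E'(2) by blast
  have "e' = e" if "e' \<in> E'" for e'
    using that e E'(1) E(3) E'(3)[OF that e] by (intro PiE_ext[of _ "{..?n}" "\<lambda>_. UNIV"]) auto
  then have "E' = {e}" using e by blast
  then have "single 0 (q e) \<in> P (Suc ?n)" using E'(4) by (simp add: tm_def)
  then have "single 0 (inverse (q e)) * single 0 (q e) \<in> P (Suc ?n)"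
    using prime[of "Suc ?n"] t by (intro ideal_mult[OF prime_ideal] polyring_single) auto
  moreover have "q e \<noteq> 0" using E(4) E'(1) e by blast
  ultimately have "1 \<in> P (Suc ?n)" by (simp add: mult_single)
  then show False using one_notin_prime[OF prime[of "Suc ?n"]] t by simp
qed

text \<open>\<open>P s\<close> may coincide with \<open>Q 0\<close>, so it is left out and
  \<open>Q 0\<close> takes its place.\<close>

lemma prime_chain_append:
  assumes "prime_chain V s P" "prime_chain V t Q" "P s \<subseteq> Q 0"
  shows "prime_chain V (s + t) (\<lambda>i. if i < s then P i else Q (i - s))"
  unfolding prime_chain_def
proof (intro conjI allI impI)
  fix i assume "i \<le> s + t"
  then show "is_prime V (if i < s then P i else Q (i - s))"
    using assms(1,2) by (auto simp: prime_chain_def)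
next
  fix i assume i: "i < s + t"
  consider "i + 1 < s" | "i + 1 = s" | "s \<le> i" by linarith
  then show "(if i < s then P i else Q (i - s)) \<subset> (if i + 1 < s then P (i + 1) else Q (i + 1 - s))"
  proof cases
    case 1
    then show ?thesis using assms(1) by (simp add: prime_chain_def)
  next
    case 2
    then have "P i \<subset> P s" using assms(1) unfolding prime_chain_def by (metis less_add_one)
    then show ?thesis using 2 assms(3) by auto
  next
    case 3
    then have "i - s < t" "Suc i - s = Suc (i - s)" using i by auto
    then show ?thesis using 3 assms(2) by (simp add: prime_chain_def)
  qed
qed

section \<open>Primes generated by variables\<close>

lemma sqf_singletons_iff:
  "p \<in> sqf V (singletons C) \<longleftrightarrow> p \<in> polyring V \<and> filt (\<lambda>m. keys m \<inter> C = {}) p = 0"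
proof -
  have "filt (\<lambda>m. keys m \<inter> C = {}) p = 0 \<longleftrightarrow> (\<forall>m\<in>keys p. keys m \<inter> C \<noteq> {})"
    using keys_filt[of "\<lambda>m. keys m \<inter> C = {}" p] keys_eq_empty[of "filt (\<lambda>m. keys m \<inter> C = {}) p"] by blast
  moreover have "(\<exists>e\<in>singletons C. e \<subseteq> keys m) \<longleftrightarrow> keys m \<inter> C \<noteq> {}" for m :: "'a \<Rightarrow>\<^sub>0 nat" by auto
  ultimately show ?thesis by (simp add: sqf_def)
qed

text \<open>The ideal is the kernel of the ring homomorphism that sets the variables in
  \<open>C\<close> to zero, with values in a domain.\<close>

lemma is_prime_singletons: "is_prime V (sqf V (singletons C) :: ('v, 'k::field) mpoly set)"
  unfolding is_prime_def
proof (intro conjI ballI impI)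
  show "is_ideal V (sqf V (singletons C) :: ('v, 'k) mpoly set)" by (rule is_ideal_sqf)
  have "(1 :: ('v, 'k) mpoly) \<notin> sqf V (singletons C)" by (simp add: sqf_def)
  then show "(sqf V (singletons C) :: ('v, 'k) mpoly set) \<noteq> polyring V" using polyring_one by blast
next
  fix a b :: "('v, 'k) mpoly"
  assume ab: "a \<in> polyring V" "b \<in> polyring V" "a * b \<in> sqf V (singletons C)"
  have "filt (\<lambda>m. keys m \<inter> C = {}) a * filt (\<lambda>m. keys m \<inter> C = {}) b = filt (\<lambda>m. keys m \<inter> C = {}) (a * b)"
    by (rule filt_mult[symmetric]) (auto simp: keys_plus_nat)
  also have "\<dots> = 0" using ab(3) by (simp add: sqf_singletons_iff)
  finally have "filt (\<lambda>m. keys m \<inter> C = {}) a = 0 \<or> filt (\<lambda>m. keys m \<inter> C = {}) b = 0"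
    using mpoly_no_zero_divisors by blast
  then show "a \<in> sqf V (singletons C) \<or> b \<in> sqf V (singletons C)"
    using ab by (simp add: sqf_singletons_iff)
qed

lemma Var_in_singletons: "v \<in> V \<Longrightarrow> (Var v :: ('v, 'k::field) mpoly) \<in> sqf V (singletons C) \<longleftrightarrow> v \<in> C"
  unfolding Var_def by (subst single_in_sqf) auto

lemma singletons_chain:
  assumes "finite D" "D \<subseteq> V" "C \<subseteq> V" "C \<inter> D = {}"
  shows "\<exists>P. prime_chain V (card D) P \<and> P 0 = (sqf V (singletons C) :: ('v, 'k::field) mpoly set)
     \<and> P (card D) = sqf V (singletons (C \<union> D))"
  using assms
proof (induction D rule: finite_induct)
  case empty
  show ?case by (intro exI[of _ "\<lambda>_. sqf V (singletons C)"]) (simp add: prime_chain_def is_prime_singletons)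
next
  case (insert d D)
  then obtain P where P: "prime_chain V (card D) P" "P 0 = (sqf V (singletons C) :: ('v, 'k) mpoly set)"
      "P (card D) = sqf V (singletons (C \<union> D))" by auto
  have dV: "d \<in> V" using insert.prems by simp
  define Q where "Q i = (if i = 0 then sqf V (singletons (C \<union> D)) else sqf V (singletons (insert d (C \<union> D))) :: ('v, 'k) mpoly set)" for i :: nat
  have "sqf V (singletons (C \<union> D)) \<subseteq> (sqf V (singletons (insert d (C \<union> D))) :: ('v, 'k) mpoly set)"
    by (auto simp: sqf_def)
  moreover have "(Var d :: ('v, 'k) mpoly) \<in> sqf V (singletons (insert d (C \<union> D)))"
    "(Var d :: ('v, 'k) mpoly) \<notin> sqf V (singletons (C \<union> D))"
    unfolding Var_in_singletons[OF dV] using insert.prems insert.hyps by auto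
  ultimately have "Q 0 \<subset> Q 1" by (auto simp: Q_def simp del: image_insert)
  moreover have "is_prime V (Q i)" for i by (simp add: Q_def is_prime_singletons del: image_insert)
  ultimately have Q: "prime_chain V 1 Q" by (simp add: prime_chain_def)
  let ?R = "\<lambda>i. if i < card D then P i else Q (i - card D)"
  have "prime_chain V (card D + 1) ?R"
    by (rule prime_chain_append[OF P(1) Q]) (simp add: P(3) Q_def)
  moreover have "?R 0 = sqf V (singletons C)" using P(2,3) by (cases "card D = 0") (auto simp: Q_def)
  moreover have "?R (card D + 1) = sqf V (singletons (C \<union> insert d D))" by (simp add: Q_def)
  moreover have "card (insert d D) = card D + 1" using insert.hyps by simp
  ultimately show ?case by (intro exI[of _ ?R]) (simp only: simp_thms)
qed

text \<open>Adjoining the variables in \<open>C\<close> one at a time gives a chain of length |C|.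
  Conversely, any chain ending here can be prolonged by the |V - C| other variables, and the total
  length is at most |V|.\<close>

lemma height_singletons:
  assumes "finite V" "C \<subseteq> V"
  shows "height V (sqf V (singletons C) :: ('v, 'k::field) mpoly set) = card C"
  unfolding height_def
proof (rule cSup_eq_maximum)
  have "finite C" using assms(2,1) by (rule finite_subset)
  obtain P where "prime_chain V (card C) P" "P (card C) = (sqf V (singletons ({} \<union> C)) :: ('v, 'k) mpoly set)"
    using singletons_chain[OF \<open>finite C\<close> assms(2), of "{}"] by auto
  then show "card C \<in> {t. \<exists>P. prime_chain V t P \<and> P t = (sqf V (singletons C) :: ('v, 'k) mpoly set)}" by auto
next
  fix t assume "t \<in> {t. \<exists>P. prime_chain V t P \<and> P t = (sqf V (singletons C) :: ('v, 'k) mpoly set)}"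
  then obtain P where P: "prime_chain V t P" "P t = (sqf V (singletons C) :: ('v, 'k) mpoly set)" by blast
  have "finite (V - C)" using assms by simp
  then obtain Q where Q: "prime_chain V (card (V - C)) Q" "Q 0 = (sqf V (singletons C) :: ('v, 'k) mpoly set)"
    using singletons_chain[of "V - C" V C] assms(2) by auto
  have "t + card (V - C) \<le> card V"
    using prime_chain_length[OF assms(1) prime_chain_append[OF P(1) Q(1)]] P(2) Q(2) by simp
  then show "t \<le> card C"
    using assms by (simp add: card_Diff_subset finite_subset)
qed

section \<open>Vertex covers, minimal primes and dimension\<close>

definition cover :: "'v set \<Rightarrow> 'v set set \<Rightarrow> 'v set \<Rightarrow> bool" where
  "cover V F C \<longleftrightarrow> C \<subseteq> V \<and> (\<forall>e\<in>F. e \<inter> C \<noteq> {})"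

definition min_cover :: "'v set \<Rightarrow> 'v set set \<Rightarrow> 'v set \<Rightarrow> bool" where
  "min_cover V F C \<longleftrightarrow> cover V F C \<and> (\<forall>D. cover V F D \<longrightarrow> D \<subseteq> C \<longrightarrow> D = C)"

lemma sqf_subset_singletons:
  assumes "cover V F C"
  shows "sqf V F \<subseteq> sqf V (singletons C)"
proof
  fix p :: "('a, 'b) mpoly" assume p: "p \<in> sqf V F"
  show "p \<in> sqf V (singletons C)"
  proof (rule sqfI[OF sqfD(1)[OF p]])
    fix m assume "m \<in> keys p"
    then obtain e where "e \<in> F" "e \<subseteq> keys m" using sqfD(2)[OF p] by blast
    moreover then obtain v where "v \<in> e" "v \<in> C" using assms unfolding cover_def by blast
    ultimately show "\<exists>e\<in>singletons C. e \<subseteq> keys m" by auto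
  qed
qed

text \<open>A prime containing x_e contains one of its variables. So below each prime over the ideal
  there is a prime generated by the variables of a cover.\<close>

lemma prime_contains_cover:
  fixes Q :: "('v, 'k::field) mpoly set"
  assumes fin: "finite V" and F: "\<And>e. e \<in> F \<Longrightarrow> e \<subseteq> V" and Q: "is_prime V Q" and sub: "sqf V F \<subseteq> Q"
  shows "cover V F {v\<in>V. Var v \<in> Q}" and "sqf V (singletons {v\<in>V. Var v \<in> Q}) \<subseteq> Q"
proof -
  have prod: "\<exists>v\<in>e. Var v \<in> Q" if "finite e" "e \<subseteq> V" "(\<Prod>v\<in>e. Var v) \<in> Q" for e
    using that
  proof (induction e rule: finite_induct)
    case empty
    then show ?case using one_notin_prime[OF Q] by simp
  next
    case (insert v e)
    have "Var v * (\<Prod>v\<in>e. Var v) \<in> Q" using insert.prems(2) insert.hyps by simp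
    moreover have "Var v \<in> polyring V" "(\<Prod>v\<in>e. Var v) \<in> polyring V"
      using insert.prems(1) by (auto intro!: polyring_Var polyring_prod)
    ultimately have "Var v \<in> Q \<or> (\<Prod>v\<in>e. Var v) \<in> Q" by (intro primeD[OF Q])
    then show ?case using insert.IH insert.prems(1) by auto
  qed
  show "cover V F {v\<in>V. Var v \<in> Q}"
    unfolding cover_def
  proof (intro conjI ballI)
    fix e assume e: "e \<in> F"
    have fe: "finite e" using F[OF e] fin by (rule finite_subset)
    have "(\<Prod>v\<in>e. Var v) \<in> (sqf V F :: ('v, 'k) mpoly set)"
      using e F[OF e] by (auto simp: prod_Var[OF fe] single_in_sqf keys_sum_single[OF fe])
    then have "(\<Prod>v\<in>e. Var v) \<in> Q" using sub by blast
    then show "e \<inter> {v\<in>V. Var v \<in> Q} \<noteq> {}" using prod[OF fe F[OF e]] F[OF e] by blast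
  qed auto
  show "sqf V (singletons {v\<in>V. Var v \<in> Q}) \<subseteq> Q"
  proof
    fix p :: "('v, 'k) mpoly" assume p: "p \<in> sqf V (singletons {v\<in>V. Var v \<in> Q})"
    show "p \<in> Q"
    proof (rule in_ideal_if_monomials_in_ideal[OF prime_ideal[OF Q] sqfD(1)[OF p]])
      fix m assume m: "m \<in> keys p"
      then obtain v where v: "v \<in> keys m" "Var v \<in> Q" using sqfD(2)[OF p m] by auto
      have s: "single v 1 + (m - single v 1) = m" using v(1) by (rule monomial_split)
      then have "keys (m - single v 1) \<subseteq> V"
        using polyringD[OF sqfD(1)[OF p] m] by (metis keys_plus_nat le_sup_iff)
      then have "single (m - single v 1) (lookup p m) * Var v \<in> Q"
        using v(2) by (intro ideal_mult[OF prime_ideal[OF Q]] polyring_single)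
      also have "single (m - single v 1) (lookup p m) * Var v = single m (lookup p m)"
        using s by (simp add: Var_def mult_single add.commute)
      finally show "single m (lookup p m) \<in> Q" .
    qed
  qed
qed

lemma minimal_primes_sqf:
  assumes fin: "finite V" and F: "\<And>e. e \<in> F \<Longrightarrow> e \<subseteq> V"
  shows "minimal_primes V (sqf V F :: ('v, 'k::field) mpoly set) = (\<lambda>C. sqf V (singletons C)) ` {C. min_cover V F C}"
proof (intro equalityI subsetI)
  fix Q :: "('v, 'k) mpoly set" assume "Q \<in> minimal_primes V (sqf V F)"
  then have Q: "is_prime V Q" "sqf V F \<subseteq> Q"
    and min: "\<And>R. is_prime V R \<Longrightarrow> sqf V F \<subseteq> R \<Longrightarrow> R \<subseteq> Q \<Longrightarrow> R = Q"
    unfolding minimal_primes_def by blast+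
  let ?C = "{v\<in>V. Var v \<in> Q}"
  note cov = prime_contains_cover[OF fin F Q]
  have eq: "sqf V (singletons ?C) = Q"
    by (rule min[OF is_prime_singletons sqf_subset_singletons[OF cov(1)] cov(2)])
  have "D = ?C" if D: "cover V F D" "D \<subseteq> ?C" for D
  proof -
    have "sqf V (singletons D) \<subseteq> (sqf V (singletons ?C) :: ('v, 'k) mpoly set)"
    proof
      fix p :: "('v, 'k) mpoly" assume p: "p \<in> sqf V (singletons D)"
      show "p \<in> sqf V (singletons ?C)"
      proof (rule sqfI[OF sqfD(1)[OF p]])
        fix m assume "m \<in> keys p"
        then obtain d where "d \<in> D" "d \<in> keys m" using sqfD(2)[OF p] by auto
        then show "\<exists>e\<in>singletons ?C. e \<subseteq> keys m"
          using D(2) by (intro bexI[of _ "{d}"] imageI) auto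
      qed
    qed
    then have "sqf V (singletons D) \<subseteq> Q" unfolding eq .
    then have "sqf V (singletons D) = Q"
      by (rule min[OF is_prime_singletons sqf_subset_singletons[OF D(1)]])
    then have "v \<in> D \<longleftrightarrow> Var v \<in> Q" if "v \<in> V" for v
      using Var_in_singletons[OF that, of D, where 'k = 'k] by simp
    moreover have "D \<subseteq> V" using D(1) by (simp add: cover_def)
    ultimately show ?thesis by blast
  qed
  then have "min_cover V F ?C" using cov(1) unfolding min_cover_def by blast
  then show "Q \<in> (\<lambda>C. sqf V (singletons C)) ` {C. min_cover V F C}"
    by (intro image_eqI[of _ _ ?C]) (simp_all only: eq mem_Collect_eq)
next
  fix Q :: "('v, 'k) mpoly set" assume "Q \<in> (\<lambda>C. sqf V (singletons C)) ` {C. min_cover V F C}"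
  then obtain C where C: "min_cover V F C" "Q = sqf V (singletons C)" by blast
  have cov: "cover V F C" using C(1) by (simp add: min_cover_def)
  have "R = Q" if R: "is_prime V R" "sqf V F \<subseteq> R" "R \<subseteq> Q" for R
  proof -
    let ?D = "{v\<in>V. Var v \<in> R}"
    note D = prime_contains_cover[OF fin F R(1,2)]
    have "?D \<subseteq> C"
    proof
      fix v assume "v \<in> ?D"
      then have "v \<in> V" "(Var v :: ('v, 'k) mpoly) \<in> sqf V (singletons C)" using R(3) C(2) by blast+
      then show "v \<in> C" by (simp add: Var_in_singletons)
    qed
    then have "?D = C" using C(1) D(1) unfolding min_cover_def by blast
    then have "Q \<subseteq> R" using D(2) C(2) by simp
    then show ?thesis using R(3) by blast
  qed
  moreover have "is_prime V Q" "sqf V F \<subseteq> Q"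
    unfolding C(2) by (rule is_prime_singletons, rule sqf_subset_singletons[OF cov])
  ultimately show "Q \<in> minimal_primes V (sqf V F)"
    unfolding minimal_primes_def by blast
qed

text \<open>A chain above the ideal starts at a prime containing all variables of some cover, and
  can be prolonged downwards by adjoining these variables to 0. The bound on chains then leaves |V|
  minus the size of that cover.\<close>

lemma krull_dim_sqf:
  assumes fin: "finite V" and F: "\<And>e. e \<in> F \<Longrightarrow> e \<subseteq> V"
    and C: "cover V F C" "\<And>D. cover V F D \<Longrightarrow> card C \<le> card D"
  shows "krull_dim V (sqf V F :: ('v, 'k::field) mpoly set) = card V - card C"
  unfolding krull_dim_def
proof (rule cSup_eq_maximum)
  have CV: "C \<subseteq> V" using C(1) by (simp add: cover_def)
  have "finite (V - C)" using fin by simp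
  then obtain P where P: "prime_chain V (card (V - C)) P" "P 0 = (sqf V (singletons C) :: ('v, 'k) mpoly set)"
    using singletons_chain[of "V - C" V C] CV by auto
  have "card (V - C) = card V - card C" using CV fin by (simp add: card_Diff_subset finite_subset)
  then show "card V - card C \<in> {t. \<exists>P. prime_chain V t P \<and> (sqf V F :: ('v, 'k) mpoly set) \<subseteq> P 0}"
    using P sqf_subset_singletons[OF C(1)] by (intro CollectI exI[of _ P]) simp
next
  fix t assume "t \<in> {t. \<exists>P. prime_chain V t P \<and> (sqf V F :: ('v, 'k) mpoly set) \<subseteq> P 0}"
  then obtain P where P: "prime_chain V t P" "(sqf V F :: ('v, 'k) mpoly set) \<subseteq> P 0" by blast
  have "is_prime V (P 0)" using P(1) by (simp add: prime_chain_def)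
  let ?D = "{v\<in>V. Var v \<in> P 0}"
  note D = prime_contains_cover[OF fin F \<open>is_prime V (P 0)\<close> P(2)]
  have "finite ?D" using fin by simp
  then obtain Q where Q: "prime_chain V (card ?D) Q" "Q (card ?D) = (sqf V (singletons ({} \<union> ?D)) :: ('v, 'k) mpoly set)"
    using singletons_chain[of ?D V "{}"] by auto
  have "card ?D + t \<le> card V"
    using prime_chain_length[OF fin prime_chain_append[OF Q(1) P(1)]] Q(2) D(2) by simp
  then show "t \<le> card V - card C" using C(2)[OF D(1)] by simp
qed

section \<open>Graphs\<close>

definition del_set :: "'v graph \<Rightarrow> 'v set \<Rightarrow> 'v graph" where
  "del_set H X = (fst H - X, {e\<in>snd H. e \<inter> X = {}})"

definition nbhd :: "'v graph \<Rightarrow> 'v \<Rightarrow> 'v set" where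
  "nbhd H v = {u. adj H v u}"

lemma adj_commute: "adj H u v \<longleftrightarrow> adj H v u"
  by (auto simp: adj_def insert_commute)

lemma not_adj_self [simp]: "\<not> adj H v v"
  by (simp add: adj_def)

lemma edge_subset: "is_graph H \<Longrightarrow> e \<in> snd H \<Longrightarrow> e \<subseteq> fst H"
  by (simp add: is_graph_def)

lemma adj_vertices: "is_graph H \<Longrightarrow> adj H u v \<Longrightarrow> u \<in> fst H \<and> v \<in> fst H"
  using edge_subset[of H "{u, v}"] by (simp add: adj_def)

lemma edge_eq:
  assumes "is_graph H" "e \<in> snd H" "v \<in> e"
  obtains u where "e = {v, u}" "adj H v u"
proof -
  have "card e = 2" using assms by (simp add: is_graph_def)
  then obtain a b where "e = {a, b}" "a \<noteq> b" by (auto simp: card_2_iff)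
  then have "(e = {v, b} \<and> v \<noteq> b) \<or> (e = {v, a} \<and> v \<noteq> a)" using assms(3) by auto
  then show ?thesis using that assms(2) by (auto simp: adj_def)
qed

lemma edge_nonempty: "is_graph H \<Longrightarrow> e \<in> snd H \<Longrightarrow> e \<noteq> {}"
  by (auto simp: is_graph_def)

lemma nbhd_subset: "is_graph H \<Longrightarrow> nbhd H v \<subseteq> fst H - {v}"
  using adj_vertices[of H v] by (auto simp: nbhd_def)

lemma hereditary_del_set:
  assumes "hereditary \<G>" "H \<in> \<G>" "finite X" "X \<subseteq> fst H"
  shows "del_set H X \<in> \<G>"
  using assms(3,4)
proof (induction X rule: finite_induct)
  case empty
  have "del_set H {} = H" by (simp add: del_set_def)
  then show ?case using assms(2) by simp
next
  case (insert x X)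
  have "x \<in> fst (del_set H X)" using insert.prems insert.hyps by (simp add: del_set_def)
  moreover have "del_set H X \<in> \<G>" using insert by simp
  ultimately have "del_vertex (del_set H X) x \<in> \<G>" using assms(1) by (simp add: hereditary_def)
  moreover have "del_vertex (del_set H X) x = del_set H (insert x X)"
    by (auto simp: del_vertex_def del_set_def)
  ultimately show ?case by simp
qed

subsection \<open>Domination numbers\<close>

lemma dom_num_le: "dominating G A \<Longrightarrow> dom_num G \<le> card A"
  unfolding dom_num_def by (rule Least_le) blast

lemma dom_num_attained:
  obtains A where "dominating G A" "card A = dom_num G"
proof -
  have "dominating G (fst G)" by (simp add: dominating_def)
  then have "\<exists>k A. dominating G A \<and> card A = k" by blast
  then have "\<exists>A. dominating G A \<and> card A = dom_num G" unfolding dom_num_def by (rule LeastI_ex)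
  then show ?thesis using that by blast
qed

lemma indep_dom_num_le: "dominating G A \<Longrightarrow> independent G A \<Longrightarrow> indep_dom_num G \<le> card A"
  unfolding indep_dom_num_def by (rule Least_le) blast

text \<open>In a maximal independent set no undominated vertex can be added. Hence the minimum in
  \<open>indep_dom_num\<close> is attained.\<close>

lemma indep_dominating_exists:
  assumes "is_graph G"
  shows "\<exists>A. dominating G A \<and> independent G A"
proof -
  have fin: "finite {A. independent G A}"
    by (rule finite_subset[of _ "Pow (fst G)"]) (use assms in \<open>auto simp: independent_def is_graph_def\<close>)
  have "{} \<in> {A. independent G A}" by (simp add: independent_def)
  then have ne: "{A. independent G A} \<noteq> {}" by blast
  obtain A where A: "independent G A" "\<forall>B\<in>{A. independent G A}. A \<subseteq> B \<longrightarrow> A = B"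
    using finite_has_maximal[OF fin ne] by blast
  have "\<exists>a\<in>A. adj G x a" if x: "x \<in> fst G - A" for x
  proof (rule ccontr)
    assume no: "\<not> (\<exists>a\<in>A. adj G x a)"
    have "\<not> adj G a b" if ab: "a \<in> insert x A" "b \<in> insert x A" for a b
    proof -
      consider "a = x" "b = x" | "a = x" "b \<in> A" | "a \<in> A" "b = x" | "a \<in> A" "b \<in> A" using ab by blast
      then show ?thesis
      proof cases
        case 3
        then show ?thesis using no adj_commute[of G a b] by blast
      next
        case 4
        then show ?thesis using A(1) unfolding independent_def by blast
      qed (use no in simp_all)
    qed
    moreover have "insert x A \<subseteq> fst G" using x A(1) by (simp add: independent_def)
    ultimately have "independent G (insert x A)" unfolding independent_def by blast
    then have "insert x A = A" by (intro A(2)[rule_format, symmetric]) auto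
    then have "x \<in> A" using insertI1[of x A] by metis
    then show False using x by simp
  qed
  then have "dominating G A" using A(1) unfolding dominating_def independent_def by blast
  then show ?thesis using A(1) by blast
qed

lemma indep_dom_num_attained:
  assumes "is_graph G"
  obtains A where "dominating G A" "independent G A" "card A = indep_dom_num G"
proof -
  have "\<exists>k A. dominating G A \<and> independent G A \<and> card A = k"
    using indep_dominating_exists[OF assms] by blast
  then have "\<exists>A. dominating G A \<and> independent G A \<and> card A = indep_dom_num G"
    unfolding indep_dom_num_def by (rule LeastI_ex)
  then show ?thesis using that by blast
qed

lemma card_dominating_le: "is_graph G \<Longrightarrow> dominating G A \<Longrightarrow> card A \<le> card (fst G)"
  by (intro card_mono) (auto simp: is_graph_def dominating_def)

lemma dominating_insert:
  assumes "v \<in> fst G" "dominating (del_set G (insert v (nbhd G v))) A"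
  shows "dominating G (insert v A)"
  unfolding dominating_def
proof (intro conjI ballI)
  show "insert v A \<subseteq> fst G" using assms by (auto simp: dominating_def del_set_def)
  fix x assume x: "x \<in> fst G - insert v A"
  show "\<exists>a\<in>insert v A. adj G x a"
  proof (cases "adj G v x")
    case True
    then show ?thesis using adj_commute[of G v x] by blast
  next
    case False
    then have "x \<in> fst (del_set G (insert v (nbhd G v))) - A" using x by (simp add: del_set_def nbhd_def)
    then obtain a where "a \<in> A" "adj (del_set G (insert v (nbhd G v))) x a"
      using assms(2) unfolding dominating_def by blast
    then show ?thesis by (auto simp: adj_def del_set_def)
  qed
qed

lemma independent_insert:
  assumes "v \<in> fst G" "independent (del_set G (insert v (nbhd G v))) A"
  shows "independent G (insert v A)"
proof -
  have A: "a \<in> fst G" "a \<noteq> v" "\<not> adj G v a" if "a \<in> A" for a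
    using assms(2) that by (auto simp: independent_def del_set_def nbhd_def)
  have AA: "\<not> adj G a b" if ab: "a \<in> A" "b \<in> A" for a b
  proof
    assume adj: "adj G a b"
    have "{a, b} \<inter> insert v (nbhd G v) = {}" using A[OF ab(1)] A[OF ab(2)] by (auto simp: nbhd_def)
    then have "adj (del_set G (insert v (nbhd G v))) a b" using adj by (simp add: adj_def del_set_def)
    then show False using assms(2) ab by (simp add: independent_def)
  qed
  have "\<not> adj G a b" if ab: "a \<in> insert v A" "b \<in> insert v A" for a b
  proof -
    consider "a = v" "b = v" | "a = v" "b \<in> A" | "a \<in> A" "b = v" | "a \<in> A" "b \<in> A" using ab by blast
    then show ?thesis
    proof cases
      case 3
      then show ?thesis using A(3)[of a] adj_commute[of G a v] by blast
    qed (use A(3) AA in simp_all)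
  qed
  moreover have "insert v A \<subseteq> fst G" using assms(1) A(1) by blast
  ultimately show ?thesis unfolding independent_def by blast
qed

text \<open>Adding \<open>v\<close> to a set for the smaller graph dominates the deleted neighbours
  and preserves independence, since that set contains no neighbour of \<open>v\<close>.\<close>

lemma domination_del_closed_nbhd:
  assumes f: "f = dom_num \<or> f = indep_dom_num" and v: "v \<in> fst G"
    and graph: "is_graph (del_set G (insert v (nbhd G v)))"
  shows "f G \<le> f (del_set G (insert v (nbhd G v))) + 1"
  using f
proof
  assume f: "f = dom_num"
  obtain A where A: "dominating (del_set G (insert v (nbhd G v))) A"
      "card A = dom_num (del_set G (insert v (nbhd G v)))"
    by (rule dom_num_attained)
  have "dom_num G \<le> card (insert v A)" by (rule dom_num_le[OF dominating_insert[OF v A(1)]])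
  also have "\<dots> \<le> card A + 1" using card_insert_le_m1[of "card A + 1" A v] by simp
  finally show ?thesis using A(2) f by simp
next
  assume f: "f = indep_dom_num"
  obtain A where A: "dominating (del_set G (insert v (nbhd G v))) A"
      "independent (del_set G (insert v (nbhd G v))) A"
      "card A = indep_dom_num (del_set G (insert v (nbhd G v)))"
    by (rule indep_dom_num_attained[OF graph])
  have "indep_dom_num G \<le> card (insert v A)"
    by (rule indep_dom_num_le[OF dominating_insert[OF v A(1)] independent_insert[OF v A(2)]])
  also have "\<dots> \<le> card A + 1" using card_insert_le_m1[of "card A + 1" A v] by simp
  finally show ?thesis using A(3) f by simp
qed

lemma domination_le_card:
  assumes "f = dom_num \<or> f = indep_dom_num" "is_graph G"
  shows "f G \<le> card (fst G)"
  using assms(1)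
proof
  assume f: "f = dom_num"
  obtain A where A: "dominating G A" "card A = dom_num G" by (rule dom_num_attained)
  show ?thesis using card_dominating_le[OF assms(2) A(1)] A(2) f by simp
next
  assume f: "f = indep_dom_num"
  obtain A where A: "dominating G A" "independent G A" "card A = indep_dom_num G"
    by (rule indep_dom_num_attained[OF assms(2)])
  show ?thesis using card_dominating_le[OF assms(2) A(1)] A(3) f by simp
qed

subsection \<open>Splitting at a vertex\<close>

text \<open>The bound on the resolution and the regular sequence pass through the same exact sequences.\<close>
definition good :: "'k::field itself \<Rightarrow> 'v set \<Rightarrow> 'v set set \<Rightarrow> nat \<Rightarrow> bool" where
  "good TYPE('k) V F t \<longleftrightarrow>
     (\<exists>m. m + t \<le> card V \<and> resolvable V (sqf V F :: ('v, 'k) mpoly set) m)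
     \<and> reg V (sqf V F :: ('v, 'k) mpoly set) (\<lambda>i. esym V (Suc i)) t"

lemma good_split:
  assumes v: "v \<in> V" and c: "good TYPE('k::field) V ((\<lambda>e. e - {v}) ` F) t"
    and a: "good TYPE('k) V (insert {v} F) t"
  shows "good TYPE('k) V F t"
proof -
  let ?J = "sqf V F :: ('a, 'k) mpoly set"
  have Var: "(Var v :: ('a, 'k) mpoly) \<in> polyring V" using v by (rule polyring_Var)
  obtain m1 where m1: "m1 + t \<le> card V" "resolvable V (colon V ?J (Var v)) m1"
    using c unfolding good_def colon_sqf[OF v] by blast
  obtain m2 where m2: "m2 + t \<le> card V" "resolvable V (adjoin V ?J (Var v)) m2"
    using a unfolding good_def adjoin_sqf[OF v] by blast
  have "resolvable V ?J (max m1 m2)"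
    by (rule resolvable_split[OF is_ideal_sqf Var resolvable_mono[OF m1(2)] resolvable_mono[OF m2(2)]]) simp_all
  moreover have "max m1 m2 + t \<le> card V" using m1(1) m2(1) by simp
  moreover have "reg V ?J (\<lambda>i. esym V (Suc i)) t"
  proof (rule reg_split[OF is_ideal_sqf Var esym_polyring])
    show "reg V (colon V ?J (Var v)) (\<lambda>i. esym V (Suc i)) t"
      using c unfolding good_def colon_sqf[OF v] by blast
    show "reg V (adjoin V ?J (Var v)) (\<lambda>i. esym V (Suc i)) t"
      using a unfolding good_def adjoin_sqf[OF v] by blast
  qed
  ultimately show ?thesis unfolding good_def by blast
qed

text \<open>Each new variable is a nonzerodivisor modulo the earlier ones and costs one step of the
  resolution.\<close>

lemma resolvable_singletons:
  assumes "finite W" "W \<subseteq> V"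
  shows "resolvable V (sqf V (singletons W) :: ('v, 'k::field) mpoly set) (card W)"
  using assms
proof (induction W rule: finite_induct)
  case empty
  have "p = 0" if "p \<in> sqf V {}" for p :: "('v, 'k) mpoly"
  proof -
    have "m \<notin> keys p" for m using sqfD(2)[OF that, of m] by auto
    then have "keys p = {}" by blast
    then show ?thesis by simp
  qed
  then have "sqf V {} = ({0} :: ('v, 'k) mpoly set)" using ideal_zero[OF is_ideal_sqf] by blast
  then show ?case using resolvable_zero by simp
next
  case (insert w W)
  have w: "w \<in> V" using insert.prems by simp
  have "resolvable V (adjoin V (sqf V (singletons W) :: ('v, 'k) mpoly set) (Var w)) (Suc (card W))"
  proof (rule resolvable_adjoin_nonzerodivisor[OF is_ideal_sqf polyring_Var[OF w]])
    show "resolvable V (sqf V (singletons W) :: ('v, 'k) mpoly set) (card W)" using insert by simp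
    fix p :: "('v, 'k) mpoly" assume p: "p \<in> polyring V" "Var w * p \<in> sqf V (singletons W)"
    show "p \<in> sqf V (singletons W)"
      by (rule sqf_Var_nonzerodivisor[OF w _ p]) (use insert.hyps in auto)
  qed
  then show ?case unfolding adjoin_singletons[OF w] using insert.hyps by simp
qed

lemma good_singletons:
  assumes "finite V" "W \<subseteq> V" "t + card W \<le> card V"
  shows "good TYPE('k::field) V (singletons W) t"
proof -
  have "card (V - W) = card V - card W" using assms by (simp add: card_Diff_subset finite_subset)
  then have "reg V (sqf V (singletons W) :: ('a, 'k) mpoly set) (\<lambda>i. esym V (Suc i)) t"
    using assms by (intro reg_esym) simp_all
  moreover have "card W + t \<le> card V" using assms(3) by simp
  moreover have "resolvable V (sqf V (singletons W) :: ('a, 'k) mpoly set) (card W)"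
    using finite_subset[OF assms(2,1)] assms(2) by (rule resolvable_singletons)
  ultimately show ?thesis unfolding good_def by blast
qed

lemma good_cong:
  assumes "\<And>X. X \<subseteq> V \<Longrightarrow> (\<exists>e\<in>F. e \<subseteq> X) \<longleftrightarrow> (\<exists>e\<in>F'. e \<subseteq> X)"
  shows "good TYPE('k::field) V F t \<longleftrightarrow> good TYPE('k) V F' t"
proof -
  have "(sqf V F :: ('a, 'k) mpoly set) = sqf V F'" by (rule sqf_cong) (rule assms)
  then show ?thesis by (simp add: good_def)
qed

text \<open>An edge through \<open>v\<close> shrinks to the opposite neighbour, and these variables
  make every edge that meets the neighbourhood redundant. What remains is the graph without the
  closed neighbourhood, and \<open>v\<close> occurs in no generator.\<close>

lemma good_colon_graph:
  assumes G: "is_graph H" and W: "fst H \<inter> W = {}" and v: "v \<in> fst H"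
  shows "good TYPE('k::field) V ((\<lambda>e. e - {v}) ` (snd H \<union> singletons W)) t \<longleftrightarrow>
    good TYPE('k) V (snd (del_set H (insert v (nbhd H v))) \<union> singletons (W \<union> nbhd H v)) t"
proof (rule good_cong, rule iffI)
  fix X
  assume "\<exists>e\<in>(\<lambda>e. e - {v}) ` (snd H \<union> singletons W). e \<subseteq> X"
  then obtain e where e: "e \<in> snd H \<union> singletons W" "e - {v} \<subseteq> X" by blast
  show "\<exists>e\<in>snd (del_set H (insert v (nbhd H v))) \<union> singletons (W \<union> nbhd H v). e \<subseteq> X"
  proof (cases "e \<in> snd H")
    case True
    show ?thesis
    proof (cases "v \<in> e")
      case ve: True
      obtain u where u: "e = {v, u}" "adj H v u" using edge_eq[OF G True ve] .
      then have "{u} \<in> singletons (W \<union> nbhd H v)" "{u} \<subseteq> X" using e(2) by (auto simp: nbhd_def adj_def)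
      then show ?thesis by blast
    next
      case ve: False
      show ?thesis
      proof (cases "e \<inter> nbhd H v = {}")
        case True
        then have "e \<in> snd (del_set H (insert v (nbhd H v)))" using \<open>e \<in> snd H\<close> ve by (simp add: del_set_def)
        moreover have "e \<subseteq> X" using e(2) ve by blast
        ultimately show ?thesis by blast
      next
        case False
        then obtain u where "u \<in> e" "u \<in> nbhd H v" by blast
        then have "{u} \<in> singletons (W \<union> nbhd H v)" "{u} \<subseteq> X" using e(2) ve by auto
        then show ?thesis by blast
      qed
    qed
  next
    case False
    then obtain w where "w \<in> W" "e = {w}" using e(1) by blast
    then have "{w} \<in> singletons (W \<union> nbhd H v)" "{w} \<subseteq> X" using e(2) W v by auto
    then show ?thesis by blast
  qed
next
  fix X
  assume "\<exists>e\<in>snd (del_set H (insert v (nbhd H v))) \<union> singletons (W \<union> nbhd H v). e \<subseteq> X"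
  then obtain e where e: "e \<in> snd (del_set H (insert v (nbhd H v))) \<union> singletons (W \<union> nbhd H v)" "e \<subseteq> X" by blast
  then consider "e \<in> snd H" | w where "w \<in> W" "e = {w}" | u where "adj H v u" "e = {u}"
    by (auto simp: del_set_def nbhd_def)
  then have "\<exists>e'\<in>snd H \<union> singletons W. e' - {v} \<subseteq> e"
  proof cases
    case (3 u)
    then have "{v, u} \<in> snd H" "{v, u} - {v} \<subseteq> e" by (auto simp: adj_def)
    then show ?thesis by blast
  qed blast+
  then show "\<exists>e\<in>(\<lambda>e. e - {v}) ` (snd H \<union> singletons W). e \<subseteq> X" using e(2) by blast
qed

text \<open>Edges through \<open>v\<close> are redundant once \<open>v\<close> itself is a
  generator.\<close>

lemma good_adjoin_graph:
  "good TYPE('k::field) V (insert {v} (snd H \<union> singletons W)) t \<longleftrightarrow>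
    good TYPE('k) V (snd (del_vertex H v) \<union> singletons (insert v W)) t"
proof (rule good_cong)
  fix X
  have "(\<exists>e\<in>snd H. e \<subseteq> X) \<or> v \<in> X \<longleftrightarrow> (\<exists>e\<in>snd (del_vertex H v). e \<subseteq> X) \<or> v \<in> X"
    by (auto simp: del_vertex_def)
  then show "(\<exists>e\<in>insert {v} (snd H \<union> singletons W). e \<subseteq> X) \<longleftrightarrow>
      (\<exists>e\<in>snd (del_vertex H v) \<union> singletons (insert v W). e \<subseteq> X)"
    by (simp add: bex_Un) blast
qed

text \<open>|V| - |fst H| - |W| counts the variables absent from the graph and from
  \<open>W\<close>; the last inequality bounds \<open>t\<close> by this number plus
  \<open>f H\<close>. Deleting the closed neighbourhood of \<open>v\<close> moves the neighbours to
  \<open>W\<close> and frees \<open>v\<close>, which pays for a drop of \<open>f\<close> by one.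
  Deleting \<open>v\<close> alone moves it to \<open>W\<close> and frees nothing, but there
  \<open>f\<close> does not drop.\<close>

lemma good_graph:
  fixes \<G> :: "'v graph set"
  assumes f: "f = dom_num \<or> f = indep_dom_num" and graphs: "\<forall>G\<in>\<G>. is_graph G"
    and her: "hereditary \<G>"
    and ex: "\<forall>G\<in>\<G>. snd G \<noteq> {} \<longrightarrow> (\<exists>v\<in>fst G. f G \<le> f (del_vertex G v))"
    and V: "finite V"
    and "H \<in> \<G>" "fst H \<subseteq> V" "W \<subseteq> V" "fst H \<inter> W = {}" "t + card (fst H) + card W \<le> card V + f H"
  shows "good TYPE('k::field) V (snd H \<union> singletons W) t"
  using assms(6-10)
proof (induction "card (fst H)" arbitrary: H W rule: less_induct)
  case less
  have G: "is_graph H" using graphs less.prems(1) by blast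
  have finH: "finite (fst H)" using G by (simp add: is_graph_def)
  have finW: "finite W" using less.prems(3) V by (rule finite_subset)
  show ?case
  proof (cases "snd H = {}")
    case True
    have "f H \<le> card (fst H)" by (rule domination_le_card[OF f G])
    then have "t + card W \<le> card V" using less.prems(5) by simp
    then show ?thesis using good_singletons[OF V less.prems(3)] True by simp
  next
    case False
    then obtain v where v: "v \<in> fst H" "f H \<le> f (del_vertex H v)"
      using ex less.prems(1) by blast
    let ?N = "nbhd H v"
    let ?H = "del_set H (insert v ?N)"
    have N: "?N \<subseteq> fst H" "v \<notin> ?N" using nbhd_subset[OF G, of v] by blast+
    have finN: "finite ?N" using N(1) finH by (rule finite_subset)
    have H': "?H \<in> \<G>"
      using finN N(1) v(1) by (intro hereditary_del_set[OF her less.prems(1)]) simp_all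
    have fH': "f H \<le> f ?H + 1"
      by (rule domination_del_closed_nbhd[OF f v(1)]) (use graphs H' in blast)
    have cardH': "card (fst ?H) + 1 + card ?N = card (fst H)"
    proof -
      have "card (insert v ?N) = card ?N + 1" using finN N(2) by simp
      moreover have "card (fst H - insert v ?N) + card (insert v ?N) = card (fst H)"
      proof -
        have "insert v ?N \<subseteq> fst H" using N(1) v(1) by simp
        with finH finN show ?thesis
          by (simp add: card_Diff_subset card_mono del: card_insert_disjoint)
      qed
      ultimately show ?thesis by (simp add: del_set_def)
    qed
    have cardW': "card (W \<union> ?N) = card W + card ?N"
      using less.prems(4) N(1) finW finN by (intro card_Un_disjoint) auto
    have "good TYPE('k) V (snd ?H \<union> singletons (W \<union> ?N)) t"
    proof (rule less.hyps[OF _ H'])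
      show "card (fst ?H) < card (fst H)" using cardH' by simp
      show "fst ?H \<subseteq> V" "W \<union> ?N \<subseteq> V" using less.prems(2,3) N(1) by (auto simp: del_set_def)
      show "fst ?H \<inter> (W \<union> ?N) = {}" using less.prems(4) by (auto simp: del_set_def)
      show "t + card (fst ?H) + card (W \<union> ?N) \<le> card V + f ?H"
        using less.prems(5) cardH' cardW' fH' by simp
    qed
    then have c: "good TYPE('k) V ((\<lambda>e. e - {v}) ` (snd H \<union> singletons W)) t"
      by (rule good_colon_graph[OF G less.prems(4) v(1), THEN iffD2])
    have Hv: "del_vertex H v \<in> \<G>" using her less.prems(1) v(1) by (simp add: hereditary_def)
    have "card (fst (del_vertex H v)) + 1 = card (fst H)"
      using card.remove[OF finH v(1)] by (simp add: del_vertex_def)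
    have "good TYPE('k) V (snd (del_vertex H v) \<union> singletons (insert v W)) t"
    proof (rule less.hyps[OF _ Hv])
      show "card (fst (del_vertex H v)) < card (fst H)"
        using \<open>card (fst (del_vertex H v)) + 1 = card (fst H)\<close> by simp
      show "fst (del_vertex H v) \<subseteq> V" "insert v W \<subseteq> V"
        using less.prems(2,3) v(1) by (auto simp: del_vertex_def)
      show "fst (del_vertex H v) \<inter> insert v W = {}" using less.prems(4) by (auto simp: del_vertex_def)
      have "card (insert v W) = card W + 1" using finW less.prems(4) v(1) by (subst card_insert_disjoint) auto
      then show "t + card (fst (del_vertex H v)) + card (insert v W) \<le> card V + f (del_vertex H v)"
        using \<open>card (fst (del_vertex H v)) + 1 = card (fst H)\<close> less.prems(5) v(2) by simp
    qed
    then have a: "good TYPE('k) V (insert {v} (snd H \<union> singletons W)) t"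
      by (rule good_adjoin_graph[THEN iffD2])
    have "v \<in> V" using v(1) less.prems(2) by blast
    then show ?thesis using c a by (rule good_split)
  qed
qed

subsection \<open>Vertex covers\<close>

text \<open>A set is a cover when its complement is independent. It is minimal when each x in it is
  needed for some edge, that is, when x has a neighbour in the complement.\<close>

lemma min_cover_iff:
  assumes G: "is_graph G"
  shows "min_cover (fst G) (snd G) C \<longleftrightarrow>
    C \<subseteq> fst G \<and> independent G (fst G - C) \<and> dominating G (fst G - C)"
proof -
  let ?V = "fst G"
  have cov: "cover ?V (snd G) D \<longleftrightarrow> D \<subseteq> ?V \<and> independent G (?V - D)" for D
  proof
    assume D: "cover ?V (snd G) D"
    have "\<not> adj G a b" if "a \<in> ?V - D" "b \<in> ?V - D" for a b
    proof
      assume "adj G a b"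
      then have "{a, b} \<inter> D \<noteq> {}" using D unfolding cover_def adj_def by blast
      then show False using that by blast
    qed
    then show "D \<subseteq> ?V \<and> independent G (?V - D)" using D by (simp add: independent_def cover_def)
  next
    assume D: "D \<subseteq> ?V \<and> independent G (?V - D)"
    have "e \<inter> D \<noteq> {}" if e: "e \<in> snd G" for e
    proof
      assume no: "e \<inter> D = {}"
      obtain v where v: "v \<in> e" using edge_nonempty[OF G e] by blast
      obtain u where u: "e = {v, u}" "adj G v u" using edge_eq[OF G e v] .
      then have "v \<in> ?V - D" "u \<in> ?V - D" using no edge_subset[OF G e] by auto
      then show False using D u(2) unfolding independent_def by blast
    qed
    then show "cover ?V (snd G) D" using D by (simp add: cover_def)
  qed
  show ?thesis
  proof
    assume C: "min_cover ?V (snd G) C"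
    then have CV: "C \<subseteq> ?V" "independent G (?V - C)" and covC: "cover ?V (snd G) C"
      using cov[of C] by (auto simp: min_cover_def)
    have "\<exists>a\<in>?V - C. adj G x a" if x: "x \<in> ?V - (?V - C)" for x
    proof -
      have xC: "x \<in> C" using x by blast
      have "\<not> cover ?V (snd G) (C - {x})"
        using C xC unfolding min_cover_def by blast
      then obtain e where e: "e \<in> snd G" "e \<inter> (C - {x}) = {}"
        using CV(1) unfolding cover_def by blast
      have "e \<inter> C \<noteq> {}" using covC e(1) by (simp add: cover_def)
      then have "x \<in> e" using e(2) by blast
      obtain u where u: "e = {x, u}" "adj G x u" using edge_eq[OF G e(1) \<open>x \<in> e\<close>] .
      then have "u \<in> ?V - C" using e(2) edge_subset[OF G e(1)] by (auto simp: adj_def)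
      then show ?thesis using u(2) by blast
    qed
    then have "dominating G (?V - C)" by (simp add: dominating_def)
    then show "C \<subseteq> ?V \<and> independent G (?V - C) \<and> dominating G (?V - C)" using CV by blast
  next
    assume C: "C \<subseteq> ?V \<and> independent G (?V - C) \<and> dominating G (?V - C)"
    have "D = C" if D: "cover ?V (snd G) D" "D \<subseteq> C" for D
    proof (rule ccontr)
      assume "D \<noteq> C"
      then obtain x where x: "x \<in> C" "x \<notin> D" using D(2) by blast
      then obtain a where a: "a \<in> ?V - C" "adj G x a"
        using C unfolding dominating_def by blast
      then have "{x, a} \<inter> D \<noteq> {}" using D(1) unfolding cover_def adj_def by blast
      then show False using x a D(2) by blast
    qed
    then show "min_cover ?V (snd G) C" using cov[of C] C unfolding min_cover_def by blast
  qed
qed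

text \<open>The support \<open>A\<close> contains no edge by independence, but by domination it
  gains one with each further vertex.\<close>

lemma independent_monomial:
  assumes G: "is_graph G" and A: "independent G A" "dominating G A"
  defines "u \<equiv> (\<Prod>v\<in>A. Var v) :: ('v, 'k::field) mpoly"
  shows "u \<in> polyring (fst G)" and "u \<notin> sqf (fst G) (snd G)"
    and "\<And>c. c \<in> fst G - A \<Longrightarrow> Var c * u \<in> sqf (fst G) (snd G)"
proof -
  have AV: "A \<subseteq> fst G" using A(1) by (simp add: independent_def)
  have finA: "finite A" using AV G finite_subset by (auto simp: is_graph_def)
  show u: "u \<in> polyring (fst G)" unfolding u_def using AV by (intro polyring_prod polyring_Var) auto
  have keys_u: "keys u = {\<Sum>v\<in>A. single v (Suc 0)}" by (simp add: u_def prod_Var[OF finA])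
  show "u \<notin> sqf (fst G) (snd G)"
  proof
    assume "u \<in> sqf (fst G) (snd G)"
    then obtain e where e: "e \<in> snd G" "e \<subseteq> A"
      using sqfD(2)[of u "fst G" "snd G" "\<Sum>v\<in>A. single v (Suc 0)"] keys_u keys_sum_single[OF finA] by auto
    obtain v where v: "v \<in> e" using edge_nonempty[OF G e(1)] by blast
    obtain w where w: "e = {v, w}" "adj G v w" using edge_eq[OF G e(1) v] .
    then show False using A(1) e(2) by (auto simp: independent_def)
  qed
  fix c assume c: "c \<in> fst G - A"
  then obtain a where a: "a \<in> A" "adj G c a" using A(2) unfolding dominating_def by blast
  show "Var c * u \<in> sqf (fst G) (snd G)"
  proof (rule sqfI)
    show "Var c * u \<in> polyring (fst G)" using c u by auto
    fix m assume "m \<in> keys (Var c * u)"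
    then have "m = single c 1 + (\<Sum>v\<in>A. single v (Suc 0))" by (auto simp: keys_Var_mult keys_u)
    then have "keys m = insert c A" by (simp add: keys_plus_nat keys_sum_single[OF finA])
    moreover have "{c, a} \<in> snd G" using a(2) by (simp add: adj_def)
    ultimately show "\<exists>e\<in>snd G. e \<subseteq> keys m" using a(1) by (intro bexI[of _ "{c, a}"]) auto
  qed
qed

theorem theorem5p1:
  fixes \<G> :: "'v graph set" and f :: "'v graph \<Rightarrow> nat"
  assumes "f = dom_num \<or> f = indep_dom_num"
    and "\<forall>G\<in>\<G>. is_graph G"
    and "hereditary \<G>"
    and "\<forall>G\<in>\<G>. snd G \<noteq> {} \<longrightarrow> (\<exists>v\<in>fst G. f G \<le> f (del_vertex G v))"
  shows "(\<forall>G\<in>\<G>. pd TYPE('k::field) G \<le> card (fst G) - f G)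
    \<and> (f = indep_dom_num \<longrightarrow> (\<forall>G\<in>\<G>.
           pd TYPE('k::field) G = card (fst G) - indep_dom_num G
         \<and> card (fst G) - indep_dom_num G = bight (fst G) (edge_ideal G :: ('v, 'k) mpoly set)
         \<and> (cohen_macaulay (fst G) (edge_ideal G :: ('v, 'k) mpoly set)
              \<longleftrightarrow> unmixed (fst G) (edge_ideal G :: ('v, 'k) mpoly set))))"
proof -
  \<comment> \<open>The invariant of \<open>good_graph\<close> for the whole graph with empty
    \<open>W\<close>, where it reduces to t being at most f(G).\<close>
  have pd: "resolvable (fst G) (sqf (fst G) (snd G) :: ('v, 'k) mpoly set) (pd TYPE('k) G)"
      "pd TYPE('k) G \<le> card (fst G) - f G"
      "reg (fst G) (sqf (fst G) (snd G) :: ('v, 'k) mpoly set) (\<lambda>i. esym (fst G) (Suc i)) (f G)"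
    if G: "G \<in> \<G>" for G
  proof -
    have graph: "is_graph G" using assms(2) G by blast
    have "good TYPE('k) (fst G) (snd G \<union> singletons {}) (f G)"
      by (rule good_graph[OF assms _ G]) (use graph in \<open>auto simp: is_graph_def\<close>)
    then obtain m where m: "m + f G \<le> card (fst G)" "resolvable (fst G) (sqf (fst G) (snd G) :: ('v, 'k) mpoly set) m"
      and r: "reg (fst G) (sqf (fst G) (snd G) :: ('v, 'k) mpoly set) (\<lambda>i. esym (fst G) (Suc i)) (f G)"
      unfolding good_def by auto
    have pd_eq: "pd TYPE('k) G = (LEAST m. resolvable (fst G) (sqf (fst G) (snd G) :: ('v, 'k) mpoly set) m)"
      unfolding pd_def proj_dim_def resolvable_iff_free_resolution edge_ideal_eq_sqf[OF graph] ..
    show "resolvable (fst G) (sqf (fst G) (snd G) :: ('v, 'k) mpoly set) (pd TYPE('k) G)"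
      unfolding pd_eq using m(2) by (rule LeastI)
    have "pd TYPE('k) G \<le> m" unfolding pd_eq using m(2) by (rule Least_le)
    then show "pd TYPE('k) G \<le> card (fst G) - f G" using m(1) by simp
    show "reg (fst G) (sqf (fst G) (snd G) :: ('v, 'k) mpoly set) (\<lambda>i. esym (fst G) (Suc i)) (f G)" by (rule r)
  qed
  have "pd TYPE('k) G = card (fst G) - indep_dom_num G
         \<and> card (fst G) - indep_dom_num G = bight (fst G) (edge_ideal G :: ('v, 'k) mpoly set)
         \<and> (cohen_macaulay (fst G) (edge_ideal G :: ('v, 'k) mpoly set)
              \<longleftrightarrow> unmixed (fst G) (edge_ideal G :: ('v, 'k) mpoly set))"
    if f: "f = indep_dom_num" and GG: "G \<in> \<G>" for G
  proof -
    let ?V = "fst G" and ?i = "indep_dom_num G"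
    let ?J = "sqf (fst G) (snd G) :: ('v, 'k) mpoly set"
    have G: "is_graph G" using assms(2) GG by blast
    have fin: "finite ?V" using G by (simp add: is_graph_def)
    have J: "(edge_ideal G :: ('v, 'k) mpoly set) = ?J" by (rule edge_ideal_eq_sqf[OF G])
    have sub: "\<And>e. e \<in> snd G \<Longrightarrow> e \<subseteq> ?V" by (rule edge_subset[OF G])
    obtain A where A: "dominating G A" "independent G A" "card A = ?i"
      by (rule indep_dom_num_attained[OF G])
    have AV: "A \<subseteq> ?V" using A(1) by (simp add: dominating_def)
    have finA: "finite A" using AV fin by (rule finite_subset)
    define C where "C = ?V - A"
    have CV: "C \<subseteq> ?V" and VC: "?V - C = A" using AV by (auto simp: C_def)
    have cardC: "card C = card ?V - ?i" using AV finA A(3) by (simp add: C_def card_Diff_subset)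
    have ile: "?i \<le> card ?V" using A(3) card_mono[OF fin AV] by simp
    have C: "min_cover ?V (snd G) C" using min_cover_iff[OF G] CV VC A(1,2) by simp
    \<comment> \<open>Complements turn smallest independent dominating sets into largest minimal
      covers.\<close>
    have max: "card D \<le> card C" if D: "min_cover ?V (snd G) D" for D
    proof -
      have D': "D \<subseteq> ?V" "dominating G (?V - D)" "independent G (?V - D)"
        using D min_cover_iff[OF G] by blast+
      have "?i \<le> card (?V - D)" by (rule indep_dom_num_le[OF D'(2,3)])
      also have "card (?V - D) = card ?V - card D"
        using D'(1) fin by (simp add: card_Diff_subset finite_subset)
      finally show ?thesis using cardC card_mono[OF fin D'(1)] ile by simp
    qed
    note mono = independent_monomial[OF G A(2,1), where 'k = 'k]
    have ann: "Var c * (\<Prod>v\<in>A. Var v) \<in> ?J" if "c \<in> C" for c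
      using that unfolding C_def by (rule mono(3))
    have "card C \<le> pd TYPE('k) G"
      by (rule resolvable_lower_bound[OF is_ideal_sqf pd(1)[OF GG] CV mono(1,2) ann])
    then have 1: "pd TYPE('k) G = card ?V - ?i" using pd(2)[OF GG] cardC f by simp

    have heights: "height ?V ` minimal_primes ?V ?J = card ` {D. min_cover ?V (snd G) D}"
    proof -
      have "height ?V (sqf ?V (singletons D) :: ('v, 'k) mpoly set) = card D" if "min_cover ?V (snd G) D" for D
        using that by (intro height_singletons[OF fin]) (simp add: min_cover_def cover_def)
      moreover have "minimal_primes ?V ?J = (\<lambda>D. sqf ?V (singletons D)) ` {D. min_cover ?V (snd G) D}"
        by (rule minimal_primes_sqf[OF fin sub])
      ultimately show ?thesis by (simp add: image_image)
    qed
    have "bight ?V ?J = card C"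
      unfolding bight_def heights by (rule cSup_eq_maximum) (use C max in auto)
    then have 2: "card ?V - ?i = bight ?V ?J" using cardC by simp

    have depth: "depth ?V ?J = ?i"
      unfolding depth_def
    proof (rule cSup_eq_maximum)
      have "{} \<notin> snd G" using edge_nonempty[OF G] by blast
      from regular_seq_esym[OF fin this pd(3)[OF GG]]
      show "?i \<in> {t. \<exists>a. regular_seq ?V ?J a t}" using f by blast
      fix t assume "t \<in> {t. \<exists>a. regular_seq ?V ?J a t}"
      then obtain a where a: "regular_seq ?V ?J a t" by blast
      have "t + card C \<le> card ?V"
        by (rule regular_seq_length_bound[OF fin CV mono(1,2) ann a])
      then show "t \<le> ?i" using cardC ile by simp
    qed

    have covV: "cover ?V (snd G) ?V"
      using sub edge_nonempty[OF G] unfolding cover_def by blast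
    have "\<exists>D. cover ?V (snd G) D \<and> (\<forall>D'. cover ?V (snd G) D' \<longrightarrow> card D \<le> card D')"
      using ex_has_least_nat[of "cover ?V (snd G)" ?V card] covV by blast
    \<comment> \<open>A cover of smallest size, which determines the dimension; it is automatically
      a minimal cover.\<close>
    then obtain D where D: "cover ?V (snd G) D" "\<And>D'. cover ?V (snd G) D' \<Longrightarrow> card D \<le> card D'" by blast
    have dim: "krull_dim ?V ?J = card ?V - card D" by (rule krull_dim_sqf[OF fin sub D])
    have DV: "D \<subseteq> ?V" using D(1) by (simp add: cover_def)
    have Dmin: "min_cover ?V (snd G) D"
    proof -
      have "D' = D" if "cover ?V (snd G) D'" "D' \<subseteq> D" for D'
        using card_seteq[OF finite_subset[OF DV fin] that(2)] D(2)[OF that(1)] by blast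
      then show ?thesis using D(1) unfolding min_cover_def by blast
    qed
    \<comment> \<open>Depth is |V| - |C| and dimension is |V| - |D|, with \<open>C\<close> a largest
      and \<open>D\<close> a smallest minimal cover.\<close>
    have "cohen_macaulay ?V ?J \<longleftrightarrow> card D = card C"
      unfolding cohen_macaulay_def depth dim using cardC ile card_mono[OF fin DV] by auto
    also have "\<dots> \<longleftrightarrow> (\<forall>x\<in>card ` {D. min_cover ?V (snd G) D}. \<forall>y\<in>card ` {D. min_cover ?V (snd G) D}. x = y)"
    proof
      assume eq: "card D = card C"
      have "card E = card C" if E: "min_cover ?V (snd G) E" for E
      proof -
        have "card D \<le> card E" using D(2) E by (simp add: min_cover_def)
        then show ?thesis using max[OF E] eq by simp
      qed
      then show "\<forall>x\<in>card ` {D. min_cover ?V (snd G) D}. \<forall>y\<in>card ` {D. min_cover ?V (snd G) D}. x = y" by simp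
    next
      assume "\<forall>x\<in>card ` {D. min_cover ?V (snd G) D}. \<forall>y\<in>card ` {D. min_cover ?V (snd G) D}. x = y"
      then show "card D = card C" using C Dmin by blast
    qed
    also have "\<dots> \<longleftrightarrow> unmixed ?V ?J"
      unfolding unmixed_def heights[symmetric] by blast
    finally show ?thesis using 1 2 unfolding J by blast
  qed
  then show ?thesis using pd(2) by blast
qed

end
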